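(* Let $\mathbf{G}=(J,\mu,E)$ and $\mathbf{G}^*=(J^*,\mu^*,E^* )$ be a pair of dual planar graphings that are hyperfinite, with the canonical measure-preserving Borel bijection $\sigma:E\to E^*$. Then $\rho^*_{\mathbf{G}}=\rho_{\mathbf{G}^*}\circ\sigma$ and $\rho^*_{\mathbf{G}^*}\circ\sigma=\rho_{\mathbf{G}}$; that is, for every Borel $A\subseteq E$, $\rho^*_{\mathbf{G}}(A)=\rho_{\mathbf{G}^*}(\sigma(A))$ and $\rho^*_{\mathbf{G}^*}(\sigma(A))=\rho_{\mathbf{G}}(A)$.
   Context: A graphing $\mathbf{H}=(X,\nu,E_{\mathbf{H}})$: $X$ a standard Borel space with finite measure $\nu$ (a probability measure for $\mathbf{G}$), $E_{\mathbf{H}}\subseteq\binom{X}{2}$ Borel with bounded degrees, satisfying $\int_A\deg(B,x)\,d\nu(x)=\int_B\deg(A,x)\,d\nu(x)$ for measurable $A,B$. Edge measure $\eta_{\mathbf{H}}(F)=\frac12\int\deg_F(x)\,d\nu(x)$. Rank function $\rho_{\mathbf{H}}(F)=\int_X\big(1-\frac{1}{|V(\mathbf{H}^F_x)|}\big)\,d\nu(x)$ for Borel $F\subseteq E_{\mathbf{H}}$, where $\mathbf{H}^F_x$ is the component of $x$ in $(X,\nu,F)$ and $1/\infty=0$. Cocycle rank: $\rho^*_{\mathbf{H}}(A)=\rho_{\mathbf{H}}(E_{\mathbf{H}}\setminus A)+\eta_{\mathbf{H}}(A)-\rho_{\mathbf{H}}(E_{\mathbf{H}})$. $\mathbf{H}$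 is hyperfinite if for every $\varepsilon>0$ there is Borel $S$ with $\eta_{\mathbf{H}}(S)\le\varepsilon$ such that all components of $(X,\nu,E_{\mathbf{H}}\setminus S)$ are finite. Planar graphings: $\mathbf{G}$ is a graphing whose connected components are 2-vertex-connected planar graphs endowed with planar embeddings, encoded in a Borel way by the collection of facial cycles (a Borel set of finite subsets of $E$); the vertex sets have no accumulation points in the plane, and all faces are finite cycles of uniformly bounded length. The dual graphing $\mathbf{G}^*=(J^*,\mu^*,E^* )$ has vertex set $J^*$ the set of faces of $\mathbf{G}$, and there is a Borel bijection $\sigma:E\to E^*$, $e\mapsto e^*$, where $e^*$ joins the two faces having $e$ on their boundary; $\mu^*$ is the (finite, not necessarily probability) measure making $\mathbf{G}^*$ a graphing and $\sigma$ measure preserving from $\eta_{\mathbf{G}}$ to $\eta_{\mathbf{G}^*}$. The image under $\sigma$ of the star of a vertex of $\mathbf{G}$ is a facial cycle of $\mathbf{G}^*$ and vice versa. $\mathbf{G}$ is hyperfinite iff $\mathbf{G}^*$ is. *)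

theory Defs
  imports "HOL-Probability.Probability"
begin

section \<open>Graphings\<close>

text \<open>Vertices: a Polish type with its Borel sets (a standard Borel space).
  Edges: a symmetric irreflexive set of ordered pairs; an unordered edge {x,y}
  is represented by the two pairs (x,y), (y,x).  A Borel set of edges is a
  symmetric measurable subset of the edge set.\<close>

definition sym_edges :: "('a \<times> 'a) set \<Rightarrow> bool" where
  "sym_edges F \<longleftrightarrow> (\<forall>x y. (x, y) \<in> F \<longrightarrow> (y, x) \<in> F)"

definition nbrs :: "('a \<times> 'a) set \<Rightarrow> 'a \<Rightarrow> 'a set" where
  "nbrs F x = {y. (x, y) \<in> F}"

text \<open>deg(B,x): number of neighbours of x lying in B.\<close>
definition deg_in :: "('a \<times> 'a) set \<Rightarrow> 'a set \<Rightarrow> 'a \<Rightarrow> nat" where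
  "deg_in E B x = card {y \<in> B. (x, y) \<in> E}"

definition graphing :: "'a::polish_space measure \<Rightarrow> ('a \<times> 'a) set \<Rightarrow> bool" where
  "graphing M E \<longleftrightarrow>
     sets M = sets borel \<and> finite_measure M \<and>
     E \<in> sets (M \<Otimes>\<^sub>M M) \<and> sym_edges E \<and> (\<forall>x. (x, x) \<notin> E) \<and>
     (\<exists>d::nat. \<forall>x. finite (nbrs E x) \<and> card (nbrs E x) \<le> d) \<and>
     (\<forall>A \<in> sets M. \<forall>B \<in> sets M.
        (\<integral>\<^sup>+ x. ennreal (real (deg_in E B x)) * indicator A x \<partial>M) =
        (\<integral>\<^sup>+ x. ennreal (real (deg_in E A x)) * indicator B x \<partial>M))"

definition borel_edges :: "'a measure \<Rightarrow> ('a \<times> 'a) set \<Rightarrow> ('a \<times> 'a) set \<Rightarrow> bool" where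
  "borel_edges M E F \<longleftrightarrow> F \<subseteq> E \<and> sym_edges F \<and> F \<in> sets (M \<Otimes>\<^sub>M M)"

text \<open>Edge measure eta(F) = 1/2 * integral of deg_F.\<close>
definition edge_measure :: "'a measure \<Rightarrow> ('a \<times> 'a) set \<Rightarrow> real" where
  "edge_measure M F = (1/2) * (\<integral> x. real (card (nbrs F x)) \<partial>M)"

text \<open>Vertex set of the connected component of x in the graph (X, F).\<close>
definition comp :: "('a \<times> 'a) set \<Rightarrow> 'a \<Rightarrow> 'a set" where
  "comp F x = {y. (x, y) \<in> F\<^sup>*}"

text \<open>Rank function.  For an infinite component, card = 0 and 1/0 = 0 in Isabelle,
  which is exactly the convention 1/\<infinity> = 0.\<close>
definition rank :: "'a measure \<Rightarrow> ('a \<times> 'a) set \<Rightarrow> real" where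
  "rank M F = (\<integral> x. (1 - 1 / real (card (comp F x))) \<partial>M)"

definition corank :: "'a measure \<Rightarrow> ('a \<times> 'a) set \<Rightarrow> ('a \<times> 'a) set \<Rightarrow> real" where
  "corank M E A = rank M (E - A) + edge_measure M A - rank M E"

definition hyperfinite :: "'a measure \<Rightarrow> ('a \<times> 'a) set \<Rightarrow> bool" where
  "hyperfinite M E \<longleftrightarrow>
     (\<forall>\<epsilon>>0. \<exists>S. borel_edges M E S \<and> edge_measure M S \<le> \<epsilon> \<and>
                 (\<forall>x. finite (comp (E - S) x)))"

section \<open>Planar embeddings and facial cycles\<close>

text \<open>A drawing of the graph (V, Ed) in the plane (complex numbers): injective
  vertex positions, edges drawn as arcs between their endpoints, no arc passes
  through a non-incident vertex, distinct edges meet only in common endpoints,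
  and the vertex set has no accumulation point in the plane.\<close>
definition plane_drawing ::
  "'a set \<Rightarrow> ('a \<times> 'a) set \<Rightarrow> ('a \<Rightarrow> complex) \<Rightarrow> ('a \<Rightarrow> 'a \<Rightarrow> real \<Rightarrow> complex) \<Rightarrow> bool" where
  "plane_drawing V Ed p c \<longleftrightarrow>
     inj_on p V \<and>
     (\<forall>(x, y) \<in> Ed. arc (c x y) \<and> pathstart (c x y) = p x \<and> pathfinish (c x y) = p y \<and>
                     c y x = reversepath (c x y)) \<and>
     (\<forall>(x, y) \<in> Ed. \<forall>v \<in> V. p v \<in> path_image (c x y) \<longrightarrow> v = x \<or> v = y) \<and>
     (\<forall>(x, y) \<in> Ed. \<forall>(u, v) \<in> Ed. {x, y} \<noteq> {u, v} \<longrightarrow>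
        path_image (c x y) \<inter> path_image (c u v) \<subseteq> p ` ({x, y} \<inter> {u, v})) \<and>
     (\<forall>K. compact K \<longrightarrow> finite {v \<in> V. p v \<in> K})"

definition drawing_image ::
  "'a set \<Rightarrow> ('a \<times> 'a) set \<Rightarrow> ('a \<Rightarrow> complex) \<Rightarrow> ('a \<Rightarrow> 'a \<Rightarrow> real \<Rightarrow> complex) \<Rightarrow> complex set" where
  "drawing_image V Ed p c = p ` V \<union> (\<Union>(x, y) \<in> Ed. path_image (c x y))"

text \<open>Faces: connected components of the complement of the drawing.\<close>
definition faces ::
  "'a set \<Rightarrow> ('a \<times> 'a) set \<Rightarrow> ('a \<Rightarrow> complex) \<Rightarrow> ('a \<Rightarrow> 'a \<Rightarrow> real \<Rightarrow> complex) \<Rightarrow> complex set set" where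
  "faces V Ed p c = components (- drawing_image V Ed p c)"

text \<open>Facial cycle of a face: the (symmetric) set of edges lying on its boundary.\<close>
definition face_boundary ::
  "('a \<times> 'a) set \<Rightarrow> ('a \<Rightarrow> 'a \<Rightarrow> real \<Rightarrow> complex) \<Rightarrow> complex set \<Rightarrow> ('a \<times> 'a) set" where
  "face_boundary Ed c f = {(x, y) \<in> Ed. path_image (c x y) \<subseteq> frontier f}"

text \<open>A finite edge set forming a single cycle.\<close>
definition is_cycle_edges :: "('a \<times> 'a) set \<Rightarrow> bool" where
  "is_cycle_edges C \<longleftrightarrow> finite C \<and> C \<noteq> {} \<and> sym_edges C \<and> (\<forall>x. (x, x) \<notin> C) \<and>
     (\<forall>x \<in> Domain C. card (nbrs C x) = 2) \<and>
     (\<forall>x \<in> Domain C. \<forall>y \<in> Domain C. (x, y) \<in> C\<^sup>*)"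

text \<open>2-vertex-connectivity: at least 3 vertices, and connected after deleting any vertex.\<close>
definition two_connected :: "'a set \<Rightarrow> ('a \<times> 'a) set \<Rightarrow> bool" where
  "two_connected V Ed \<longleftrightarrow> (infinite V \<or> card V \<ge> 3) \<and>
     (\<forall>v \<in> V. \<forall>x \<in> V - {v}. \<forall>y \<in> V - {v}. (x, y) \<in> (Ed \<inter> ((V - {v}) \<times> (V - {v})))\<^sup>*)"

text \<open>A planar graphing with (Borel) collection FC of facial cycles: every component
  is 2-connected and has a planar embedding whose facial cycles are exactly the
  members of FC within that component; all faces are finite cycles of
  uniformly bounded length; FC is Borel (encoded as the Borel relation
  "e and e' lie on a common facial cycle").\<close>
definition planar_graphing ::
  "'a::polish_space measure \<Rightarrow> ('a \<times> 'a) set \<Rightarrow> ('a \<times> 'a) set set \<Rightarrow> bool" where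
  "planar_graphing M E FC \<longleftrightarrow>
     graphing M E \<and>
     (\<forall>x. two_connected (comp E x) (E \<inter> (comp E x \<times> comp E x))) \<and>
     (\<forall>x. \<exists>p c. plane_drawing (comp E x) (E \<inter> (comp E x \<times> comp E x)) p c \<and>
          face_boundary (E \<inter> (comp E x \<times> comp E x)) c `
              faces (comp E x) (E \<inter> (comp E x \<times> comp E x)) p c
            = {C \<in> FC. C \<subseteq> E \<inter> (comp E x \<times> comp E x)}) \<and>
     (\<exists>L::nat. \<forall>C \<in> FC. C \<subseteq> E \<and> is_cycle_edges C \<and> card C \<le> L) \<and>
     {(e, e'). \<exists>C \<in> FC. e \<in> C \<and> e' \<in> C} \<in> sets (borel :: (('a \<times> 'a) \<times> ('a \<times> 'a)) measure)"

text \<open>(Ms, Es) is the dual graphing of the planar graphing (M, E, FC) via sigma: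
  its vertices are (in Borel bijection phi with) the faces of G; sigma is a
  measurable bijection of edge sets, compatible with reversal of orientation,
  measure preserving for the edge measures, and sigma(e) joins the two faces
  having e on their boundary.\<close>
definition dual_via ::
  "'a::polish_space measure \<Rightarrow> ('a \<times> 'a) set \<Rightarrow> ('a \<times> 'a) set set \<Rightarrow>
   'b::polish_space measure \<Rightarrow> ('b \<times> 'b) set \<Rightarrow> ('a \<times> 'a \<Rightarrow> 'b \<times> 'b) \<Rightarrow> bool" where
  "dual_via M E FC Ms Es \<sigma> \<longleftrightarrow>
     bij_betw \<sigma> E Es \<and>
     (\<forall>(x, y) \<in> E. \<sigma> (y, x) = prod.swap (\<sigma> (x, y))) \<and>
     \<sigma> \<in> measurable (restrict_space (M \<Otimes>\<^sub>M M) E) (Ms \<Otimes>\<^sub>M Ms) \<and>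
     (\<forall>A. borel_edges M E A \<longrightarrow> edge_measure Ms (\<sigma> ` A) = edge_measure M A) \<and>
     (\<exists>\<phi>. bij_betw \<phi> FC (UNIV :: 'b set) \<and>
          (\<forall>e \<in> E. {fst (\<sigma> e), snd (\<sigma> e)} = \<phi> ` {C \<in> FC. e \<in> C}))"

end

theory Submission
  imports Defs
begin

text \<open>
  For a Borel edge set \<open>B\<close> with finite components take a Borel minimum spanning forest \<open>T\<close> of \<open>B\<close>.
  A finite component of \<open>E\<^sup>* \ T\<^sup>*\<close> other than a whole component of \<open>E\<^sup>*\<close> would make the sum of its
  facial cycles a nonempty even subset of \<open>T\<close>; hence \<open>E\<^sup>* \ T\<^sup>*\<close> has the same rank as \<open>E\<^sup>*\<close>.
  By the Jordan curve theorem a cycle of \<open>G\<^sup>*\<close> is dual to a finite cut of \<open>G\<close>, and \<open>T\<close> crosses every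
  cut that \<open>B\<close> crosses; hence \<open>B \ T\<close> is dual to a set of edges independent over the dual of
  \<open>E \ B\<close>, and in a hyperfinite graphing independent edges raise the rank by their measure.
  Together these give \<open>\<rho>(B) + \<eta>(E \ B) - \<rho>\<^sup>*(\<sigma>(E \ B)) = \<eta>(E) - \<rho>\<^sup>*(E\<^sup>*)\<close>. Hyperfiniteness of \<open>G\<close>
  extends the identity to every Borel \<open>B\<close>, and \<open>B = E\<close> evaluates the right-hand side.

  Ranks are Bochner integrals, so component sizes must be shown to be Borel functions. This rests on
  the Lusin-Souslin theorem: injective projections of Borel sets are Borel.
\<close>

section \<open>Injective projections of Borel sets\<close>

text \<open>Hyperfiniteness is essential for the claim about independent edges: in a treeing of
  degree 4 on a probability space all edges are independent and have measure 2, yet the rank is at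
  most 1. Hence edges are counted on finite components, where counting is exact, and mass transport
  turns the counts into integrals. The forest, too, is taken on finite components only: in an
  infinite one a cheapest edge across a cut need not exist, and a minimum spanning forest may fail
  to connect it.

  Topology enters in one direction only. From faces to even edge sets the argument is parity:
  \<open>\<sigma> e\<close> joins the two faces containing \<open>e\<close>, so the sum modulo 2 of
  a set of facial cycles consists of the edges whose duals leave the corresponding set of dual
  vertices. From a cycle to finitely many faces a Jordan curve is needed, and finiteness comes from
  the absence of accumulation points. Used in the dual, where faces stand for vertices of the primal
  graph, this turns a cycle into a finite cut. Drawings are chosen for one component at a time,
  without any measurability; only combinatorial statements are kept.\<close>

instance prod :: (polish_space, polish_space) polish_space ..

text \<open>
  The real witnesses are there for open sets: \<open>x \<in> U\<close> iff \<open>r * infdist x (-U) = 1\<close> for some \<open>r\<close>,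
  a closed condition with a unique solution.
\<close>
definition unique_closed_proj :: "'a::polish_space set \<Rightarrow> bool" where
  "unique_closed_proj A \<longleftrightarrow>
     (\<exists>Z :: ('a \<times> (nat \<Rightarrow> real)) set. closed Z \<and> inj_on fst Z \<and> fst ` Z = A)"

lemma continuous_on_snd_coordinate:
  "continuous_on S (\<lambda>z :: 'x::topological_space \<times> ('i \<Rightarrow> 'b::topological_space). snd z i)"
  by (rule continuous_on_compose2[OF continuous_on_product_coordinates]) (auto intro!: continuous_on_snd continuous_on_id)

lemma unique_closed_proj_closed:
  assumes "closed (C :: 'a::polish_space set)"
  shows "unique_closed_proj C"
proof -
  have "closed (C \<times> {\<lambda>_. 0} :: ('a \<times> (nat \<Rightarrow> real)) set)"
    using assms by (intro closed_Times) auto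
  then show ?thesis
    unfolding unique_closed_proj_def
    by (intro exI[of _ "C \<times> {\<lambda>_. 0}"]) (auto simp: inj_on_def)
qed

lemma unique_closed_proj_open:
  assumes "open (U :: 'a::polish_space set)"
  shows "unique_closed_proj U"
\<comment> \<open>The distance to the empty set is 0 by convention, so the equation below would have
  no solution for the whole space.\<close>
proof (cases "U = UNIV")
  case True
  then show ?thesis using unique_closed_proj_closed[OF closed_UNIV] by simp
next
  case False
  \<comment> \<open>Coordinate 0 carries the reciprocal of the distance; the others are pinned to 0
    to keep the witness unique.\<close>
  define Z :: "('a \<times> (nat \<Rightarrow> real)) set" where
    "Z = {z. snd z 0 * infdist (fst z) (-U) = 1} \<inter> (\<Inter>k. {z. snd z (Suc k) = 0})"
  have "closed Z"
    unfolding Z_def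
    by (intro closed_Int closed_INT closed_Collect_eq ballI continuous_intros continuous_on_snd_coordinate)
  moreover have "inj_on fst Z"
  proof (rule inj_onI)
    fix z z' assume z: "z \<in> Z" "z' \<in> Z" "fst z = fst z'"
    have "snd z n = snd z' n" for n
      using z by (cases n) (auto simp: Z_def, metis mult_cancel_right zero_neq_one mult_zero_right)
    then show "z = z'" using z(3) by (auto simp: prod_eq_iff)
  qed
  moreover have "fst ` Z = U"
  proof
    show "fst ` Z \<subseteq> U"
      by (auto simp: Z_def) (metis ComplI infdist_zero mult_zero_right zero_neq_one)
    show "U \<subseteq> fst ` Z"
    proof
      fix x assume "x \<in> U"
      moreover have "closed (-U)" "-U \<noteq> {}" using assms False by auto
      ultimately have "infdist x (-U) \<noteq> 0"
        using in_closed_iff_infdist_zero by (metis ComplD)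
      then have "(x, \<lambda>n. if n = 0 then 1 / infdist x (-U) else 0) \<in> Z"
        by (auto simp: Z_def)
      then show "x \<in> fst ` Z" by force
    qed
  qed
  ultimately show ?thesis unfolding unique_closed_proj_def by blast
qed

text \<open>The witnesses for all \<open>A n\<close> are interleaved into one sequence along the
  pairing function. Since every index codes a pair, uniqueness of each witness determines the whole
  sequence.\<close>

lemma unique_closed_proj_INT:
  assumes "\<And>n::nat. unique_closed_proj (A n :: 'a::polish_space set)"
  shows "unique_closed_proj (\<Inter>n. A n)"
proof -
  obtain Z :: "nat \<Rightarrow> ('a \<times> (nat \<Rightarrow> real)) set" where
    Z: "\<And>n. closed (Z n)" "\<And>n. inj_on fst (Z n)" "\<And>n. fst ` Z n = A n"
    using assms unfolding unique_closed_proj_def by metis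
  define r where "r n z = (fst z :: 'a, \<lambda>k. snd z (prod_encode (n, k)) :: real)" for n z
  define Y where "Y = (\<Inter>n. r n -` Z n)"
  have "continuous_on UNIV (r n)" for n
    unfolding r_def by (intro continuous_intros continuous_on_snd_coordinate)
  then have "closed Y"
    unfolding Y_def using Z(1) by (intro closed_INT ballI closed_vimage) auto
  moreover have "inj_on fst Y"
  proof (rule inj_onI)
    fix z z' assume z: "z \<in> Y" "z' \<in> Y" "fst z = fst z'"
    have "r n z \<in> Z n" "r n z' \<in> Z n" "fst (r n z) = fst (r n z')" for n
      using z unfolding Y_def r_def by auto
    then have "r n z = r n z'" for n
      using Z(2)[of n] unfolding inj_on_def by blast
    then have "(\<lambda>k. snd z (prod_encode (n, k))) = (\<lambda>k. snd z' (prod_encode (n, k)))" for n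
      unfolding r_def by simp
    then have "snd z (prod_encode (n, k)) = snd z' (prod_encode (n, k))" for n k
      by (rule fun_cong)
    then have "snd z i = snd z' i" for i
      by (metis prod_decode_inverse prod.collapse)
    then show "z = z'" using z(3) by (auto simp: prod_eq_iff)
  qed
  moreover have "fst ` Y = (\<Inter>n. A n)"
  proof
    show "fst ` Y \<subseteq> (\<Inter>n. A n)"
    proof clarify
      fix x w n assume "(x, w) \<in> Y"
      then have "r n (x, w) \<in> Z n" unfolding Y_def by blast
      then have "fst (r n (x, w)) \<in> A n" using Z(3) by blast
      then show "fst (x, w) \<in> A n" unfolding r_def by simp
    qed
    show "(\<Inter>n. A n) \<subseteq> fst ` Y"
    proof
      fix x assume "x \<in> (\<Inter>n. A n)"
      then have "\<exists>w. (x, w) \<in> Z n" for n using Z(3)[of n] by force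
      then obtain w where w: "\<And>n. (x, w n) \<in> Z n" by metis
      have "(x, \<lambda>i. w (fst (prod_decode i)) (snd (prod_decode i))) \<in> Y"
        using w by (auto simp: Y_def r_def)
      then show "x \<in> fst ` Y" by force
    qed
  qed
  ultimately show ?thesis unfolding unique_closed_proj_def by blast
qed

text \<open>Coordinate 0 names the piece that contains the point, and the remaining coordinates are
  its witness. Disjointness makes the name unique.\<close>

lemma unique_closed_proj_disjoint_UN:
  assumes "\<And>n::nat. unique_closed_proj (A n :: 'a::polish_space set)" "disjoint_family A"
  shows "unique_closed_proj (\<Union>n. A n)"
proof -
  obtain Z :: "nat \<Rightarrow> ('a \<times> (nat \<Rightarrow> real)) set" where
    Z: "\<And>n. closed (Z n)" "\<And>n. inj_on fst (Z n)" "\<And>n. fst ` Z n = A n"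
    using assms unfolding unique_closed_proj_def by metis
  define r where "r z = (fst z :: 'a, \<lambda>k. snd z (Suc k) :: real)" for z
  \<comment> \<open>An infinite union of closed pieces need not be closed, so membership is stated
    as an intersection: for every \<open>n\<close>, either coordinate 0 stays away from
    \<open>n\<close> or the rest is a witness for \<open>A n\<close>.\<close>
  define Y where "Y = {z. snd z 0 \<in> \<nat>} \<inter>
    (\<Inter>n. {z. 1/2 \<le> \<bar>snd z 0 - real n\<bar>} \<union> r -` Z n)"
  have r: "continuous_on UNIV r"
    unfolding r_def by (intro continuous_intros continuous_on_snd_coordinate)
  have "closed ((\<lambda>z::'a \<times> (nat \<Rightarrow> real). snd z 0) -` \<nat>)"
    by (intro closed_vimage closed_Nats continuous_intros continuous_on_snd_coordinate)
  moreover have "closed ({z. 1/2 \<le> \<bar>snd z 0 - real n\<bar>} \<union> r -` Z n)" for n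
    by (intro closed_Un closed_Collect_le closed_vimage[OF Z(1) r] continuous_intros
        continuous_on_snd_coordinate)
  ultimately have "closed Y"
    unfolding Y_def vimage_def[of _ \<nat>] by (intro closed_Int closed_INT) auto
  moreover have Y: "z \<in> Y \<longleftrightarrow> (\<exists>n. snd z 0 = real n \<and> r z \<in> Z n)" for z
  proof
    assume z: "z \<in> Y"
    then obtain n where n: "snd z 0 = real n" by (auto simp: Y_def Nats_def)
    have "z \<in> {z. 1/2 \<le> \<bar>snd z 0 - real n\<bar>} \<union> r -` Z n" using z by (auto simp: Y_def)
    then show "\<exists>n. snd z 0 = real n \<and> r z \<in> Z n" using n by auto
  next
    assume "\<exists>n. snd z 0 = real n \<and> r z \<in> Z n"
    then obtain n where n: "snd z 0 = real n" "r z \<in> Z n" by blast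
    have "1/2 \<le> \<bar>real n - real m\<bar>" if "m \<noteq> n" for m
      using that by linarith
    then show "z \<in> Y" using n by (fastforce simp: Y_def)
  qed
  moreover have "inj_on fst Y"
  proof (rule inj_onI)
    fix z z' assume z: "z \<in> Y" "z' \<in> Y" "fst z = fst z'"
    obtain n m where n: "snd z 0 = real n" "r z \<in> Z n" and m: "snd z' 0 = real m" "r z' \<in> Z m"
      using z Y by metis
    have "fst (r z) \<in> A n" "fst (r z') \<in> A m" using n m Z(3) by blast+
    then have "fst z \<in> A n" "fst z \<in> A m" using z(3) unfolding r_def by simp_all
    then have nm: "n = m" using assms(2) unfolding disjoint_family_on_def by blast
    moreover have "fst (r z) = fst (r z')" using z(3) unfolding r_def by simp
    ultimately have "r z = r z'"
      using Z(2)[of n] n m unfolding inj_on_def by blast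
    then have "(\<lambda>k. snd z (Suc k)) = (\<lambda>k. snd z' (Suc k))"
      unfolding r_def by simp
    then have "snd z (Suc k) = snd z' (Suc k)" for k
      by (rule fun_cong)
    then have "snd z i = snd z' i" for i using n m nm by (cases i) auto
    then show "z = z'" using z(3) by (auto simp: prod_eq_iff)
  qed
  moreover have "fst ` Y = (\<Union>n. A n)"
  proof
    show "fst ` Y \<subseteq> (\<Union>n. A n)"
    proof
      fix x assume "x \<in> fst ` Y"
      then obtain z n where "x = fst z" "r z \<in> Z n" using Y by blast
      then have "x = fst (r z)" "fst (r z) \<in> A n" using Z(3)[of n] by (simp add: r_def, blast)
      then show "x \<in> (\<Union>n. A n)" by blast
    qed
    show "(\<Union>n. A n) \<subseteq> fst ` Y"
    proof
      fix x assume "x \<in> (\<Union>n. A n)"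
      then obtain n where "x \<in> A n" by auto
      then obtain w where w: "(x, w) \<in> Z n" using Z(3)[of n] by force
      have "(x, \<lambda>i. case i of 0 \<Rightarrow> real n | Suc k \<Rightarrow> w k) \<in> Y"
        unfolding Y r_def using w by auto
      then show "x \<in> fst ` Y" by force
    qed
  qed
  ultimately show ?thesis unfolding unique_closed_proj_def by blast
qed

lemma unique_closed_proj_borel:
  assumes "A \<in> sets (borel :: 'a::polish_space measure)"
  shows "unique_closed_proj A"
proof -
  have "Int_stable (Collect open :: 'a set set)" by (auto simp: Int_stable_def)
  moreover have "Collect open \<subseteq> Pow (UNIV :: 'a set)" by simp
  moreover have "A \<in> sigma_sets UNIV (Collect open)" using assms unfolding sets_borel .
  \<comment> \<open>The complement is carried along because the class is not visibly closed under
    complements. The disjoint form of the induction is forced: overlapping pieces would destroy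
    uniqueness of the witness.\<close>
  ultimately have "unique_closed_proj A \<and> unique_closed_proj (UNIV - A)"
  proof (induction rule: sigma_sets_induct_disjoint)
    case (basic A)
    then show ?case
      using unique_closed_proj_open[of A] unique_closed_proj_closed[of "UNIV - A"]
      by (simp add: Compl_eq_Diff_UNIV[symmetric] closed_Compl)
  next
    case empty
    then show ?case using unique_closed_proj_open[of "{}"] unique_closed_proj_open[of UNIV] by simp
  next
    case (compl A)
    then show ?case by (simp add: double_diff)
  next
    case (union A)
    have "UNIV - (\<Union>n. A n) = (\<Inter>n. UNIV - A n)" by auto
    with union show ?case
      using unique_closed_proj_disjoint_UN[of A] unique_closed_proj_INT[of "\<lambda>n. UNIV - A n"] by simp
  qed
  then show ?thesis by blast
qed

section \<open>Lusin separation and injective continuous images\<close>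

definition borel_separable :: "'a::topological_space set \<Rightarrow> 'a set \<Rightarrow> bool" where
  "borel_separable A B \<longleftrightarrow> (\<exists>C\<in>sets borel. A \<subseteq> C \<and> C \<inter> B = {})"

lemma borel_separable_UN:
  assumes "\<And>(i::nat) (j::nat). borel_separable (A i) (B j)"
  shows "borel_separable (\<Union>i. A i) (\<Union>j. B j)"
proof -
  obtain C where C: "\<And>i j. C i j \<in> sets borel" "\<And>i j. A i \<subseteq> C i j" "\<And>i j. C i j \<inter> B j = {}"
    using assms unfolding borel_separable_def by metis
  have "(\<Union>i. \<Inter>j. C i j) \<in> sets borel"
    using C(1) by (intro sets.countable_UN'' sets.countable_INT'') auto
  moreover have "(\<Union>i. A i) \<subseteq> (\<Union>i. \<Inter>j. C i j)" using C(2) by blast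
  moreover have "(\<Union>i. \<Inter>j. C i j) \<inter> (\<Union>j. B j) = {}" using C(3) by blast
  ultimately show ?thesis unfolding borel_separable_def by blast
qed

lemma countable_closed_covers:
  obtains D :: "nat \<Rightarrow> nat \<Rightarrow> 'a::polish_space set" where
    "\<And>n k. closed (D n k)" "\<And>n. (\<Union>k. D n k) = UNIV"
    "\<And>n k x y. x \<in> D n k \<Longrightarrow> y \<in> D n k \<Longrightarrow> dist x y \<le> 2 / Suc n"
proof -
  obtain Q :: "'a set" where Q: "countable Q" "\<And>U. open U \<Longrightarrow> U \<noteq> {} \<Longrightarrow> \<exists>q\<in>Q. q \<in> U"
    using countable_dense_setE by blast
  have "Q \<noteq> {}" using Q(2)[of UNIV] by auto
  define q where "q = from_nat_into Q"
  define D where "D n k = cball (q k) (1 / Suc n)" for n k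
  have "\<exists>k. x \<in> D n k" for x n
  proof -
    obtain y where "y \<in> Q" "y \<in> ball x (1 / Suc n)"
      using Q(2)[of "ball x (1 / Suc n)"] by auto
    moreover then obtain k where "q k = y"
      using from_nat_into_surj[OF Q(1)] unfolding q_def by blast
    ultimately show ?thesis
      unfolding D_def by (metis dist_commute less_imp_le mem_ball mem_cball)
  qed
  moreover have "dist x y \<le> 2 / Suc n" if "x \<in> D n k" "y \<in> D n k" for x y n k
  proof -
    have "dist x y \<le> dist (q k) x + dist (q k) y" by (rule dist_triangle3)
    also have "\<dots> \<le> 1 / Suc n + 1 / Suc n" using that unfolding D_def mem_cball by linarith
    finally show ?thesis by simp
  qed
  moreover have "closed (D n k)" for n k unfolding D_def by simp
  ultimately show ?thesis by (intro that[of D]) auto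
qed

lemma eventually_two_over_Suc_less:
  assumes "e > (0::real)"
  obtains N where "\<And>n::nat. n \<ge> N \<Longrightarrow> 2 / Suc n < e"
proof -
  obtain N where N: "inverse (real (Suc N)) < e / 2" using reals_Archimedean[of "e/2"] assms by auto
  have "2 / Suc n < e" if "n \<ge> N" for n
  proof -
    have "2 / real (Suc n) \<le> 2 / Suc N" using that by (intro divide_left_mono) auto
    also have "\<dots> < e" using N by (simp add: field_simps)
    finally show ?thesis .
  qed
  then show ?thesis using that by blast
qed

text \<open>If the images were inseparable, \<open>borel_separable_UN\<close> would give an
  inseparable pair of smaller pieces, and so on at every scale. The pieces shrink to points
  \<open>a\<close> and \<open>b\<close> with distinct values, and disjoint neighbourhoods of these
  values separate the images of late pieces.\<close>

lemma Lusin_separation: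
  fixes f :: "'d::polish_space \<Rightarrow> 'a::polish_space"
  assumes f: "continuous_on UNIV f" and K: "closed K" and L: "closed L" and dj: "f ` K \<inter> f ` L = {}"
  shows "borel_separable (f ` K) (f ` L)"
proof (rule ccontr)
  assume neg: "\<not> ?thesis"
  obtain D :: "nat \<Rightarrow> nat \<Rightarrow> 'd set" where D: "\<And>n k. closed (D n k)" "\<And>n. (\<Union>k. D n k) = UNIV"
    "\<And>n k x y. x \<in> D n k \<Longrightarrow> y \<in> D n k \<Longrightarrow> dist x y \<le> 2 / Suc n"
    using countable_closed_covers by blast
  define good where "good p \<longleftrightarrow> closed (fst p) \<and> closed (snd p) \<and> fst p \<subseteq> K \<and> snd p \<subseteq> L \<and>
    \<not> borel_separable (f ` fst p) (f ` snd p)" for p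
  define ref where "ref n p p' \<longleftrightarrow> (\<exists>k l. p' = (fst p \<inter> D n k, snd p \<inter> D n l))" for n p p'
  have "\<exists>s. \<forall>n. good (s n) \<and> ref n (s n) (s (Suc n))"
  proof (rule dependent_nat_choice)
    show "\<exists>p. good p" using neg K L unfolding good_def by (intro exI[of _ "(K, L)"]) auto
    fix p n assume p: "good p"
    have "\<exists>k l. \<not> borel_separable (f ` (fst p \<inter> D n k)) (f ` (snd p \<inter> D n l))"
    proof (rule ccontr)
      assume "\<not> ?thesis"
      then have "borel_separable (\<Union>k. f ` (fst p \<inter> D n k)) (\<Union>l. f ` (snd p \<inter> D n l))"
        by (intro borel_separable_UN) auto
      moreover have "(\<Union>k. f ` (A \<inter> D n k)) = f ` A" for A
        using D(2)[of n] by blast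
      ultimately show False using p unfolding good_def by simp
    qed
    then obtain k l where "\<not> borel_separable (f ` (fst p \<inter> D n k)) (f ` (snd p \<inter> D n l))" by blast
    then show "\<exists>p'. good p' \<and> ref n p p'"
      using p D(1) unfolding good_def ref_def
      by (intro exI[of _ "(fst p \<inter> D n k, snd p \<inter> D n l)"]) auto
  qed
  then obtain s where s: "\<And>n. good (s n)" "\<And>n. ref n (s n) (s (Suc n))" by blast
  have step: "fst (s (Suc n)) \<subseteq> fst (s n)" "snd (s (Suc n)) \<subseteq> snd (s n)" for n
    using s(2)[of n] unfolding ref_def by auto
  have diam: "dist x y \<le> 2 / Suc n"
    if "x \<in> fst (s (Suc n)) \<and> y \<in> fst (s (Suc n)) \<or> x \<in> snd (s (Suc n)) \<and> y \<in> snd (s (Suc n))" for n x y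
    using s(2)[of n] D(3) that unfolding ref_def by auto
  have nest: "\<exists>n. \<forall>x\<in>g (s n). \<forall>y\<in>g (s n). dist x y < e" if e: "e > 0" and g: "g = fst \<or> g = snd" for e and g :: "'d set \<times> 'd set \<Rightarrow> 'd set"
  proof -
    obtain N where "2 / Suc N < e" using eventually_two_over_Suc_less[OF e] by blast
    then show ?thesis using diam g by (intro exI[of _ "Suc N"]) (meson order.strict_trans1)
  qed
  \<comment> \<open>An image of the empty set is trivially separable from any set.\<close>
  have ne: "fst (s n) \<noteq> {}" "snd (s n) \<noteq> {}" for n
    using s(1)[of n] unfolding good_def borel_separable_def by auto
  have cl: "closed (fst (s n))" "closed (snd (s n))" for n using s(1) unfolding good_def by auto
  have anti: "fst (s n) \<subseteq> fst (s m)" "snd (s n) \<subseteq> snd (s m)" if "m \<le> n" for m n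
    using that lift_Suc_antimono_le[of "\<lambda>n. fst (s n)"] lift_Suc_antimono_le[of "\<lambda>n. snd (s n)"] step
    by auto
  obtain a where a: "\<And>n. a \<in> fst (s n)"
    by (rule decreasing_closed_nest[of "\<lambda>n. fst (s n)"]) (use cl ne nest anti in auto)
  obtain b where b: "\<And>n. b \<in> snd (s n)"
    by (rule decreasing_closed_nest[of "\<lambda>n. snd (s n)"]) (use cl ne nest anti in auto)
  have "a \<in> K" "b \<in> L" using a[of 0] b[of 0] s(1)[of 0] unfolding good_def by auto
  then have "f a \<noteq> f b" using dj by auto
  then obtain U V where U: "open U" "open V" "f a \<in> U" "f b \<in> V" "U \<inter> V = {}"
    using hausdorff by metis
  have ball: "\<exists>e>0. ball c e \<subseteq> f -` W" if "open W" "f c \<in> W" for c W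
    using open_vimage[OF that(1) f] that(2) open_contains_ball by (metis vimageI)
  obtain e1 where e1: "e1 > 0" "ball a e1 \<subseteq> f -` U" using ball U by metis
  obtain e2 where e2: "e2 > 0" "ball b e2 \<subseteq> f -` V" using ball U by metis
  obtain N where N: "2 / Suc N < min e1 e2"
    using eventually_two_over_Suc_less[of "min e1 e2"] e1(1) e2(1) by (metis min_less_iff_conj order_refl)
  have "dist a x < e1" if "x \<in> fst (s (Suc N))" for x
    using diam[of a N x] a[of "Suc N"] that N by linarith
  moreover have "dist b x < e2" if "x \<in> snd (s (Suc N))" for x
    using diam[of b N x] b[of "Suc N"] that N by linarith
  ultimately have "fst (s (Suc N)) \<subseteq> ball a e1" "snd (s (Suc N)) \<subseteq> ball b e2"
    by auto
  then have "f ` fst (s (Suc N)) \<subseteq> U" "f ` snd (s (Suc N)) \<subseteq> V" using e1 e2 by auto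
  then have "borel_separable (f ` fst (s (Suc N))) (f ` snd (s (Suc N)))"
    unfolding borel_separable_def using U by (intro bexI[of _ U]) auto
  then show False using s(1) unfolding good_def by blast
qed

text \<open>
  A point lies in the image as soon as, at every scale, it lies in an approximating Borel set of some
  piece: separated pieces have disjoint approximations, so the pieces met form a Cauchy filter.
\<close>
lemma closed_inj_image_borel:
  fixes f :: "'d::polish_space \<Rightarrow> 'a::polish_space"
  assumes f: "continuous_on UNIV f" and Z: "closed Z" and inj: "inj_on f Z"
  shows "f ` Z \<in> sets borel"
proof -
  obtain D :: "nat \<Rightarrow> nat \<Rightarrow> 'd set" where D: "\<And>n k. closed (D n k)" "\<And>n. (\<Union>k. D n k) = UNIV"
    "\<And>n k x y. x \<in> D n k \<Longrightarrow> y \<in> D n k \<Longrightarrow> dist x y \<le> 2 / Suc n"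
    using countable_closed_covers by blast
  define I where "I i = Z \<inter> D (fst i) (snd i)" for i
  define dj where "dj i j \<longleftrightarrow> I i \<inter> I j = {}" for i j
  have clI: "closed (I i)" for i unfolding I_def using Z D(1) by auto
  have ex: "\<exists>C. C \<in> sets borel \<and> (dj i j \<longrightarrow> f ` I i \<subseteq> C \<and> C \<inter> f ` I j = {})" for i j
  proof (cases "dj i j")
    case True
    then have "f ` I i \<inter> f ` I j = {}"
      using inj unfolding dj_def I_def inj_on_def by blast
    from Lusin_separation[OF f clI clI this] show ?thesis
      unfolding borel_separable_def by blast
  next
    case False
    then show ?thesis using sets.empty_sets by blast
  qed
  define C where "C i j = (SOME C. C \<in> sets borel \<and> (dj i j \<longrightarrow> f ` I i \<subseteq> C \<and> C \<inter> f ` I j = {}))" for i j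
  have C: "\<And>i j. C i j \<in> sets borel"
    "\<And>i j. dj i j \<Longrightarrow> f ` I i \<subseteq> C i j" "\<And>i j. dj i j \<Longrightarrow> C i j \<inter> f ` I j = {}"
    using someI_ex[OF ex] unfolding C_def by blast+
  \<comment> \<open>Subtracting \<open>C j i\<close> makes the approximations of disjoint pieces
    disjoint, which \<open>C i j\<close> alone does not.\<close>
  define G where "G i j = (if dj i j then C i j - C j i else UNIV)" for i j
  \<comment> \<open>The closure supplies, for a point of \<open>B i\<close>, values of
    \<open>f\<close> on the piece arbitrarily close to it.\<close>
  define B where "B i = closure (f ` I i) \<inter> (\<Inter>j. G i j)" for i
  have "G i j \<in> sets borel" for i j unfolding G_def using C(1) by auto
  then have Bs: "B i \<in> sets borel" for i
    unfolding B_def by (intro sets.Int sets.countable_INT'') auto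
  have dj_sym: "dj i j \<longleftrightarrow> dj j i" for i j unfolding dj_def by auto
  have IB: "f ` I i \<subseteq> B i" for i
  proof -
    have "f ` I i \<subseteq> G i j" for j
      using C(2)[of i j] C(3)[of j i] dj_sym[of i j] unfolding G_def by (cases "dj i j") auto
    then show ?thesis unfolding B_def using closure_subset[of "f ` I i"] by blast
  qed
  have Bd: "\<not> dj i j" if "x \<in> B i" "x \<in> B j" for x i j
  proof
    assume d: "dj i j"
    have "x \<in> G i j" "x \<in> G j i" using that unfolding B_def by blast+
    then show False using d dj_sym[of i j] unfolding G_def by simp
  qed
  have "f ` Z = (\<Inter>n. \<Union>k. B (n, k))"
  proof
    show "f ` Z \<subseteq> (\<Inter>n. \<Union>k. B (n, k))"
    proof clarify
      fix z n assume "z \<in> Z"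
      moreover obtain k where "z \<in> D n k" using D(2)[of n] by blast
      ultimately have "f z \<in> f ` I (n, k)" unfolding I_def by auto
      then show "f z \<in> (\<Union>k. B (n, k))" using IB by blast
    qed
    show "(\<Inter>n. \<Union>k. B (n, k)) \<subseteq> f ` Z"
    proof
      fix x assume "x \<in> (\<Inter>n. \<Union>k. B (n, k))"
      then have "\<forall>n. \<exists>k. x \<in> B (n, k)" by blast
      then obtain k where k: "\<And>n. x \<in> B (n, k n)" by metis
      have "\<exists>z\<in>I (n, k n). dist (f z) x < 1 / Suc n" for n
      proof -
        have "x \<in> closure (f ` I (n, k n))" using k unfolding B_def by blast
        then show ?thesis unfolding closure_approachable by auto
      qed
      then obtain z where z: "\<And>n. z n \<in> I (n, k n)" "\<And>n. dist (f (z n)) x < 1 / Suc n" by metis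
      have dz: "dist (z n) (z m) \<le> 2 / Suc n + 2 / Suc m" for n m
      proof -
        \<comment> \<open>Two pieces whose approximations share \<open>x\<close> are not disjoint,
          so any of their points are joined through a common point.\<close>
        obtain w where w: "w \<in> I (n, k n)" "w \<in> I (m, k m)"
          using Bd[OF k[of n] k[of m]] unfolding dj_def by blast
        have "dist (z n) w \<le> 2 / Suc n" "dist (z m) w \<le> 2 / Suc m"
          using D(3)[of "z n" n "k n" w] D(3)[of "z m" m "k m" w] z(1)[of n] z(1)[of m] w
          unfolding I_def by auto
        then show ?thesis using dist_triangle2[of "z n" "z m" w] by linarith
      qed
      have "Cauchy z"
      proof (rule metric_CauchyI)
        fix e :: real assume "e > 0"
        then obtain N where N: "\<And>n. n \<ge> N \<Longrightarrow> 2 / Suc n < e / 2"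
          using eventually_two_over_Suc_less[of "e/2"] by auto
        have "dist (z m) (z n) < e" if "m \<ge> N" "n \<ge> N" for m n
          using dz[of m n] N[OF that(1)] N[OF that(2)] by linarith
        then show "\<exists>N. \<forall>m\<ge>N. \<forall>n\<ge>N. dist (z m) (z n) < e" by blast
      qed
      then obtain l where l: "z \<longlonglongrightarrow> l" using Cauchy_convergent_iff convergent_def by blast
      have "l \<in> Z" using closed_sequentially[OF Z _ l] z(1) unfolding I_def by blast
      have "(\<lambda>n. f (z n)) \<longlonglongrightarrow> f l"
        using f l by (intro isCont_tendsto_compose[of l f]) (auto simp: continuous_on_eq_continuous_at)
      moreover have "(\<lambda>n. f (z n)) \<longlonglongrightarrow> x"
      proof (rule metric_LIMSEQ_I)
        fix e :: real assume "e > 0"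
        then obtain N where N: "\<And>n. n \<ge> N \<Longrightarrow> 2 / Suc n < e"
          using eventually_two_over_Suc_less by blast
        have "dist (f (z n)) x < e" if "n \<ge> N" for n
        proof -
          have "1 / real (Suc n) \<le> 2 / Suc n" by (intro divide_right_mono) auto
          then show ?thesis using z(2)[of n] N[OF that] by linarith
        qed
        then show "\<exists>N. \<forall>n\<ge>N. dist (f (z n)) x < e" by blast
      qed
      ultimately have "f l = x" using LIMSEQ_unique by blast
      then show "x \<in> f ` Z" using \<open>l \<in> Z\<close> by blast
    qed
  qed
  moreover have "(\<Inter>n. \<Union>k. B (n, k)) \<in> sets borel"
    using Bs by (intro sets.countable_UN'' sets.countable_INT'') auto
  ultimately show ?thesis by simp
qed

theorem Lusin_Souslin_fst:
  fixes P :: "('a::polish_space \<times> 'b::polish_space) set"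
  assumes P: "P \<in> sets borel" and inj: "inj_on fst P"
  shows "fst ` P \<in> sets borel"
proof -
  obtain Z :: "(('a \<times> 'b) \<times> (nat \<Rightarrow> real)) set" where
    Z: "closed Z" "inj_on fst Z" "fst ` Z = P"
    using unique_closed_proj_borel[OF P] unfolding unique_closed_proj_def by blast
  have "(fst \<circ> fst) ` Z \<in> sets borel"
  proof (rule closed_inj_image_borel)
    show "continuous_on UNIV (fst \<circ> fst :: ('a \<times> 'b) \<times> (nat \<Rightarrow> real) \<Rightarrow> 'a)"
      unfolding comp_def by (intro continuous_intros)
    show "inj_on (fst \<circ> fst) Z" using Z inj by (intro comp_inj_on) auto
  qed (use Z in auto)
  then show ?thesis unfolding image_comp[symmetric] Z(3) .
qed

section \<open>Borel sets with bounded sections\<close>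

text \<open>A countable basis separates points; membership in its members is recorded as the ternary
  digits 0 and 1. In base 3 the tail after a digit is at most half of that digit's weight, so
  distinct digit sequences have distinct sums, unlike in base 2.\<close>

lemma ex_borel_inj_real:
  obtains g :: "'b::polish_space \<Rightarrow> real" where "inj g" "g \<in> borel_measurable borel"
proof -
  obtain U :: "nat \<Rightarrow> 'b set" where U: "\<And>n. open (U n)" "\<And>x y. x \<noteq> y \<Longrightarrow> \<exists>n. x \<in> U n \<and> y \<notin> U n"
  proof -
    obtain B :: "'b set set" where B: "countable B" "topological_basis B"
      using ex_countable_basis by blast
    have "B \<noteq> {}"
      using topological_basisE[OF B(2), of UNIV undefined] by auto
    show ?thesis
    proof (rule that[of "from_nat_into B"])
      show "open (from_nat_into B n)" for n
        using from_nat_into[OF \<open>B \<noteq> {}\<close>] B(2) topological_basis_open by blast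
      fix x y :: 'b assume "x \<noteq> y"
      then obtain V where "open V" "x \<in> V" "y \<notin> V" using t1_space by blast
      then obtain W where W: "W \<in> B" "x \<in> W" "W \<subseteq> V" using topological_basisE[OF B(2)] by metis
      then obtain n where "from_nat_into B n = W" using from_nat_into_surj[OF B(1)] by blast
      then show "\<exists>n. x \<in> from_nat_into B n \<and> y \<notin> from_nat_into B n"
        using W \<open>y \<notin> V\<close> by blast
    qed
  qed
  define t where "t x n = (1/3)^n * (indicator (U n) x :: real)" for x n
  have t: "0 \<le> t x n" "t x n \<le> (1/3)^n" for x n
    unfolding t_def by (auto simp: indicator_def)
  have geo: "summable (\<lambda>n. (1/3::real)^n)" by (rule summable_geometric) simp
  have sm: "summable (t x)" for x
    by (rule summable_comparison_test'[OF geo, of 0]) (use t in auto)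
  define g where "g x = suminf (t x)" for x
  have tail: "0 \<le> (\<Sum>k. t x (k + Suc n))" "(\<Sum>k. t x (k + Suc n)) \<le> (1/3)^n / 2" for x n
  proof -
    have s: "summable (\<lambda>k. t x (k + Suc n))" using summable_ignore_initial_segment[OF sm] .
    show "0 \<le> (\<Sum>k. t x (k + Suc n))" using s t by (intro suminf_nonneg) auto
    have gs: "(\<lambda>k. (1/3::real)^k * (1/3)^(Suc n)) sums ((1 / (1 - 1/3)) * (1/3)^(Suc n))"
      by (intro sums_mult2 geometric_sums) simp
    have "(\<Sum>k. t x (k + Suc n)) \<le> (\<Sum>k. (1/3::real)^k * (1/3)^(Suc n))"
      using s gs t(2)[of x "_ + Suc n"]
      by (intro suminf_le) (auto simp: sums_iff power_add)
    also have "\<dots> = (1/3)^n / 2" using gs by (simp add: sums_iff)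
    finally show "(\<Sum>k. t x (k + Suc n)) \<le> (1/3)^n / 2" .
  qed
  have "inj g"
  proof (rule injI, rule ccontr)
    fix x y assume eq: "g x = g y" and "x \<noteq> y"
    then obtain m where "x \<in> U m" "y \<notin> U m" using U(2)[of x y] by blast
    then have "t x m \<noteq> t y m" unfolding t_def by simp
    then obtain n where n: "t x n \<noteq> t y n" "\<And>k. k < n \<Longrightarrow> t x k = t y k"
      using exists_least_iff[of "\<lambda>m. t x m \<noteq> t y m"] by blast
    have split: "g z = (\<Sum>k. t z (k + Suc n)) + t z n + (\<Sum>k<n. t z k)" for z
      unfolding g_def using suminf_split_initial_segment[OF sm, of z "Suc n"] by simp
    have "(\<Sum>k<n. t x k) = (\<Sum>k<n. t y k)" using n(2) by (intro sum.cong) auto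
    then have "(\<Sum>k. t x (k + Suc n)) + t x n = (\<Sum>k. t y (k + Suc n)) + t y n"
      using eq split[of x] split[of y] by linarith
    moreover have "t x n = (1/3)^n \<and> t y n = 0 \<or> t x n = 0 \<and> t y n = (1/3)^n"
      using n(1) unfolding t_def by (auto simp: indicator_def split: if_splits)
    moreover have "(1/3::real)^n > 0" by simp
    ultimately show False using tail[of x n] tail[of y n] by linarith
  qed
  moreover have "g \<in> borel_measurable borel"
  proof -
    have [measurable]: "U n \<in> sets borel" for n using U(1) by auto
    show ?thesis unfolding g_def t_def by measurable
  qed
  ultimately show ?thesis using that by blast
qed

text \<open>
  Where a section has the maximal number of points, its increasing enumeration is unique, so
  Lusin-Souslin applies to the set of these enumerations.
\<close>
lemma bounded_sections_proj_borel:
  fixes P :: "('a::polish_space \<times> 'b::polish_space) set"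
  assumes "P \<in> sets borel" "\<And>x. finite (P `` {x}) \<and> card (P `` {x}) \<le> d"
  shows "fst ` P \<in> sets borel"
  using assms
proof (induction d arbitrary: P)
  case 0
  then have "P `` {x} = {}" for x by (metis card_0_eq le_zero_eq)
  then have "P = {}" by auto
  then show ?case by simp
next
  case (Suc d)
  obtain g :: "'b \<Rightarrow> real" where g: "inj g" and [measurable]: "g \<in> borel_measurable borel"
    using ex_borel_inj_real by blast
  note [measurable] = Suc.prems(1)
  \<comment> \<open>A point of \<open>Q\<close> lists \<open>d + 1\<close> section elements in
    increasing order of \<open>g\<close>. Entries beyond \<open>d\<close> repeat entry 0, so that
    the list determines the whole sequence.\<close>
  define Q where "Q = {z :: 'a \<times> (nat \<Rightarrow> 'b). (\<forall>i\<in>{..d}. (fst z, snd z i) \<in> P) \<and>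
     (\<forall>i\<in>{..<d}. g (snd z i) < g (snd z (Suc i))) \<and> (\<forall>i\<in>{d<..}. snd z i = snd z 0)}"
  have [measurable]: "(\<lambda>z :: 'a \<times> (nat \<Rightarrow> 'b). snd z i) \<in> borel_measurable borel" for i
    by (intro borel_measurable_continuous_onI continuous_on_snd_coordinate)
  have [measurable]: "(\<lambda>z :: 'a \<times> (nat \<Rightarrow> 'b). (fst z, snd z i)) \<in> borel_measurable borel" for i
    by (intro borel_measurable_continuous_onI continuous_on_snd_coordinate continuous_intros)
  have Qb: "Q \<in> sets borel" unfolding Q_def by measurable
  have enum: "distinct (map (\<lambda>i. g (w i)) [0..<Suc d]) \<and> sorted (map (\<lambda>i. g (w i)) [0..<Suc d]) \<and>
      set (map (\<lambda>i. g (w i)) [0..<Suc d]) = g ` (P `` {x})" if "(x, w) \<in> Q" for x w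
  proof -
    have "g (w i) < g (w j)" if "i < j" "j < Suc d" for i j
      using that
    proof (induction j)
      case (Suc j)
      have "g (w j) < g (w (Suc j))" using \<open>(x, w) \<in> Q\<close> Suc.prems unfolding Q_def by auto
      then show ?case using Suc by (cases "i = j") auto
    qed simp
    then have so: "sorted_wrt (<) (map (\<lambda>i. g (w i)) [0..<Suc d])"
      by (auto simp: sorted_wrt_iff_nth_less nth_append simp del: upt_Suc)
    then have ds: "distinct (map (\<lambda>i. g (w i)) [0..<Suc d])" "sorted (map (\<lambda>i. g (w i)) [0..<Suc d])"
      using strict_sorted_iff by blast+
    have fin: "finite (g ` (P `` {x}))" using Suc.prems(2) by blast
    have "set (map (\<lambda>i. g (w i)) [0..<Suc d]) = g ` (P `` {x})"
    proof (rule card_subset_eq[OF fin])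
      show "set (map (\<lambda>i. g (w i)) [0..<Suc d]) \<subseteq> g ` (P `` {x})"
        using that unfolding Q_def by (auto simp del: upt_Suc)
      then have "card (set (map (\<lambda>i. g (w i)) [0..<Suc d])) \<le> card (g ` (P `` {x}))"
        using fin card_mono by blast
      moreover have "card (set (map (\<lambda>i. g (w i)) [0..<Suc d])) = Suc d"
        using distinct_card[OF ds(1)] by simp
      moreover have "card (g ` (P `` {x})) \<le> Suc d"
        using Suc.prems(2)[of x] g card_image_le le_trans by blast
      ultimately show "card (set (map (\<lambda>i. g (w i)) [0..<Suc d])) = card (g ` (P `` {x}))" by linarith
    qed
    then show ?thesis using ds by blast
  qed
  have "inj_on fst Q"
  proof (rule inj_onI)
    fix z z' assume z: "z \<in> Q" "z' \<in> Q" "fst z = fst z'"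
    have "(fst z, snd z) \<in> Q" using z(1) by simp
    moreover have "(fst z, snd z') \<in> Q" using z(2) unfolding z(3) by simp
    ultimately have "map (\<lambda>i. g (snd z i)) [0..<Suc d] = map (\<lambda>i. g (snd z' i)) [0..<Suc d]"
      using enum by (metis sorted_distinct_set_unique)
    then have le: "snd z i = snd z' i" if "i \<le> d" for i
      using that g unfolding inj_def by (auto simp del: upt_Suc)
    moreover have "snd z i = snd z' i" if "i > d" for i
    proof -
      have "snd z i = snd z 0" "snd z' i = snd z' 0" using z that unfolding Q_def by auto
      then show ?thesis using le[of 0] by simp
    qed
    ultimately have "snd z i = snd z' i" for i using not_le_imp_less by blast
    then show "z = z'" using z(3) by (auto simp: prod_eq_iff)
  qed
  then have fQ: "fst ` Q \<in> sets borel" by (rule Lusin_Souslin_fst[OF Qb])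
  have full: "x \<in> fst ` Q" if card: "card (P `` {x}) = Suc d" for x
  proof -
    have fin: "finite (P `` {x})" using card card.infinite by fastforce
    define l where "l = sorted_list_of_set (g ` (P `` {x}))"
    have l: "sorted l" "distinct l" "set l = g ` (P `` {x})" "length l = Suc d"
      using fin card_image[OF inj_on_subset[OF g], of "P `` {x}"] card
      unfolding l_def by (auto simp del: sorted_list_of_set.sorted_key_list_of_set_unique)
    then have sl: "sorted_wrt (<) l" by (simp add: strict_sorted_iff)
    define w where "w i = inv g (l ! (if i \<le> d then i else 0))" for i
    have lw: "l ! i \<in> g ` (P `` {x})" if "i \<le> d" for i using l that by (metis le_imp_less_Suc nth_mem)
    have gw: "g (w i) = l ! i" if "i \<le> d" for i
      using lw[OF that] that unfolding w_def by (auto simp: inv_f_f[OF g])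
    have "(x, w) \<in> Q"
      unfolding Q_def
    proof (clarsimp, intro conjI ballI allI impI)
      fix i assume i: "i \<in> {..d}"
      have "w i \<in> P `` {x}" using lw[of i] i unfolding w_def by (auto simp: inv_f_f[OF g])
      then show "(x, w i) \<in> P" by simp
    next
      fix i assume "i \<in> {..<d}"
      then show "g (w i) < g (w (Suc i))"
        using gw sl l(4) by (auto simp: sorted_wrt_iff_nth_less)
    next
      fix i assume "i \<in> {d<..}"
      then show "w i = w 0" unfolding w_def by simp
    qed
    then show ?thesis by force
  qed
  \<comment> \<open>Once the maximal sections are removed, every section has at most
    \<open>d\<close> elements.\<close>
  define P' where "P' = P \<inter> ((- fst ` Q) \<times> UNIV)"
  have "fst ` P' \<in> sets borel"
  proof (rule Suc.IH)
    show "P' \<in> sets borel" unfolding P'_def using fQ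
      by (auto simp: borel_prod[symmetric] intro!: sets.Int pair_measureI Suc.prems(1)[unfolded borel_prod[symmetric]])
    fix x
    have sub: "P' `` {x} \<subseteq> P `` {x}" unfolding P'_def by auto
    have "card (P' `` {x}) \<le> d"
    proof (cases "card (P `` {x}) = Suc d")
      case True
      then have "P' `` {x} = {}" using full unfolding P'_def by auto
      then show ?thesis by simp
    next
      case False
      then show ?thesis using Suc.prems(2)[of x] card_mono[OF _ sub] by simp
    qed
    then show "finite (P' `` {x}) \<and> card (P' `` {x}) \<le> d"
      using Suc.prems(2)[of x] finite_subset[OF sub] by blast
  qed
  moreover have "fst ` P = fst ` P' \<union> fst ` Q"
  proof -
    have "fst ` Q \<subseteq> fst ` P" unfolding Q_def by force
    then show ?thesis unfolding P'_def by force
  qed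
  ultimately show ?case using fQ by simp
qed

text \<open>The \<open>g\<close>-least point of each section is peeled off. These points form the
  graph of a partial function, whose contribution is measurable by Lusin-Souslin, and the bound on
  the remaining sections drops by one.\<close>

lemma section_sum_measurable:
  fixes P :: "('a::polish_space \<times> 'b::polish_space) set" and h :: "'a \<times> 'b \<Rightarrow> ennreal"
  assumes "P \<in> sets borel" "\<And>x. finite (P `` {x}) \<and> card (P `` {x}) \<le> d"
    and h[measurable]: "h \<in> borel_measurable borel"
  shows "(\<lambda>x. \<Sum>y\<in>P `` {x}. h (x, y)) \<in> borel_measurable borel"
  using assms(1,2)
proof (induction d arbitrary: P)
  case 0
  then have "P `` {x} = {}" for x by (metis card_0_eq le_zero_eq)
  then show ?case by simp
next
  case (Suc d)
  obtain g :: "'b \<Rightarrow> real" where g: "inj g" and [measurable]: "g \<in> borel_measurable borel"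
    using ex_borel_inj_real by blast
  note [measurable] = Suc.prems(1)
  have [measurable]: "(\<lambda>z :: ('a \<times> 'b) \<times> 'b. snd z) \<in> borel_measurable borel"
    "(\<lambda>z :: ('a \<times> 'b) \<times> 'b. fst z) \<in> borel_measurable borel"
    "(\<lambda>z :: ('a \<times> 'b) \<times> 'b. snd (fst z)) \<in> borel_measurable borel"
    "(\<lambda>z :: ('a \<times> 'b) \<times> 'b. (fst (fst z), snd z)) \<in> borel_measurable borel"
    by (intro borel_measurable_continuous_onI continuous_intros)+
  \<comment> \<open>\<open>N\<close> pairs a point with a smaller one of the same section. Its
    sections are bounded, so the set of non-minimal points is a Borel projection.\<close>
  define N where "N = {z :: ('a \<times> 'b) \<times> 'b. fst z \<in> P \<and> (fst (fst z), snd z) \<in> P \<and> g (snd z) < g (snd (fst z))}"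
  have Ns: "N `` {z} \<subseteq> P `` {fst z}" for z unfolding N_def by auto
  have "fst ` N \<in> sets borel"
  proof (rule bounded_sections_proj_borel[where d = "Suc d"])
    show "N \<in> sets borel" unfolding N_def by measurable
    show "finite (N `` {z}) \<and> card (N `` {z}) \<le> Suc d" for z
      using Suc.prems(2)[of "fst z"] Ns[of z] card_mono finite_subset le_trans by metis
  qed
  define P0 where "P0 = P - fst ` N"
  have P0b[measurable]: "P0 \<in> sets borel" unfolding P0_def using \<open>fst ` N \<in> sets borel\<close> by simp
  have P0: "(x, y) \<in> P0 \<longleftrightarrow> (x, y) \<in> P \<and> (\<forall>y'\<in>P `` {x}. g y \<le> g y')" for x y
    unfolding P0_def N_def by (force simp: not_less image_iff)
  have uniq: "y = y'" if "(x, y) \<in> P0" "(x, y') \<in> P0" for x y y'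
    using that g unfolding P0 inj_def by (metis Image_singleton_iff order_antisym)
  have exP0: "\<exists>y. (x, y) \<in> P0" if "P `` {x} \<noteq> {}" for x
  proof -
    have "\<exists>y\<in>P `` {x}. \<forall>y'\<in>P `` {x}. g y \<le> g y'"
      using Suc.prems(2)[of x] that
      by (metis arg_min_least arg_min_if_finite(1))
    then show ?thesis unfolding P0 by auto
  qed
  have inj: "inj_on fst (P0 \<inter> W)" for W using uniq unfolding inj_on_def by auto
  define F where "F x = (\<Sum>y\<in>P0 `` {x}. h (x, y))" for x
  have single: "P0 `` {x} = {y}" if "(x, y) \<in> P0" for x y using uniq that by auto
  have "F \<in> borel_measurable borel"
  proof (rule measurableI)
    fix S :: "ennreal set" assume S[measurable]: "S \<in> sets borel"
    \<comment> \<open>Over an empty section the sum is 0, hence the extra part when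
      \<open>0 \<in> S\<close>.\<close>
    have eq: "F -` S = fst ` (P0 \<inter> h -` S) \<union> (if 0 \<in> S then - fst ` P0 else {})"
    proof (rule set_eqI)
      fix x
      show "x \<in> F -` S \<longleftrightarrow> x \<in> fst ` (P0 \<inter> h -` S) \<union> (if 0 \<in> S then - fst ` P0 else {})"
      proof (cases "\<exists>y. (x, y) \<in> P0")
        case True
        then obtain y where y: "(x, y) \<in> P0" by blast
        have "x \<in> fst ` (P0 \<inter> h -` S) \<longleftrightarrow> h (x, y) \<in> S"
        proof
          assume "x \<in> fst ` (P0 \<inter> h -` S)"
          then obtain y' where "(x, y') \<in> P0" "h (x, y') \<in> S" by auto
          then show "h (x, y) \<in> S" using uniq[OF y] by auto
        next
          assume "h (x, y) \<in> S"
          then have "(x, y) \<in> P0 \<inter> h -` S" using y by auto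
          then show "x \<in> fst ` (P0 \<inter> h -` S)" by (rule rev_image_eqI) simp
        qed
        moreover have "x \<in> fst ` P0" using y by (rule rev_image_eqI) simp
        moreover have "F x = h (x, y)" unfolding F_def single[OF y] by simp
        ultimately show ?thesis by simp
      next
        case False
        then have "P0 `` {x} = {}" "x \<notin> fst ` P0" "x \<notin> fst ` (P0 \<inter> h -` S)" by auto
        moreover then have "F x = 0" unfolding F_def by simp
        ultimately show ?thesis by simp
      qed
    qed
    have "P0 \<inter> h -` S \<in> sets borel" using sets.Int[OF P0b measurable_sets[OF h S]] by simp
    then have "fst ` (P0 \<inter> h -` S) \<in> sets borel" by (rule Lusin_Souslin_fst[OF _ inj])
    moreover have "fst ` P0 \<in> sets borel"
      using Lusin_Souslin_fst[OF P0b] inj[of UNIV] by simp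
    ultimately show "F -` S \<inter> space borel \<in> sets borel" unfolding eq by simp
  qed simp
  moreover have "(\<lambda>x. \<Sum>y\<in>(P - P0) `` {x}. h (x, y)) \<in> borel_measurable borel"
  proof (rule Suc.IH)
    show "P - P0 \<in> sets borel" by measurable
    fix x
    show "finite ((P - P0) `` {x}) \<and> card ((P - P0) `` {x}) \<le> d"
    proof (cases "P `` {x} = {}")
      case True
      then have "(P - P0) `` {x} = {}" by auto
      then show ?thesis by simp
    next
      case False
      then obtain y where y: "(x, y) \<in> P0" using exP0 by blast
      have "(P - P0) `` {x} = P `` {x} - P0 `` {x}" by blast
      moreover have "y \<in> P `` {x}" using y unfolding P0_def by blast
      moreover note single[OF y]
      ultimately show ?thesis using Suc.prems(2)[of x] by (auto simp: card_Diff_singleton_if)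
    qed
  qed
  moreover have "(\<Sum>y\<in>P `` {x}. h (x, y)) = F x + (\<Sum>y\<in>(P - P0) `` {x}. h (x, y))" for x
  proof -
    have "P `` {x} = P0 `` {x} \<union> (P - P0) `` {x}" unfolding P0_def by auto
    moreover have "finite (P `` {x})" using Suc.prems(2) by blast
    moreover have "P0 `` {x} \<inter> (P - P0) `` {x} = {}" by auto
    ultimately show ?thesis unfolding F_def by (metis finite_Un sum.union_disjoint)
  qed
  ultimately show ?case by simp
qed

lemma section_card_measurable:
  fixes P :: "('a::polish_space \<times> 'b::polish_space) set"
  assumes "P \<in> sets borel" "\<And>x. finite (P `` {x}) \<and> card (P `` {x}) \<le> d"
  shows "(\<lambda>x. card (P `` {x})) \<in> measurable borel (count_space UNIV)"
proof -
  have "(\<lambda>x. \<Sum>y\<in>P `` {x}. (\<lambda>_. 1) (x, y) :: ennreal) \<in> borel_measurable borel"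
    by (rule section_sum_measurable[OF assms]) simp
  then have "(\<lambda>x. of_nat (card (P `` {x})) :: ennreal) \<in> borel_measurable borel" by simp
  then have "{x \<in> space borel. (of_nat (card (P `` {x})) :: ennreal) = of_nat n} \<in> sets borel" for n
    by (rule borel_measurable_eq) simp
  then have m: "{x. card (P `` {x}) = n} \<in> sets borel" for n by simp
  show ?thesis
    unfolding measurable_count_space_eq2_countable
    using m by (auto simp: vimage_def)
qed

section \<open>Mass transport in graphings\<close>

definition bounded_sections :: "('a \<times> 'b) set \<Rightarrow> bool" where
  "bounded_sections P \<longleftrightarrow> (\<exists>d::nat. \<forall>x. finite (P `` {x}) \<and> card (P `` {x}) \<le> d)"

lemma bounded_sections_finite: "bounded_sections P \<Longrightarrow> finite (P `` {x})"
  unfolding bounded_sections_def by blast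

lemma bounded_sections_mono:
  assumes "bounded_sections P" "\<And>z. Q `` {z} \<subseteq> P `` {f z}"
  shows "bounded_sections Q"
proof -
  obtain d where d: "\<And>x. finite (P `` {x}) \<and> card (P `` {x}) \<le> d"
    using assms(1) unfolding bounded_sections_def by blast
  have "finite (Q `` {z}) \<and> card (Q `` {z}) \<le> d" for z
    using d[of "f z"] assms(2)[of z] by (meson card_mono finite_subset le_trans)
  then show ?thesis unfolding bounded_sections_def by blast
qed

lemma bounded_sections_subset: "bounded_sections P \<Longrightarrow> Q \<subseteq> P \<Longrightarrow> bounded_sections Q"
  by (rule bounded_sections_mono[where f = "\<lambda>x. x"]) auto

lemma bounded_sections_Un:
  assumes "bounded_sections P" "bounded_sections Q"
  shows "bounded_sections (P \<union> Q)"
proof -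
  obtain d e where d: "\<And>x. finite (P `` {x}) \<and> card (P `` {x}) \<le> d"
    "\<And>x. finite (Q `` {x}) \<and> card (Q `` {x}) \<le> e"
    using assms unfolding bounded_sections_def by metis
  have "finite ((P \<union> Q) `` {x}) \<and> card ((P \<union> Q) `` {x}) \<le> d + e" for x
    using d[of x] card_Un_le[of "P `` {x}" "Q `` {x}"] unfolding Un_Image
    by (meson add_mono finite_UnI le_trans)
  then show ?thesis unfolding bounded_sections_def by blast
qed

lemma bounded_sections_Id: "bounded_sections Id"
  unfolding bounded_sections_def by (intro exI[of _ 1]) auto

lemma bounded_sections_relcomp:
  assumes "bounded_sections P" "bounded_sections Q"
  shows "bounded_sections (P O Q)"
proof -
  obtain d e where d: "\<And>x. finite (P `` {x}) \<and> card (P `` {x}) \<le> d"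
    "\<And>x. finite (Q `` {x}) \<and> card (Q `` {x}) \<le> e"
    using assms unfolding bounded_sections_def by metis
  have "finite ((P O Q) `` {x}) \<and> card ((P O Q) `` {x}) \<le> d * e" for x
  proof -
    have eq: "(P O Q) `` {x} = (\<Union>y\<in>P `` {x}. Q `` {y})" by auto
    have "card (\<Union>y\<in>P `` {x}. Q `` {y}) \<le> (\<Sum>y\<in>P `` {x}. card (Q `` {y}))"
      using d by (intro card_UN_le) auto
    also have "\<dots> \<le> card (P `` {x}) * e" using d(2) sum_bounded_above[of "P `` {x}" _ e] by simp
    also have "\<dots> \<le> d * e" using d(1) by simp
    finally show ?thesis unfolding eq using d by auto
  qed
  then show ?thesis unfolding bounded_sections_def by blast
qed

lemma section_sum_borel:
  fixes P :: "('a::polish_space \<times> 'b::polish_space) set" and h :: "'a \<times> 'b \<Rightarrow> ennreal"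
  assumes "P \<in> sets borel" "bounded_sections P" "h \<in> borel_measurable borel"
  shows "(\<lambda>x. \<Sum>y\<in>P `` {x}. h (x, y)) \<in> borel_measurable borel"
  using assms section_sum_measurable unfolding bounded_sections_def by blast

lemma section_card_borel:
  fixes P :: "('a::polish_space \<times> 'b::polish_space) set"
  assumes "P \<in> sets borel" "bounded_sections P"
  shows "(\<lambda>x. card (P `` {x})) \<in> measurable borel (count_space UNIV)"
  using assms section_card_measurable unfolding bounded_sections_def by blast

lemma borel_triple_measurable [measurable]:
  "(\<lambda>z :: ('a::polish_space \<times> 'a) \<times> 'a. (fst (fst z), snd z)) \<in> borel_measurable borel"
  "(\<lambda>z :: ('a \<times> 'a) \<times> 'a. (snd z, snd (fst z))) \<in> borel_measurable borel"
  by (intro borel_measurable_continuous_onI continuous_intros)+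

lemma swap_borel_measurable [measurable]:
  "(\<lambda>z :: 'a::polish_space \<times> 'b::polish_space. (snd z, fst z)) \<in> borel_measurable borel"
  by (intro borel_measurable_continuous_onI continuous_intros)

lemma fst_snd_borel_measurable:
  "(fst :: 'a::polish_space \<times> 'b::polish_space \<Rightarrow> 'a) \<in> borel_measurable borel"
  "(snd :: 'a::polish_space \<times> 'b::polish_space \<Rightarrow> 'b) \<in> borel_measurable borel"
  by (intro borel_measurable_continuous_onI continuous_intros)+

lemma pair_section_sum_borel:
  fixes P :: "('a::polish_space \<times> 'a) set" and h :: "('a \<times> 'a) \<times> 'a \<Rightarrow> ennreal"
  assumes "P \<in> sets borel" "bounded_sections P" "f \<in> borel_measurable borel" "h \<in> borel_measurable borel"
  shows "(\<lambda>z. \<Sum>w\<in>P `` {f z}. h (z, w)) \<in> borel_measurable borel"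
proof -
  have "(\<lambda>z :: ('a \<times> 'a) \<times> 'a. (f (fst z), snd z)) \<in> borel_measurable borel"
    using assms(3) fst_snd_borel_measurable by measurable
  from measurable_sets[OF this assms(1)]
  have T: "{z. (f (fst z), snd z) \<in> P} \<in> sets borel" by (simp add: vimage_def)
  have "bounded_sections {z. (f (fst z), snd z) \<in> P}"
    by (rule bounded_sections_mono[OF assms(2), where f = f]) auto
  from section_sum_borel[OF T this assms(4)] show ?thesis by (simp add: Image_def)
qed

text \<open>The composition is the projection that forgets the intermediate point, and its fibres
  are bounded because those of \<open>P\<close> are.\<close>

lemma relcomp_borel:
  fixes P Q :: "('a::polish_space \<times> 'a) set"
  assumes [measurable]: "P \<in> sets borel" "Q \<in> sets borel" and P: "bounded_sections P"
  shows "P O Q \<in> sets borel"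
proof -
  define T where "T = {z :: ('a \<times> 'a) \<times> 'a. (fst (fst z), snd z) \<in> P \<and> (snd z, snd (fst z)) \<in> Q}"
  have "T \<in> sets borel" unfolding T_def by measurable
  moreover have "bounded_sections T"
    by (rule bounded_sections_mono[OF P, where f = fst]) (auto simp: T_def)
  ultimately have "fst ` T \<in> sets borel"
    unfolding bounded_sections_def using bounded_sections_proj_borel by blast
  moreover have "fst ` T = P O Q"
    unfolding T_def by (force simp: image_iff)
  ultimately show ?thesis by simp
qed

lemma Id_borel: "(Id :: ('a::polish_space \<times> 'a) set) \<in> sets borel"
proof -
  have "closed {z :: 'a \<times> 'a. fst z = snd z}" by (intro closed_Collect_eq continuous_intros)
  moreover have "{z :: 'a \<times> 'a. fst z = snd z} = Id" by auto
  ultimately show ?thesis by (metis borel_closed)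
qed

lemma relpow_borel:
  fixes P :: "('a::polish_space \<times> 'a) set"
  assumes "P \<in> sets borel" "bounded_sections P"
  shows "P ^^ n \<in> sets borel \<and> bounded_sections (P ^^ n)"
proof (induction n)
  case 0
  show ?case using Id_borel bounded_sections_Id by simp
next
  case (Suc n)
  then show ?case using assms relcomp_borel bounded_sections_relcomp by auto
qed

section \<open>Balls exhausting a component\<close>

lemma relpow_refl_mono:
  assumes "Id \<subseteq> P" "m \<le> n"
  shows "P ^^ m \<subseteq> P ^^ n"
proof -
  have "P ^^ n \<subseteq> P ^^ Suc n" for n using assms(1) by auto
  then show ?thesis using assms(2) by (rule lift_Suc_mono_le)
qed

lemma sym_relpow: "sym P \<Longrightarrow> sym (P ^^ n)"
proof (induction n)
  case 0
  show ?case by (simp add: sym_Id)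
next
  case (Suc n)
  have "(P ^^ Suc n)\<inverse> = P\<inverse> O (P ^^ n)\<inverse>" by (simp add: converse_relcomp)
  also have "\<dots> = P ^^ Suc n" using Suc by (simp add: sym_conv_converse_eq relpow_commute)
  finally show ?case using sym_conv_converse_eq by blast
qed

lemma sym_edges_iff_sym: "sym_edges F \<longleftrightarrow> sym F"
  unfolding sym_edges_def sym_def ..

text \<open>The ball of radius \<open>n\<close>: adding \<open>Id\<close> turns walks of length
  exactly \<open>n\<close> into walks of length at most \<open>n\<close>.\<close>

definition nball :: "('a \<times> 'a) set \<Rightarrow> nat \<Rightarrow> 'a \<Rightarrow> 'a set" where
  "nball F n x = ((F \<union> Id) ^^ n) `` {x}"

lemma rtrancl_eq_UN_relpow_reflcl: "F\<^sup>* = (\<Union>n. (F \<union> Id) ^^ n)"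
  using rtrancl_is_UN_relpow[of "F \<union> Id"] by (metis rtrancl_reflcl)

lemma comp_eq_UN_nball: "comp F x = (\<Union>n. nball F n x)"
  unfolding comp_def nball_def rtrancl_eq_UN_relpow_reflcl by auto

lemma nball_mono: "m \<le> n \<Longrightarrow> nball F m x \<subseteq> nball F n x"
  unfolding nball_def using relpow_refl_mono[of "F \<union> Id" m n] by blast

lemma nball_self: "x \<in> nball F n x"
  using nball_mono[of 0 n F x] by (auto simp: nball_def)

lemma comp_self: "x \<in> comp F x"
  unfolding comp_def by simp

lemma comp_mono: "F \<subseteq> G \<Longrightarrow> comp F x \<subseteq> comp G x"
  unfolding comp_def using rtrancl_mono by blast

lemma comp_eq:
  assumes "sym F" "y \<in> comp F x"
  shows "comp F y = comp F x"
proof -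
  have "(x, y) \<in> F\<^sup>*" "(y, x) \<in> F\<^sup>*"
    using assms sym_rtrancl[OF assms(1)] unfolding comp_def sym_def by auto
  then show ?thesis unfolding comp_def by (blast intro: rtrancl_trans)
qed

lemma incseq_finite_subset_UN:
  assumes "incseq B" "finite C" "C \<subseteq> (\<Union>n::nat. B n)"
  shows "\<exists>N. \<forall>n\<ge>N. C \<subseteq> B n"
proof -
  have "\<exists>N. C \<subseteq> B N" using assms(2,3)
  proof (induction C)
    case (insert c C)
    then obtain N k where "C \<subseteq> B N" "c \<in> B k" by auto
    moreover have "B N \<subseteq> B (max N k)" "B k \<subseteq> B (max N k)"
      using assms(1) unfolding incseq_def by auto
    ultimately have "insert c C \<subseteq> B (max N k)" by blast
    then show ?case by blast
  qed simp
  then show ?thesis using assms(1) unfolding incseq_def by (meson order_trans)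
qed

text \<open>For a finite union the sequence is eventually constant. For an infinite one the
  cardinalities diverge, and the limit 0 agrees with the convention that an infinite set has
  cardinality 0.\<close>

lemma LIMSEQ_inverse_card:
  assumes "incseq B" "\<And>n. finite (B n)" "\<And>n. B n \<noteq> {}"
  shows "(\<lambda>n. 1 / real (card (B n))) \<longlonglongrightarrow> 1 / real (card (\<Union>n. B n))"
proof (cases "finite (\<Union>n. B n)")
  case True
  then obtain N where "\<forall>n\<ge>N. (\<Union>n. B n) \<subseteq> B n"
    using incseq_finite_subset_UN[OF assms(1) True] by blast
  then have "\<forall>n\<ge>N. B n = (\<Union>n. B n)" by blast
  then show ?thesis
    by (intro tendsto_eventually) (unfold eventually_sequentially, metis)
next
  case False
  have "filterlim (\<lambda>n. card (B n)) at_top sequentially"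
    unfolding filterlim_at_top
  proof
    fix Z
    obtain C where C: "finite C" "card C = Z" "C \<subseteq> (\<Union>n. B n)"
      using False infinite_arbitrarily_large by metis
    then obtain N where "\<forall>n\<ge>N. C \<subseteq> B n"
      using incseq_finite_subset_UN[OF assms(1)] by blast
    then have "Z \<le> card (B n)" if "n \<ge> N" for n
      using assms(2) that C(2) card_mono by blast
    then show "eventually (\<lambda>n. Z \<le> card (B n)) sequentially"
      unfolding eventually_sequentially by blast
  qed
  then have "(\<lambda>n. 1 / real (card (B n))) \<longlonglongrightarrow> 0"
    by (intro tendsto_divide_0[OF tendsto_const] filterlim_at_top_imp_at_infinity
        filterlim_compose[OF filterlim_real_sequentially])
  then show ?thesis using False by simp
qed

text \<open>Components may be infinite, so they cannot be counted as bounded sections. Balls can,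
  and their inverse sizes converge pointwise.\<close>

lemma inverse_card_comp_measurable:
  fixes F :: "('a::polish_space \<times> 'a) set"
  assumes "F \<in> sets borel" "bounded_sections F"
  shows "(\<lambda>x. 1 / real (card (comp F x))) \<in> borel_measurable borel"
proof (rule borel_measurable_LIMSEQ_real)
  have P: "(F \<union> Id) ^^ n \<in> sets borel \<and> bounded_sections ((F \<union> Id) ^^ n)" for n
    using assms Id_borel by (intro relpow_borel bounded_sections_Un bounded_sections_Id sets.Un)
  have "(\<lambda>x. card (nball F n x)) \<in> measurable borel (count_space UNIV)" for n
    unfolding nball_def by (rule section_card_borel[OF conjunct1[OF P] conjunct2[OF P]])
  then show "(\<lambda>x. 1 / real (card (nball F n x))) \<in> borel_measurable borel" for n
    by (rule measurable_compose[where g = "\<lambda>k. 1 / real k"]) simp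
  show "(\<lambda>n. 1 / real (card (nball F n x))) \<longlonglongrightarrow> 1 / real (card (comp F x))" for x
    unfolding comp_eq_UN_nball
  proof (rule LIMSEQ_inverse_card)
    show "incseq (\<lambda>n. nball F n x)" unfolding incseq_def by (intro allI impI nball_mono)
    show "finite (nball F n x)" for n
      unfolding nball_def by (rule bounded_sections_finite[OF conjunct2[OF P]])
    show "nball F n x \<noteq> {}" for n using nball_self by fast
  qed
qed

text \<open>The mass transport principle along \<open>P\<close>: with \<open>h (x, y)\<close> the
  mass sent from \<open>x\<close> to \<open>y\<close>, total mass sent equals total mass
  received.\<close>

definition mass_transport :: "'a::polish_space measure \<Rightarrow> ('a \<times> 'a) set \<Rightarrow> bool" where
  "mass_transport M P \<longleftrightarrow> (\<forall>h::'a \<times> 'a \<Rightarrow> ennreal. h \<in> borel_measurable borel \<longrightarrow>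
     (\<integral>\<^sup>+ x. (\<Sum>y\<in>P `` {x}. h (x, y)) \<partial>M) = (\<integral>\<^sup>+ x. (\<Sum>y\<in>P `` {x}. h (y, x)) \<partial>M))"

lemma mass_transportD:
  fixes h :: "'a::polish_space \<times> 'a \<Rightarrow> ennreal"
  assumes "mass_transport M P" "h \<in> borel_measurable borel"
  shows "(\<integral>\<^sup>+ x. (\<Sum>y\<in>P `` {x}. h (x, y)) \<partial>M) = (\<integral>\<^sup>+ x. (\<Sum>y\<in>P `` {x}. h (y, x)) \<partial>M)"
  using assms unfolding mass_transport_def by blast

lemma relcomp_sum:
  fixes k :: "'a \<Rightarrow> ennreal"
  assumes "finite (P `` {x})" "finite ((P O Q) `` {x})"
  shows "(\<Sum>y\<in>P `` {x}. \<Sum>z\<in>Q `` {y}. k z) =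
    (\<Sum>z\<in>(P O Q) `` {x}. of_nat (card {y. (x, y) \<in> P \<and> (y, z) \<in> Q}) * k z)"
proof -
  have "(\<Sum>y\<in>P `` {x}. \<Sum>z\<in>Q `` {y}. k z) =
      (\<Sum>y\<in>P `` {x}. \<Sum>z\<in>{z\<in>(P O Q) `` {x}. (y, z) \<in> Q}. k z)"
    by (intro sum.cong refl) auto
  also have "\<dots> = (\<Sum>z\<in>(P O Q) `` {x}. \<Sum>y\<in>{y\<in>P `` {x}. (y, z) \<in> Q}. k z)"
    by (rule sum.swap_restrict[OF assms])
  also have "\<dots> = (\<Sum>z\<in>(P O Q) `` {x}. of_nat (card {y. (x, y) \<in> P \<and> (y, z) \<in> Q}) * k z)"
    by (intro sum.cong refl) simp
  finally show ?thesis .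
qed

text \<open>Weights are divided by the number of intermediate points and then transported in two steps.\<close>
lemma mass_transport_relcomp:
  fixes P Q :: "('a::polish_space \<times> 'a) set"
  assumes M: "sets M = sets borel"
    and P[measurable]: "P \<in> sets borel" and bP: "bounded_sections P" and symP: "sym P"
    and Q[measurable]: "Q \<in> sets borel" and bQ: "bounded_sections Q" and symQ: "sym Q"
    and tP: "mass_transport M P" and tQ: "mass_transport M Q" and comm: "P O Q = Q O P"
  shows "mass_transport M (P O Q)"
  unfolding mass_transport_def
proof (intro allI impI)
  fix h :: "'a \<times> 'a \<Rightarrow> ennreal" assume h[measurable]: "h \<in> borel_measurable borel"
  define m where "m z = card {y. (fst z, y) \<in> P \<and> (y, snd z) \<in> Q}" for z
  define k where "k z = h z / of_nat (m z)" for z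
  have m_meas: "m \<in> measurable borel (count_space UNIV)"
  proof -
    define T where "T = {z :: ('a \<times> 'a) \<times> 'a. (fst (fst z), snd z) \<in> P \<and> (snd z, snd (fst z)) \<in> Q}"
    have "T \<in> sets borel" unfolding T_def by measurable
    moreover have "bounded_sections T"
      by (rule bounded_sections_mono[OF bP, where f = fst]) (auto simp: T_def)
    ultimately have "(\<lambda>z. card (T `` {z})) \<in> measurable borel (count_space UNIV)"
      by (rule section_card_borel)
    moreover have "T `` {z} = {y. (fst z, y) \<in> P \<and> (y, snd z) \<in> Q}" for z unfolding T_def by auto
    ultimately show ?thesis unfolding m_def by simp
  qed
  then have k[measurable]: "k \<in> borel_measurable borel"
    unfolding k_def by measurable
  have mk: "of_nat (m z) * k z = h z" if "z \<in> P O Q" for z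
  proof -
    have "finite {y. (fst z, y) \<in> P \<and> (y, snd z) \<in> Q}"
      using bounded_sections_finite[OF bP, of "fst z"] by (rule rev_finite_subset) auto
    moreover have "{y. (fst z, y) \<in> P \<and> (y, snd z) \<in> Q} \<noteq> {}" using that by auto
    ultimately have "m z \<noteq> 0" unfolding m_def by simp
    then show ?thesis unfolding k_def
      by (metis ennreal_of_nat_neq_top ennreal_times_divide mult.commute mult_divide_eq_ennreal of_nat_eq_0_iff)
  qed
  define h1 where "h1 z = (\<Sum>w\<in>Q `` {snd z}. k (fst z, w))" for z
  define h2 where "h2 z = (\<Sum>y\<in>P `` {fst z}. k (y, snd z))" for z
  note pair_section_sum_borel[OF Q bQ fst_snd_borel_measurable(2), of "\<lambda>z. k (fst (fst z), snd z)"]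
  then have h1: "h1 \<in> borel_measurable borel" unfolding h1_def by simp
  note pair_section_sum_borel[OF P bP fst_snd_borel_measurable(1), of "\<lambda>z. k (snd z, snd (fst z))"]
  then have h2: "h2 \<in> borel_measurable borel" unfolding h2_def by simp
  have fin: "finite (P `` {x})" "finite (Q `` {x})" "finite ((P O Q) `` {x})" "finite ((Q O P) `` {x})" for x
    using bP bQ bounded_sections_relcomp bounded_sections_finite by metis+
  have "(\<integral>\<^sup>+ x. (\<Sum>z\<in>(P O Q) `` {x}. h (x, z)) \<partial>M) = (\<integral>\<^sup>+ x. (\<Sum>y\<in>P `` {x}. h1 (x, y)) \<partial>M)"
  proof (intro nn_integral_cong)
    fix x
    have "(\<Sum>y\<in>P `` {x}. h1 (x, y)) = (\<Sum>z\<in>(P O Q) `` {x}. of_nat (m (x, z)) * k (x, z))"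
      unfolding h1_def m_def using relcomp_sum[OF fin(1,3), of "\<lambda>w. k (x, w)" x] by simp
    also have "\<dots> = (\<Sum>z\<in>(P O Q) `` {x}. h (x, z))" by (intro sum.cong refl mk) auto
    finally show "(\<Sum>z\<in>(P O Q) `` {x}. h (x, z)) = (\<Sum>y\<in>P `` {x}. h1 (x, y))" by simp
  qed
  also have "\<dots> = (\<integral>\<^sup>+ x. (\<Sum>y\<in>P `` {x}. h1 (y, x)) \<partial>M)" by (rule mass_transportD[OF tP h1])
  \<comment> \<open>After the first transport \<open>x\<close> is the midpoint, with source and
    target both among its neighbours, so the two sums can be exchanged.\<close>
  also have "\<dots> = (\<integral>\<^sup>+ x. (\<Sum>z\<in>Q `` {x}. h2 (x, z)) \<partial>M)"
    unfolding h1_def h2_def fst_conv snd_conv by (intro nn_integral_cong sum.swap)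
  also have "\<dots> = (\<integral>\<^sup>+ x. (\<Sum>z\<in>Q `` {x}. h2 (z, x)) \<partial>M)" by (rule mass_transportD[OF tQ h2])
  also have "\<dots> = (\<integral>\<^sup>+ x. (\<Sum>y\<in>(P O Q) `` {x}. h (y, x)) \<partial>M)"
  proof (intro nn_integral_cong)
    fix x
    \<comment> \<open>Seen from the target, the walk runs along \<open>Q\<close> first and then
      along \<open>P\<close>; this is where the two relations have to commute.\<close>
    have "(\<Sum>z\<in>Q `` {x}. h2 (z, x)) =
        (\<Sum>y\<in>(Q O P) `` {x}. of_nat (card {z. (x, z) \<in> Q \<and> (z, y) \<in> P}) * k (y, x))"
      unfolding h2_def using relcomp_sum[OF fin(2,4), of "\<lambda>y. k (y, x)" x] by simp
    also have "\<dots> = (\<Sum>y\<in>(Q O P) `` {x}. h (y, x))"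
    proof (intro sum.cong refl)
      fix y assume y: "y \<in> (Q O P) `` {x}"
      have "{z. (x, z) \<in> Q \<and> (z, y) \<in> P} = {z. (y, z) \<in> P \<and> (z, x) \<in> Q}"
        using symP symQ unfolding sym_def by blast
      then have "card {z. (x, z) \<in> Q \<and> (z, y) \<in> P} = m (y, x)" unfolding m_def by simp
      moreover have "(y, x) \<in> P O Q" using y symP symQ unfolding sym_def by blast
      ultimately show "of_nat (card {z. (x, z) \<in> Q \<and> (z, y) \<in> P}) * k (y, x) = h (y, x)"
        using mk by simp
    qed
    finally show "(\<Sum>z\<in>Q `` {x}. h2 (z, x)) = (\<Sum>y\<in>(P O Q) `` {x}. h (y, x))"
      unfolding comm .
  qed
  finally show "(\<integral>\<^sup>+ x. (\<Sum>y\<in>(P O Q) `` {x}. h (x, y)) \<partial>M) =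
    (\<integral>\<^sup>+ x. (\<Sum>y\<in>(P O Q) `` {x}. h (y, x)) \<partial>M)" .
qed

lemma mass_transport_subset:
  fixes P F :: "('a::polish_space \<times> 'a) set"
  assumes "mass_transport M P" "bounded_sections P" "F \<subseteq> P"
    and F[measurable]: "F \<in> sets borel" and "sym F"
  shows "mass_transport M F"
  unfolding mass_transport_def
proof (intro allI impI)
  fix h :: "'a \<times> 'a \<Rightarrow> ennreal" assume h[measurable]: "h \<in> borel_measurable borel"
  have "(\<Sum>y\<in>F `` {x}. h (x, y)) = (\<Sum>y\<in>P `` {x}. indicator F (x, y) * h (x, y))" for x
    using bounded_sections_finite[OF assms(2)] assms(3)
    by (intro sum.mono_neutral_cong_left) (auto simp: indicator_def)
  moreover have "(\<Sum>y\<in>F `` {x}. h (y, x)) = (\<Sum>y\<in>P `` {x}. indicator F (y, x) * h (y, x))" for x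
    using bounded_sections_finite[OF assms(2)] assms(3) \<open>sym F\<close>
    by (intro sum.mono_neutral_cong_left) (auto simp: indicator_def sym_def)
  moreover have "(\<lambda>z. indicator F z * h z) \<in> borel_measurable borel" by measurable
  ultimately show "(\<integral>\<^sup>+ x. (\<Sum>y\<in>F `` {x}. h (x, y)) \<partial>M) = (\<integral>\<^sup>+ x. (\<Sum>y\<in>F `` {x}. h (y, x)) \<partial>M)"
    using mass_transportD[OF assms(1), of "\<lambda>z. indicator F z * h z"] by simp
qed

lemma mass_transport_Un_Id:
  fixes F :: "('a::polish_space \<times> 'a) set"
  assumes M: "sets M = sets borel" and tF: "mass_transport M F"
    and F[measurable]: "F \<in> sets borel" and bF: "bounded_sections F" and irr: "\<And>x. (x, x) \<notin> F"
  shows "mass_transport M (F \<union> Id)"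
  unfolding mass_transport_def
proof (intro allI impI)
  fix h :: "'a \<times> 'a \<Rightarrow> ennreal" assume h[measurable]: "h \<in> borel_measurable borel"
  have eq: "(\<Sum>y\<in>(F \<union> Id) `` {x}. k y) = k x + (\<Sum>y\<in>F `` {x}. k y)" for k :: "'a \<Rightarrow> ennreal" and x
  proof -
    have "(F \<union> Id) `` {x} = insert x (F `` {x})" by auto
    moreover have "x \<notin> F `` {x}" using irr by auto
    ultimately show ?thesis using bounded_sections_finite[OF bF] by simp
  qed
  have diag: "(\<lambda>x. h (x, x)) \<in> borel_measurable M"
  proof -
    have "(\<lambda>x::'a. (x, x)) \<in> borel_measurable borel"
      by (intro borel_measurable_continuous_onI continuous_intros)
    then show ?thesis unfolding measurable_cong_sets[OF M refl] by measurable
  qed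
  have s1: "(\<lambda>x. \<Sum>y\<in>F `` {x}. h (x, y)) \<in> borel_measurable M"
    unfolding measurable_cong_sets[OF M refl] by (rule section_sum_borel[OF F bF h])
  have "(\<lambda>z. h (snd z, fst z)) \<in> borel_measurable borel" by measurable
  then have s2: "(\<lambda>x. \<Sum>y\<in>F `` {x}. h (y, x)) \<in> borel_measurable M"
    unfolding measurable_cong_sets[OF M refl] using section_sum_borel[OF F bF, of "\<lambda>z. h (snd z, fst z)"] by simp
  show "(\<integral>\<^sup>+ x. (\<Sum>y\<in>(F \<union> Id) `` {x}. h (x, y)) \<partial>M) = (\<integral>\<^sup>+ x. (\<Sum>y\<in>(F \<union> Id) `` {x}. h (y, x)) \<partial>M)"
    unfolding eq using diag s1 s2 mass_transportD[OF tF h] by (simp add: nn_integral_add)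
qed

section \<open>Borel edge sets and mass transport inside one graphing\<close>

lemma nbrs_eq_Image: "nbrs F x = F `` {x}"
  unfolding nbrs_def by auto

locale graphing_on =
  fixes M :: "'a::polish_space measure" and E :: "('a \<times> 'a) set"
  assumes graphing: "graphing M E"
begin

lemma sets_M: "sets M = sets borel"
  using graphing unfolding graphing_def by blast

lemma space_M: "space M = UNIV"
  using sets_eq_imp_space_eq[OF sets_M] by simp

lemma measurable_M_iff: "f \<in> borel_measurable M \<longleftrightarrow> f \<in> borel_measurable borel"
  by (simp add: measurable_cong_sets[OF sets_M refl])

lemma finite_measure_M: "finite_measure M"
  using graphing unfolding graphing_def by blast

sublocale finite_measure M
  by (rule finite_measure_M)

lemma sets_pair_M: "sets (M \<Otimes>\<^sub>M M) = sets (borel :: ('a \<times> 'a) measure)"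
  using sets_pair_measure_cong[OF sets_M sets_M] unfolding borel_prod .

lemma E_borel: "E \<in> sets borel"
  using graphing sets_pair_M unfolding graphing_def by blast

lemma sym_E: "sym E"
  using graphing sym_edges_iff_sym unfolding graphing_def by blast

lemma irrefl_E: "(x, x) \<notin> E"
  using graphing unfolding graphing_def by blast

lemma bounded_E: "bounded_sections E"
  using graphing unfolding graphing_def bounded_sections_def nbrs_eq_Image by blast

lemma deg_balance:
  "A \<in> sets borel \<Longrightarrow> B \<in> sets borel \<Longrightarrow>
    (\<integral>\<^sup>+ x. ennreal (real (deg_in E B x)) * indicator A x \<partial>M) =
    (\<integral>\<^sup>+ x. ennreal (real (deg_in E A x)) * indicator B x \<partial>M)"
  using graphing sets_M unfolding graphing_def by blast

lemma borel_edgesD: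
  assumes "borel_edges M E F"
  shows "F \<subseteq> E" "sym F" "F \<in> sets borel" "bounded_sections F" "(x, x) \<notin> F" "finite (F `` {y})"
proof -
  show F: "F \<subseteq> E" "sym F" "F \<in> sets borel"
    using assms unfolding borel_edges_def sets_pair_M sym_edges_iff_sym by simp_all
  show b: "bounded_sections F" by (rule bounded_sections_subset[OF bounded_E F(1)])
  show "(x, x) \<notin> F" using F(1) irrefl_E by blast
  show "finite (F `` {y})" by (rule bounded_sections_finite[OF b])
qed

lemma borel_edgesI: "F \<subseteq> E \<Longrightarrow> sym F \<Longrightarrow> F \<in> sets borel \<Longrightarrow> borel_edges M E F"
  unfolding borel_edges_def sets_pair_M sym_edges_iff_sym by simp

lemma borel_edges_E: "borel_edges M E E"
  by (rule borel_edgesI[OF order_refl sym_E E_borel])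

lemma borel_edges_Diff: "borel_edges M E F \<Longrightarrow> borel_edges M E G \<Longrightarrow> borel_edges M E (F - G)"
  and borel_edges_Int: "borel_edges M E F \<Longrightarrow> borel_edges M E G \<Longrightarrow> borel_edges M E (F \<inter> G)"
  and borel_edges_Un: "borel_edges M E F \<Longrightarrow> borel_edges M E G \<Longrightarrow> borel_edges M E (F \<union> G)"
  using borel_edgesD(1-3)[of F] borel_edgesD(1-3)[of G]
  by (intro borel_edgesI; auto simp: sym_def)+

text \<open>The balance condition on degrees is the case of the indicator of a rectangle. Dynkin's
  lemma extends it to all Borel sets of pairs, and monotone approximation to all nonnegative Borel
  functions.\<close>

lemma mass_transport_E: "mass_transport M E"
proof -
  define I where "I h = (\<integral>\<^sup>+ x. (\<Sum>y\<in>E `` {x}. h (x, y)) \<partial>M)" for h :: "'a \<times> 'a \<Rightarrow> ennreal"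
  define sw where "sw h z = h (snd z, fst z)" for h :: "'a \<times> 'a \<Rightarrow> ennreal" and z
  have fin: "finite (E `` {x})" for x by (rule bounded_sections_finite[OF bounded_E])
  have meas: "(\<lambda>x. \<Sum>y\<in>E `` {x}. h (x, y)) \<in> borel_measurable M" if "h \<in> borel_measurable borel" for h :: "'a \<times> 'a \<Rightarrow> ennreal"
    unfolding measurable_M_iff by (rule section_sum_borel[OF E_borel bounded_E that])
  have sw_meas: "sw h \<in> borel_measurable borel" if "h \<in> borel_measurable borel" for h
    unfolding sw_def using that by measurable
  have I_add: "I (\<lambda>z. u z + v z) = I u + I v"
    if "u \<in> borel_measurable borel" "v \<in> borel_measurable borel" for u v
    unfolding I_def sum.distrib using meas that by (intro nn_integral_add) auto
  have I_mult: "I (\<lambda>z. c * u z) = c * I u" if "u \<in> borel_measurable borel" for c u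
    unfolding I_def sum_distrib_left[symmetric] using meas that by (intro nn_integral_cmult) auto
  have I_suminf: "I (\<lambda>z. \<Sum>n. u n z) = (\<Sum>n. I (u n))"
    if "\<And>n::nat. u n \<in> borel_measurable borel" for u
  proof -
    have "I (\<lambda>z. \<Sum>n. u n z) = (\<integral>\<^sup>+ x. (\<Sum>n. \<Sum>y\<in>E `` {x}. u n (x, y)) \<partial>M)"
      unfolding I_def by (intro nn_integral_cong suminf_sum[symmetric]) simp
    also have "\<dots> = (\<Sum>n. I (u n))" unfolding I_def using meas that by (intro nn_integral_suminf) auto
    finally show ?thesis .
  qed
  have I_SUP: "I (SUP i. U i) = (SUP i. I (U i))"
    if "\<And>i::nat. U i \<in> borel_measurable borel" "incseq U" for U
  proof -
    have inc: "incseq (\<lambda>i. U i z)" for z using that(2) unfolding incseq_def le_fun_def by blast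
    have "I (SUP i. U i) = (\<integral>\<^sup>+ x. (SUP i. \<Sum>y\<in>E `` {x}. U i (x, y)) \<partial>M)"
      unfolding I_def SUP_apply using inc by (intro nn_integral_cong ennreal_SUP_sum[symmetric])
    also have "\<dots> = (SUP i. I (U i))"
      unfolding I_def using meas that inc
      by (intro nn_integral_monotone_convergence_SUP)
        (auto simp: incseq_def le_fun_def intro!: sum_mono)
    finally show ?thesis .
  qed
  have ind: "I (indicator W) = I (sw (indicator W))" if W: "W \<in> sets borel" for W
  proof -
    have "W \<in> sigma_sets (space borel \<times> space borel) {a \<times> b |a b. a \<in> sets (borel :: 'a measure) \<and> b \<in> sets (borel :: 'a measure)}"
      using W unfolding borel_prod[symmetric] sets_pair_measure .
    with Int_stable_pair_measure_generator pair_measure_closed show ?thesis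
    proof (induction rule: sigma_sets_induct_disjoint)
      case (basic W)
      then obtain A B where AB: "W = A \<times> B" "A \<in> sets borel" "B \<in> sets borel" by blast
      have c: "(\<Sum>y\<in>E `` {x}. indicator C y) = ennreal (real (deg_in E C x))" for x C
      proof -
        have "(\<Sum>y\<in>E `` {x}. indicator C y :: ennreal) = of_nat (card (E `` {x} \<inter> C))"
          using fin by (simp add: indicator_def sum.If_cases of_bool_def)
        moreover have "E `` {x} \<inter> C = {y \<in> C. (x, y) \<in> E}" by auto
        ultimately show ?thesis unfolding deg_in_def by (simp add: ennreal_of_nat_eq_real_of_nat)
      qed
      have "I (indicator W) = (\<integral>\<^sup>+ x. ennreal (real (deg_in E B x)) * indicator A x \<partial>M)"
        unfolding I_def AB indicator_times fst_conv snd_conv c[symmetric] sum_distrib_right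
        by (simp add: mult.commute)
      moreover have "I (sw (indicator W)) = (\<integral>\<^sup>+ x. ennreal (real (deg_in E A x)) * indicator B x \<partial>M)"
        unfolding I_def sw_def AB indicator_times fst_conv snd_conv c[symmetric] sum_distrib_right ..
      ultimately show ?case using deg_balance[OF AB(2,3)] by simp
    next
      case empty
      then show ?case unfolding I_def sw_def by simp
    next
      case (compl W)
      have W: "W \<in> sets borel" using compl(1) unfolding borel_prod[symmetric] sets_pair_measure .
      obtain d where d: "\<And>x. card (E `` {x}) \<le> d" using bounded_E unfolding bounded_sections_def by blast
      \<comment> \<open>Passing to the complement cancels this term, which is legitimate only
        because bounded degrees and finite measure make it finite.\<close>
      have fin_I: "I (indicator W) \<noteq> \<infinity>"
      proof -
        have "I (indicator W) \<le> (\<integral>\<^sup>+ x. of_nat d \<partial>M)"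
          unfolding I_def
        proof (intro nn_integral_mono)
          fix x
          have "(\<Sum>y\<in>E `` {x}. indicator W (x, y)) \<le> (\<Sum>y\<in>E `` {x}. 1 :: ennreal)"
            by (intro sum_mono) (auto simp: indicator_def)
          also have "\<dots> \<le> of_nat d" using d by (simp add: of_nat_mono)
          finally show "(\<Sum>y\<in>E `` {x}. indicator W (x, y)) \<le> (of_nat d :: ennreal)" .
        qed
        also have "\<dots> = of_nat d * emeasure M (space M)" by simp
        also have "\<dots> < \<infinity>"
          using emeasure_finite[of "space M"] unfolding less_top
          by (auto simp: ennreal_mult_less_top of_nat_less_top)
        finally show ?thesis by simp
      qed
      let ?C = "space borel \<times> space borel - W"
      have "I (indicator W) + I (indicator ?C) = I (\<lambda>_. 1)"
        using W by (subst I_add[symmetric]) (auto intro!: arg_cong[where f = I] simp: indicator_def fun_eq_iff)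
      moreover have "I (sw (indicator W)) + I (sw (indicator ?C)) = I (\<lambda>_. 1)"
        using W sw_meas
        by (subst I_add[symmetric]) (auto intro!: arg_cong[where f = I] sw_meas simp: sw_def indicator_def fun_eq_iff)
      ultimately have "I (indicator W) + I (indicator ?C) = I (indicator W) + I (sw (indicator ?C))"
        using compl(2) by simp
      then show ?case using fin_I unfolding ennreal_add_left_cancel by blast
    next
      case (union A)
      have A: "A n \<in> sets borel" for n
        using union(2) unfolding borel_prod[symmetric] sets_pair_measure by blast
      have eq: "indicator (\<Union>n. A n) = (\<lambda>z. \<Sum>n. indicator (A n) z :: ennreal)"
        using suminf_indicator[OF union(1)] by (auto simp: fun_eq_iff)
      have "I (indicator (\<Union>n. A n)) = (\<Sum>n. I (indicator (A n)))"
        unfolding eq using A by (intro I_suminf) auto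
      also have "\<dots> = (\<Sum>n. I (sw (indicator (A n))))" using union(3) by simp
      also have "\<dots> = I (sw (indicator (\<Union>n. A n)))"
        unfolding eq sw_def using A sw_meas by (intro I_suminf[symmetric]) (auto simp: sw_def[abs_def])
      finally show ?case .
    qed
  qed
  have "I h = I (sw h)" if "h \<in> borel_measurable borel" for h
    using that
  proof (induction rule: borel_measurable_induct)
    case (cong f g)
    then have "f = g" by auto
    then show ?case using cong by simp
  next
    case (set A)
    then show ?case using ind by simp
  next
    case (mult u c)
    then show ?case using I_mult[of u c] I_mult[OF sw_meas[of u], of c] by (simp add: sw_def[abs_def])
  next
    case (add u v)
    then show ?case
      using I_add[of v u] I_add[OF sw_meas[of v] sw_meas[of u]] by (simp add: sw_def[abs_def])
  next
    case (seq U)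
    have "sw (SUP i. U i) = (SUP i. sw (U i))" unfolding sw_def by (auto simp: fun_eq_iff SUP_apply image_image)
    moreover have "incseq (\<lambda>i. sw (U i))" using \<open>incseq U\<close> unfolding sw_def incseq_def le_fun_def by blast
    then have "I (SUP i. sw (U i)) = (SUP i. I (sw (U i)))" using seq sw_meas by (intro I_SUP) auto
    moreover have "I (SUP i. U i) = (SUP i. I (U i))" using seq by (intro I_SUP) auto
    moreover have "I (U i) = I (sw (U i))" for i by (rule seq)
    ultimately show ?case by (simp only:)
  qed
  then show ?thesis unfolding mass_transport_def I_def sw_def by simp
qed

text \<open>Powers of one relation commute with it, so transport along a single step composes to
  transport along balls.\<close>

lemma nball_relation:
  assumes F: "borel_edges M E F"
  shows "(F \<union> Id) ^^ n \<in> sets borel" "bounded_sections ((F \<union> Id) ^^ n)" "sym ((F \<union> Id) ^^ n)"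
    "mass_transport M ((F \<union> Id) ^^ n)"
proof -
  note FD = borel_edgesD[OF F]
  have P: "F \<union> Id \<in> sets borel" "bounded_sections (F \<union> Id)" "sym (F \<union> Id)"
    using FD Id_borel bounded_sections_Un[OF FD(4) bounded_sections_Id]
    by (auto simp: sym_Un sym_Id)
  have t: "mass_transport M (F \<union> Id)"
    by (rule mass_transport_Un_Id[OF sets_M mass_transport_subset[OF mass_transport_E bounded_E FD(1,3,2)] FD(3,4,5)])
  show b: "(F \<union> Id) ^^ n \<in> sets borel" "bounded_sections ((F \<union> Id) ^^ n)" for n
    using relpow_borel[OF P(1,2)] by blast+
  show s: "sym ((F \<union> Id) ^^ n)" for n by (rule sym_relpow[OF P(3)])
  show "mass_transport M ((F \<union> Id) ^^ n)"
  proof (induction n)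
    case 0
    show ?case by (simp add: mass_transport_def)
  next
    case (Suc n)
    show ?case
      using mass_transport_relcomp[OF sets_M b s P Suc t] relpow_commute[of "F \<union> Id" n] by simp
  qed
qed

lemma finite_nball: "borel_edges M E F \<Longrightarrow> finite (nball F n x)"
  unfolding nball_def by (rule bounded_sections_finite[OF nball_relation(2)])

lemma inverse_card_comp_borel:
  "borel_edges M E F \<Longrightarrow> (\<lambda>x. 1 / real (card (comp F x))) \<in> borel_measurable M"
  unfolding measurable_M_iff by (rule inverse_card_comp_measurable[OF borel_edgesD(3,4)])

text \<open>Each vertex spreads its weight evenly over its component. Transport is available along
  balls; a finite component is eventually a ball, and monotone convergence passes to the
  limit.\<close>

lemma nn_integral_comp_average:
  assumes F: "borel_edges M E F" and fc: "\<And>x. finite (comp F x)" and w: "w \<in> borel_measurable M"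
  shows "(\<integral>\<^sup>+ x. w x \<partial>M) = (\<integral>\<^sup>+ x. (\<Sum>y\<in>comp F x. w y) * ennreal (1 / real (card (comp F x))) \<partial>M)"
proof -
  note FD = borel_edgesD[OF F]
  define c where "c x = ennreal (1 / real (card (comp F x)))" for x
  have c[measurable]: "c \<in> borel_measurable borel"
    unfolding c_def using inverse_card_comp_measurable[OF FD(3,4)] by measurable
  have w'[measurable]: "w \<in> borel_measurable borel" using w measurable_M_iff by blast
  note [measurable] = fst_snd_borel_measurable
  have m1: "(\<lambda>z. w (snd z) * c (fst z)) \<in> borel_measurable borel" by measurable
  have m2: "(\<lambda>z. w (fst z) * c (snd z)) \<in> borel_measurable borel" by measurable
  have ms1: "(\<lambda>x. \<Sum>y\<in>nball F n x. w y * c x) \<in> borel_measurable M" for n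
    unfolding measurable_M_iff nball_def
    using section_sum_borel[OF nball_relation(1,2)[OF F] m1] by simp
  have ms2: "(\<lambda>x. \<Sum>y\<in>nball F n x. w x * c y) \<in> borel_measurable M" for n
    unfolding measurable_M_iff nball_def
    using section_sum_borel[OF nball_relation(1,2)[OF F] m2] by simp
  have eq: "(\<integral>\<^sup>+ x. (\<Sum>y\<in>nball F n x. w y * c x) \<partial>M) = (\<integral>\<^sup>+ x. (\<Sum>y\<in>nball F n x. w x * c y) \<partial>M)" for n
    using mass_transportD[OF nball_relation(4)[OF F] m1] unfolding nball_def by simp
  have lim: "(SUP n. \<Sum>y\<in>nball F n x. k y) = (\<Sum>y\<in>comp F x. k y)" for k :: "'a \<Rightarrow> ennreal" and x
  proof (rule SUP_eqI)
    show "(\<Sum>y\<in>nball F n x. k y) \<le> (\<Sum>y\<in>comp F x. k y)" for n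
      by (intro sum_mono2[OF fc]) (auto simp: comp_eq_UN_nball)
    fix u assume u: "\<And>n. n \<in> UNIV \<Longrightarrow> (\<Sum>y\<in>nball F n x. k y) \<le> u"
    have "incseq (\<lambda>n. nball F n x)" unfolding incseq_def by (intro allI impI nball_mono)
    then obtain N where "comp F x \<subseteq> nball F N x"
      using incseq_finite_subset_UN[of "\<lambda>n. nball F n x" "comp F x"] fc comp_eq_UN_nball[of F x]
      by (metis order_refl)
    then have "comp F x = nball F N x" unfolding comp_eq_UN_nball by blast
    then show "(\<Sum>y\<in>comp F x. k y) \<le> u" using u by simp
  qed
  have inc: "incseq (\<lambda>n x. \<Sum>y\<in>nball F n x. k x y)" for k :: "'a \<Rightarrow> 'a \<Rightarrow> ennreal"
    unfolding incseq_def le_fun_def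
    by (intro allI impI sum_mono2 nball_mono finite_nball[OF F]) auto
  have "(\<integral>\<^sup>+ x. (\<Sum>y\<in>comp F x. w y * c x) \<partial>M) = (SUP n. \<integral>\<^sup>+ x. (\<Sum>y\<in>nball F n x. w y * c x) \<partial>M)"
    unfolding lim[symmetric] by (rule nn_integral_monotone_convergence_SUP[OF inc ms1])
  also have "\<dots> = (\<integral>\<^sup>+ x. (\<Sum>y\<in>comp F x. w x * c y) \<partial>M)"
    unfolding eq lim[symmetric] by (rule nn_integral_monotone_convergence_SUP[OF inc ms2, symmetric])
  also have "\<dots> = (\<integral>\<^sup>+ x. w x \<partial>M)"
  proof (intro nn_integral_cong)
    fix x
    have "(\<Sum>y\<in>comp F x. w x * c y) = (\<Sum>y\<in>comp F x. w x * c x)"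
      unfolding c_def by (intro sum.cong refl) (simp add: comp_eq[OF FD(2)])
    also have "\<dots> = w x * (of_nat (card (comp F x)) * c x)" by (simp add: mult_ac)
    also have "of_nat (card (comp F x)) * c x = 1"
    proof -
      have "card (comp F x) \<noteq> 0" using fc comp_self by (metis card_0_eq equals0D)
      then show ?thesis unfolding c_def
        by (simp add: ennreal_of_nat_eq_real_of_nat ennreal_mult[symmetric])
    qed
    finally show "(\<Sum>y\<in>comp F x. w x * c y) = w x" by simp
  qed
  finally show ?thesis unfolding sum_distrib_right c_def by simp
qed

text \<open>The passage from local to global: an inequality counted on each finite component yields
  the inequality of integrals.\<close>

lemma nn_integral_mono_comp_sum:
  assumes F: "borel_edges M E F" and fc: "\<And>x. finite (comp F x)"
    and "w \<in> borel_measurable M" "v \<in> borel_measurable M"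
    and le: "\<And>x. (\<Sum>y\<in>comp F x. w y) \<le> (\<Sum>y\<in>comp F x. v y)"
  shows "(\<integral>\<^sup>+ x. w x \<partial>M) \<le> (\<integral>\<^sup>+ x. v x \<partial>M)"
  unfolding nn_integral_comp_average[OF F fc assms(3)] nn_integral_comp_average[OF F fc assms(4)]
  by (intro nn_integral_mono mult_right_mono le) simp

text \<open>Mass transport on each ball carries the indicator of \<open>N\<close> to an integral
  concentrated on \<open>N\<close>, which vanishes. So the union of all components meeting a null
  set is negligible, and almost sure properties of vertices hold along whole components.\<close>

lemma AE_comp_avoids_null:
  assumes N: "N \<in> null_sets M"
  shows "AE x in M. comp E x \<inter> N = {}"
proof -
  have Nb[measurable]: "N \<in> sets borel" using N sets_M by auto
  have m: "(\<lambda>z :: 'a \<times> 'a. indicator N (snd z) :: ennreal) \<in> borel_measurable borel"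
    by (rule measurable_compose[OF fst_snd_borel_measurable(2)]) measurable
  have "AE x in M. nball E n x \<inter> N = {}" for n
  proof -
    have ms: "(\<lambda>x. \<Sum>y\<in>nball E n x. indicator N y :: ennreal) \<in> borel_measurable M"
      unfolding measurable_M_iff nball_def
      using section_sum_borel[OF nball_relation(1,2)[OF borel_edges_E] m] by simp
    have "(\<integral>\<^sup>+ x. (\<Sum>y\<in>nball E n x. indicator N y) \<partial>M) = (\<integral>\<^sup>+ x. (\<Sum>y\<in>nball E n x. indicator N x) \<partial>M)"
      using mass_transportD[OF nball_relation(4)[OF borel_edges_E] m] unfolding nball_def by simp
    also have "\<dots> = (\<integral>\<^sup>+ x. 0 \<partial>M)"
      by (intro nn_integral_cong_AE eventually_mono[OF AE_not_in[OF N]]) simp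
    finally have "AE x in M. (\<Sum>y\<in>nball E n x. indicator N y :: ennreal) = 0"
      using nn_integral_0_iff_AE[OF ms] by simp
    then show ?thesis
      by (rule eventually_mono) (auto simp: finite_nball[OF borel_edges_E] indicator_eq_0_iff)
  qed
  then have "AE x in M. \<forall>n. nball E n x \<inter> N = {}" by (simp add: AE_all_countable)
  then show ?thesis by (rule eventually_mono) (auto simp: comp_eq_UN_nball)
qed

section \<open>Integrability of degrees and inverse component sizes\<close>

lemma degree_measurable:
  assumes F: "borel_edges M E F"
  shows "(\<lambda>x. real (card (nbrs F x))) \<in> borel_measurable M"
proof -
  have "(\<lambda>x. card (F `` {x})) \<in> measurable borel (count_space UNIV)"
    by (rule section_card_borel[OF borel_edgesD(3,4)[OF F]])
  then have "(\<lambda>x. real (card (F `` {x}))) \<in> borel_measurable borel"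
    by (rule measurable_compose) simp
  then show ?thesis unfolding nbrs_eq_Image measurable_M_iff .
qed

lemma degree_bounded:
  obtains d where "\<And>F x. F \<subseteq> E \<Longrightarrow> real (card (nbrs F x)) \<le> d"
proof -
  obtain d where d: "\<And>x. finite (E `` {x}) \<and> card (E `` {x}) \<le> d"
    using bounded_E unfolding bounded_sections_def by blast
  have "real (card (nbrs F x)) \<le> real d" if "F \<subseteq> E" for F x
  proof -
    have "card (F `` {x}) \<le> card (E `` {x})" using d that by (intro card_mono) auto
    then show ?thesis using d[of x] unfolding nbrs_eq_Image by linarith
  qed
  then show ?thesis by (rule that)
qed

lemma degree_integrable:
  assumes F: "borel_edges M E F"
  shows "integrable M (\<lambda>x. real (card (nbrs F x)))"
proof -
  obtain d where "\<And>F x. F \<subseteq> E \<Longrightarrow> real (card (nbrs F x)) \<le> d" using degree_bounded by blast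
  then show ?thesis
    using borel_edgesD(1)[OF F] degree_measurable[OF F]
    by (intro integrable_const_bound[where B = d]) auto
qed

lemma inverse_card_comp_integrable:
  assumes F: "borel_edges M E F"
  shows "integrable M (\<lambda>x. 1 / real (card (comp F x)))"
proof -
  have "norm (1 / real (card (comp F x))) \<le> 1" for x
    by (cases "card (comp F x) = 0") auto
  then show ?thesis
    using inverse_card_comp_borel[OF F] by (intro integrable_const_bound[where B = 1]) auto
qed

lemma rank_empty: "rank M {} = 0"
proof -
  have "comp {} x = {x}" for x :: 'a unfolding comp_def by auto
  then show ?thesis unfolding rank_def by simp
qed

lemma rank_eq:
  assumes F: "borel_edges M E F"
  shows "rank M F = measure M UNIV - (\<integral>x. 1 / real (card (comp F x)) \<partial>M)"
proof -
  show ?thesis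
    unfolding rank_def using inverse_card_comp_integrable[OF F]
    by (subst Bochner_Integration.integral_diff) (auto simp: space_M)
qed

end

section \<open>Counting components\<close>

lemma comp_subset_closed:
  assumes "x \<in> S" "\<And>a b. (a, b) \<in> R \<Longrightarrow> a \<in> S \<Longrightarrow> b \<in> S"
  shows "comp R x \<subseteq> S"
proof
  fix y assume "y \<in> comp R x"
  then have "(x, y) \<in> R\<^sup>*" unfolding comp_def by simp
  then show "y \<in> S" by induction (use assms in auto)
qed

lemma comp_step: "y \<in> comp R x \<Longrightarrow> (y, z) \<in> R \<Longrightarrow> z \<in> comp R x"
  unfolding comp_def by (auto intro: rtrancl_into_rtrancl)

lemma comp_commute: "sym R \<Longrightarrow> y \<in> comp R x \<longleftrightarrow> x \<in> comp R y"
  unfolding comp_def using sym_rtrancl[of R] by (auto dest: symD)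

text \<open>A component of size \<open>c\<close> contributes \<open>c\<close> summands equal to
  \<open>1 / c\<close>.\<close>

lemma sum_inverse_card_comp:
  assumes "sym F" "finite K" "\<And>y. y \<in> K \<Longrightarrow> comp F y \<subseteq> K"
  shows "(\<Sum>y\<in>K. 1 / real (card (comp F y))) = real (card (comp F ` K))"
proof -
  have "(\<Sum>y\<in>K. 1 / real (card (comp F y))) =
      (\<Sum>C\<in>comp F ` K. \<Sum>y\<in>{y \<in> K. comp F y = C}. 1 / real (card (comp F y)))"
    by (rule sum.image_gen[OF assms(2)])
  also have "\<dots> = (\<Sum>C\<in>comp F ` K. 1)"
  proof (intro sum.cong refl)
    fix C assume "C \<in> comp F ` K"
    then obtain x where x: "x \<in> K" "C = comp F x" by blast
    have CK: "C \<subseteq> K" using assms(3)[OF x(1)] x(2) by simp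
    have "y \<in> C" if "comp F y = C" for y using that comp_self[of y F] by simp
    moreover have "comp F y = C" if "y \<in> C" for y using that comp_eq[OF assms(1)] x(2) by simp
    ultimately have "{y \<in> K. comp F y = C} = C" using CK by blast
    moreover have "card C \<noteq> 0"
      using finite_subset[OF CK assms(2)] comp_self[of x F] x(2) by auto
    moreover have "(\<Sum>y\<in>{y \<in> K. comp F y = C}. 1 / real (card (comp F y))) =
        (\<Sum>y\<in>{y \<in> K. comp F y = C}. 1 / real (card C))"
      by (intro sum.cong) auto
    ultimately show "(\<Sum>y\<in>{y \<in> K. comp F y = C}. 1 / real (card (comp F y))) = 1" by simp
  qed
  finally show ?thesis by simp
qed

lemma comp_insert_edge:
  assumes "sym F"
  shows "comp (F \<union> {(u, v), (v, u)}) x =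
    (if x \<in> comp F u \<union> comp F v then comp F u \<union> comp F v else comp F x)"
proof -
  let ?F = "F \<union> {(u, v), (v, u)}" and ?D = "comp F u \<union> comp F v"
  have symF': "sym ?F" using assms unfolding sym_def by blast
  show ?thesis
  proof (cases "x \<in> ?D")
    case True
    have "comp ?F x \<subseteq> ?D"
      using True comp_self[of u F] comp_self[of v F] comp_step[of _ F u] comp_step[of _ F v]
      by (intro comp_subset_closed) auto
    moreover have "?D \<subseteq> comp ?F x"
    proof -
      have uv: "v \<in> comp ?F u" unfolding comp_def by auto
      have sub: "comp F u \<subseteq> comp ?F u" "comp F v \<subseteq> comp ?F v" by (intro comp_mono; blast)+
      have eq: "comp ?F v = comp ?F u" by (rule comp_eq[OF symF' uv])
      have "x \<in> comp ?F u" using True sub eq by blast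
      then have "comp ?F x = comp ?F u" by (rule comp_eq[OF symF'])
      then show ?thesis using sub eq by blast
    qed
    ultimately show ?thesis using True by auto
  next
    case False
    have "u \<notin> comp F x" "v \<notin> comp F x"
      using False comp_commute[OF assms, of _ x] by simp_all
    then have "comp ?F x \<subseteq> comp F x"
      using comp_self[of x F] comp_step[of _ F x] by (intro comp_subset_closed) auto
    then show ?thesis using False comp_mono[of F ?F x] by auto
  qed
qed

lemma card_comps_insert_edge:
  assumes F: "sym F" and K: "finite K" "u \<in> K" "v \<in> K"
  shows "card (comp F ` K) \<le> card (comp (F \<union> {(u, v), (v, u)}) ` K) + 1"
    and "(u, v) \<notin> F\<^sup>* \<Longrightarrow> card (comp F ` K) = card (comp (F \<union> {(u, v), (v, u)}) ` K) + 1"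
proof -
  let ?F = "F \<union> {(u, v), (v, u)}" and ?D = "comp F u \<union> comp F v"
  have img: "comp ?F ` K = insert ?D (comp F ` K - {comp F u, comp F v})"
  proof
    show "comp ?F ` K \<subseteq> insert ?D (comp F ` K - {comp F u, comp F v})"
    proof
      fix C assume "C \<in> comp ?F ` K"
      then obtain x where x: "x \<in> K" "C = comp ?F x" by blast
      show "C \<in> insert ?D (comp F ` K - {comp F u, comp F v})"
      proof (cases "x \<in> ?D")
        case True
        then show ?thesis using x(2) unfolding comp_insert_edge[OF F] by simp
      next
        case False
        then have "C = comp F x" using x(2) unfolding comp_insert_edge[OF F] by simp
        moreover have "comp F x \<noteq> comp F u" "comp F x \<noteq> comp F v"
          using False comp_self[of x F] by auto
        ultimately show ?thesis using x(1) by simp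
      qed
    qed
    show "insert ?D (comp F ` K - {comp F u, comp F v}) \<subseteq> comp ?F ` K"
    proof
      fix C assume C: "C \<in> insert ?D (comp F ` K - {comp F u, comp F v})"
      show "C \<in> comp ?F ` K"
      proof (cases "C = ?D")
        case True
        then have "C = comp ?F u" unfolding comp_insert_edge[OF F] using comp_self[of u F] by simp
        then show ?thesis using K by blast
      next
        case False
        then obtain x where x: "x \<in> K" "C = comp F x" "C \<noteq> comp F u" "C \<noteq> comp F v" using C by blast
        then have "x \<notin> ?D" using comp_eq[OF F, of x u] comp_eq[OF F, of x v] by auto
        then have "C = comp ?F x" unfolding comp_insert_edge[OF F] using x by simp
        then show ?thesis using x by blast
      qed
    qed
  qed
  have fin: "finite (comp F ` K)" using K by simp
  \<comment> \<open>If \<open>u\<close> and \<open>v\<close> already share a component,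
    \<open>?D\<close> is that component and has just been removed; otherwise \<open>?D\<close> is
    not a component of \<open>F\<close>.\<close>
  have new: "?D \<notin> comp F ` K - {comp F u, comp F v}"
  proof
    assume D: "?D \<in> comp F ` K - {comp F u, comp F v}"
    then obtain x where x: "?D = comp F x" by blast
    then have "u \<in> comp F x" using comp_self[of u F] by blast
    then have "comp F u = ?D" using comp_eq[OF F] x by simp
    then show False using D by blast
  qed
  have "card (comp ?F ` K) = Suc (card (comp F ` K - {comp F u, comp F v}))"
    unfolding img using fin new by simp
  moreover have "card (comp F ` K - {comp F u, comp F v}) = card (comp F ` K) - card {comp F u, comp F v}"
    using K by (intro card_Diff_subset) auto
  moreover have "card {comp F u, comp F v} \<le> card (comp F ` K)"
    using K fin by (intro card_mono) auto
  moreover have "card {comp F u, comp F v} \<le> 2" by (simp add: card_insert_if)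
  ultimately show "card (comp F ` K) \<le> card (comp ?F ` K) + 1" by linarith
  assume "(u, v) \<notin> F\<^sup>*"
  then have "comp F u \<noteq> comp F v" using comp_self[of v F] unfolding comp_def by blast
  then have "card {comp F u, comp F v} = 2" by simp
  with \<open>card (comp ?F ` K) = _\<close> \<open>card (comp F ` K - _) = _\<close> \<open>card {comp F u, comp F v} \<le> card (comp F ` K)\<close>
  show "card (comp F ` K) = card (comp ?F ` K) + 1" by linarith
qed

text \<open>In matroid terms: \<open>R\<close> is independent after contracting \<open>A\<close>.
  Both orientations are deleted because an edge is a pair of ordered pairs.\<close>

definition independent_over :: "('a \<times> 'a) set \<Rightarrow> ('a \<times> 'a) set \<Rightarrow> bool" where
  "independent_over A R \<longleftrightarrow>
     A \<inter> R = {} \<and> (\<forall>(u, v)\<in>R. (u, v) \<notin> (A \<union> R - {(u, v), (v, u)})\<^sup>*)"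

lemma independent_over_mono:
  assumes "independent_over A R" "A' \<subseteq> A" "R' \<subseteq> R"
  shows "independent_over A' R'"
proof -
  have "(A' \<union> R' - {(u, v), (v, u)})\<^sup>* \<subseteq> (A \<union> R - {(u, v), (v, u)})\<^sup>*" for u v
    using assms(2,3) by (intro rtrancl_mono) blast
  then show ?thesis using assms unfolding independent_over_def by blast
qed

text \<open>Adding the edges of \<open>R\<close> one by one, each lowers the number of components by
  at most one, and by exactly one if its ends were not yet joined. Each edge is two elements of
  \<open>R\<close>, hence the factor one half.\<close>

lemma card_comps_Un:
  assumes "sym A" "finite K" "finite R" "sym R" "\<And>x. (x, x) \<notin> R" "R \<subseteq> K \<times> K"
  shows "real (card (comp A ` K)) \<le> real (card (comp (A \<union> R) ` K)) + real (card R) / 2 \<and>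
    (independent_over A R \<longrightarrow> real (card (comp A ` K)) = real (card (comp (A \<union> R) ` K)) + real (card R) / 2)"
  using assms(3-6)
proof (induction "card R" arbitrary: R rule: less_induct)
  case less
  show ?case
  proof (cases "R = {}")
    case False
    then obtain u v where uv: "(u, v) \<in> R" by auto
    define R' where "R' = R - {(u, v), (v, u)}"
    have vu: "(v, u) \<in> R" "u \<noteq> v" using uv less.prems unfolding sym_def by auto
    have cR: "card R = card R' + 2"
    proof -
      have "card R' = card R - card {(u, v), (v, u)}"
        unfolding R'_def using uv vu by (intro card_Diff_subset) auto
      moreover have "card {(u, v), (v, u)} \<le> card R" using uv vu less.prems(1) by (intro card_mono) auto
      moreover have "card {(u, v), (v, u)} = 2" using vu by simp
      ultimately show ?thesis by linarith
    qed
    have symR': "sym R'" using less.prems(2) unfolding R'_def sym_def by blast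
    have IH: "real (card (comp A ` K)) \<le> real (card (comp (A \<union> R') ` K)) + real (card R') / 2"
      "independent_over A R' \<Longrightarrow> real (card (comp A ` K)) = real (card (comp (A \<union> R') ` K)) + real (card R') / 2"
      using less.hyps[of R'] cR less.prems symR' unfolding R'_def by auto
    have AR: "A \<union> R = (A \<union> R') \<union> {(u, v), (v, u)}" unfolding R'_def using uv vu by blast
    have sym': "sym (A \<union> R')" using assms(1) symR' by (rule sym_Un)
    have K: "u \<in> K" "v \<in> K" using uv less.prems(4) by auto
    note step = card_comps_insert_edge[OF sym' assms(2) K, folded AR]
    have "(u, v) \<notin> (A \<union> R')\<^sup>*" if ind: "independent_over A R"
    proof -
      have "A \<union> R - {(u, v), (v, u)} = A \<union> R'"
        using ind uv vu unfolding independent_over_def R'_def by blast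
      then show ?thesis using ind uv unfolding independent_over_def by auto
    qed
    moreover have "independent_over A R'" if "independent_over A R"
      using that by (rule independent_over_mono) (auto simp: R'_def)
    ultimately show ?thesis using step IH cR by (auto simp: field_simps)
  qed simp
qed

text \<open>On a single component \<open>K\<close> of \<open>A \<union> R\<close>, the sum
  \<open>l\<close> is the number of components of \<open>A\<close> inside \<open>K\<close>, and
  \<open>r\<close> is 1 plus the number of edges of \<open>R\<close> in \<open>K\<close>.\<close>

lemma comp_counting:
  assumes A: "sym A" and R: "sym R" "\<And>x. (x, x) \<notin> R" and fin: "finite (comp (A \<union> R) x)"
  defines "l \<equiv> \<Sum>y\<in>comp (A \<union> R) x. 1 / real (card (comp A y))"
    and "r \<equiv> \<Sum>y\<in>comp (A \<union> R) x. 1 / real (card (comp (A \<union> R) y)) + real (card (nbrs R y)) / 2"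
  shows "l \<le> r" and "independent_over A R \<Longrightarrow> l = r"
proof -
  define K where "K = comp (A \<union> R) x"
  define R' where "R' = R \<inter> K \<times> K"
  have finK: "finite K" using fin unfolding K_def .
  have symAR: "sym (A \<union> R)" using A R(1) by (rule sym_Un)
  have compK: "comp (A \<union> R) y = K" if "y \<in> K" for y
    using that unfolding K_def by (rule comp_eq[OF symAR])
  have compK': "comp (A \<union> R') y = K" if y: "y \<in> K" for y
  proof
    show "comp (A \<union> R') y \<subseteq> K"
      using comp_mono[of "A \<union> R'" "A \<union> R" y] compK[OF y] unfolding R'_def by blast
    have "comp (A \<union> R) y \<subseteq> comp (A \<union> R') y \<inter> K"
      using y comp_self[of y "A \<union> R'"] comp_step[of _ "A \<union> R'" y] comp_step[of _ "A \<union> R" x]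
      unfolding R'_def K_def by (intro comp_subset_closed) auto
    then show "K \<subseteq> comp (A \<union> R') y" using compK[OF y] by blast
  qed
  have K_ne: "K \<noteq> {}" unfolding K_def using comp_self by fast
  have "(\<lambda>y. comp (A \<union> R') y) ` K = {K}" using compK' K_ne by auto
  then have one: "card (comp (A \<union> R') ` K) = 1" by simp
  have sumA: "(\<Sum>y\<in>K. 1 / real (card (comp A y))) = real (card (comp A ` K))"
    using comp_mono[of A "A \<union> R"] compK by (intro sum_inverse_card_comp[OF A finK]) auto
  have sum1: "(\<Sum>y\<in>K. 1 / real (card (comp (A \<union> R) y))) = 1"
    using compK finK K_ne by simp
  have cR': "(\<Sum>y\<in>K. card (nbrs R y)) = card R'"
  proof -
    have "nbrs R y \<subseteq> K" if "y \<in> K" for y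
      using that comp_step[of y "A \<union> R" x] unfolding nbrs_def K_def by auto
    then have "R' = Sigma K (nbrs R)" unfolding R'_def nbrs_def by auto
    moreover have "finite (nbrs R y)" if "y \<in> K" for y
      using finK \<open>\<And>y. y \<in> K \<Longrightarrow> nbrs R y \<subseteq> K\<close>[OF that] finite_subset by blast
    ultimately show ?thesis using finK by simp
  qed
  have sumR: "(\<Sum>y\<in>K. 1 / real (card (comp (A \<union> R) y)) + real (card (nbrs R y)) / 2) = 1 + real (card R') / 2"
    unfolding sum.distrib sum1 sum_divide_distrib[symmetric] of_nat_sum[symmetric] cR' ..
  have "finite R'" "sym R'" "\<And>x. (x, x) \<notin> R'" "R' \<subseteq> K \<times> K"
    using finK R unfolding R'_def sym_def by auto
  note cnt = card_comps_Un[OF A finK this, unfolded one]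
  show "l \<le> r"
    unfolding l_def r_def K_def[symmetric] sumA sumR using cnt by simp
  assume "independent_over A R"
  then have "independent_over A R'" by (rule independent_over_mono) (auto simp: R'_def)
  then show "l = r"
    unfolding l_def r_def K_def[symmetric] sumA sumR using cnt by simp
qed

section \<open>Rank in hyperfinite graphings\<close>

context graphing_on
begin

text \<open>The count on each component is integrated by mass transport. Equality comes from
  comparing in both directions, as the transport lemma yields inequalities.\<close>

lemma rank_Un_finite_comps:
  assumes A: "borel_edges M E A" and R: "borel_edges M E R" and fc: "\<And>x. finite (comp (A \<union> R) x)"
  shows "rank M (A \<union> R) \<le> rank M A + edge_measure M R"
    and "independent_over A R \<Longrightarrow> rank M (A \<union> R) = rank M A + edge_measure M R"
proof -
  define w where "w x = 1 / real (card (comp A x))" for x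
  define v where "v x = 1 / real (card (comp (A \<union> R) x)) + real (card (nbrs R x)) / 2" for x
  have AR: "borel_edges M E (A \<union> R)" by (rule borel_edges_Un[OF A R])
  have iw: "integrable M w" unfolding w_def by (rule inverse_card_comp_integrable[OF A])
  have iv: "integrable M v"
    unfolding v_def using inverse_card_comp_integrable[OF AR] degree_integrable[OF R] by simp
  have mw: "(\<lambda>x. ennreal (w x)) \<in> borel_measurable M" "(\<lambda>x. ennreal (v x)) \<in> borel_measurable M"
    using iw iv by auto
  have nn: "0 \<le> w x" "0 \<le> v x" for x unfolding w_def v_def by auto
  have Iw: "(\<integral>\<^sup>+ x. ennreal (w x) \<partial>M) = ennreal (\<integral>x. w x \<partial>M)"
    "(\<integral>\<^sup>+ x. ennreal (v x) \<partial>M) = ennreal (\<integral>x. v x \<partial>M)"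
    using nn_integral_eq_integral[OF iw] nn_integral_eq_integral[OF iv] nn by auto
  have In: "0 \<le> (\<integral>x. w x \<partial>M)" "0 \<le> (\<integral>x. v x \<partial>M)" using nn by (auto intro: Bochner_Integration.integral_nonneg)
  have Iv: "(\<integral>x. v x \<partial>M) = (\<integral>x. 1 / real (card (comp (A \<union> R) x)) \<partial>M) + edge_measure M R"
    unfolding v_def edge_measure_def using inverse_card_comp_integrable[OF AR] degree_integrable[OF R] by simp
  note cnt = comp_counting[OF borel_edgesD(2)[OF A] borel_edgesD(2,5)[OF R] fc, folded w_def v_def]
  have le: "(\<integral>x. w x \<partial>M) \<le> (\<integral>x. v x \<partial>M)"
  proof -
    have "(\<integral>\<^sup>+ x. ennreal (w x) \<partial>M) \<le> (\<integral>\<^sup>+ x. ennreal (v x) \<partial>M)"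
    proof (rule nn_integral_mono_comp_sum[OF AR fc mw])
      fix x show "(\<Sum>y\<in>comp (A \<union> R) x. ennreal (w y)) \<le> (\<Sum>y\<in>comp (A \<union> R) x. ennreal (v y))"
        using cnt(1)[of x] nn by (simp add: sum_ennreal ennreal_leI)
    qed
    then show ?thesis unfolding Iw using In by (simp add: ennreal_le_iff)
  qed
  then show "rank M (A \<union> R) \<le> rank M A + edge_measure M R"
    unfolding rank_eq[OF A] rank_eq[OF AR] Iv unfolding w_def by linarith
  assume ind: "independent_over A R"
  have "(\<integral>x. v x \<partial>M) \<le> (\<integral>x. w x \<partial>M)"
  proof -
    have "(\<integral>\<^sup>+ x. ennreal (v x) \<partial>M) \<le> (\<integral>\<^sup>+ x. ennreal (w x) \<partial>M)"
    proof (rule nn_integral_mono_comp_sum[OF AR fc mw(2,1)])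
      fix x show "(\<Sum>y\<in>comp (A \<union> R) x. ennreal (v y)) \<le> (\<Sum>y\<in>comp (A \<union> R) x. ennreal (w y))"
        using cnt(2)[OF ind, of x] nn by (simp add: sum_ennreal)
    qed
    then show ?thesis unfolding Iw using In by (simp add: ennreal_le_iff)
  qed
  with le show "rank M (A \<union> R) = rank M A + edge_measure M R"
    unfolding rank_eq[OF A] rank_eq[OF AR] Iv unfolding w_def by linarith
qed

lemma edge_measure_Un:
  assumes A: "borel_edges M E A" and B: "borel_edges M E B" and "A \<inter> B = {}"
  shows "edge_measure M (A \<union> B) = edge_measure M A + edge_measure M B"
proof -
  have "card (nbrs (A \<union> B) x) = card (nbrs A x) + card (nbrs B x)" for x
  proof -
    have "nbrs (A \<union> B) x = nbrs A x \<union> nbrs B x" unfolding nbrs_def by auto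
    moreover have "nbrs A x \<inter> nbrs B x = {}" using assms(3) unfolding nbrs_def by auto
    moreover have "finite (nbrs A x)" "finite (nbrs B x)"
      unfolding nbrs_eq_Image by (rule borel_edgesD(6)[OF A], rule borel_edgesD(6)[OF B])
    ultimately show ?thesis by (simp add: card_Un_disjoint)
  qed
  then show ?thesis
    unfolding edge_measure_def using degree_integrable[OF A] degree_integrable[OF B]
    by (simp add: distrib_left)
qed

lemma rank_mono:
  assumes A: "borel_edges M E A" and B: "borel_edges M E B" and "A \<subseteq> B"
  shows "rank M A \<le> rank M B"
proof -
  have "1 / real (card (comp B x)) \<le> 1 / real (card (comp A x))" for x
  proof (cases "finite (comp B x)")
    case True
    have "finite (comp A x)" "card (comp A x) \<le> card (comp B x)"
      by (rule finite_subset[OF comp_mono[OF assms(3)] True], rule card_mono[OF True comp_mono[OF assms(3)]])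
    moreover have "card (comp A x) > 0" using calculation(1) comp_self[of x A] by (auto simp: card_gt_0_iff)
    ultimately show ?thesis by (intro divide_left_mono) auto
  qed simp
  then show ?thesis
    unfolding rank_eq[OF A] rank_eq[OF B]
    using inverse_card_comp_integrable[OF A] inverse_card_comp_integrable[OF B]
    by (simp add: integral_mono)
qed

text \<open>Hyperfiniteness as one sequence suited to limits. The last clause speaks of every vertex
  of the component, since a walk survives only if the edges at all its vertices are eventually
  released.\<close>

definition exhausts :: "(nat \<Rightarrow> ('a \<times> 'a) set) \<Rightarrow> bool" where
  "exhausts S \<longleftrightarrow> (\<forall>n. borel_edges M E (S n)) \<and> decseq S \<and> (\<forall>n x. finite (comp (E - S n) x)) \<and>
     (AE x in M. \<forall>y\<in>comp E x. \<exists>n. nbrs (S n) y = {})"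

text \<open>A Borel-Cantelli argument: with measures at most \<open>(1/2)^n\<close> the total degree
  over all \<open>T k\<close> has finite integral, so almost every vertex meets only finitely many
  \<open>T k\<close>. The tail unions \<open>S n\<close> decrease, and they keep components finite
  because \<open>S n\<close> contains \<open>T n\<close>.\<close>

lemma hyperfinite_exhausts:
  assumes "hyperfinite M E"
  obtains S where "exhausts S"
proof -
  have "\<forall>n. \<exists>S. borel_edges M E S \<and> edge_measure M S \<le> (1/2)^n \<and> (\<forall>x. finite (comp (E - S) x))"
    using assms unfolding hyperfinite_def by simp
  then obtain T where T: "\<And>n. borel_edges M E (T n)" "\<And>n. edge_measure M (T n) \<le> (1/2)^n"
    "\<And>n x. finite (comp (E - T n) x)"
    by metis
  define S where "S n = (\<Union>k\<in>{n..}. T k)" for n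
  have bS: "borel_edges M E (S n)" for n
    using borel_edgesD(1-3)[OF T(1)] unfolding S_def
    by (intro borel_edgesI sets.countable_UN'' sym_UNION) auto
  have "AE x in M. (\<Sum>k. ennreal (real (card (nbrs (T k) x)))) \<noteq> \<infinity>"
  proof (rule nn_integral_PInf_AE)
    have [measurable]: "(\<lambda>x. real (card (nbrs (T k) x))) \<in> borel_measurable M" for k
      by (rule degree_measurable[OF T(1)])
    show "(\<lambda>x. \<Sum>k. ennreal (real (card (nbrs (T k) x)))) \<in> borel_measurable M" by measurable
    have "(\<integral>\<^sup>+ x. (\<Sum>k. ennreal (real (card (nbrs (T k) x)))) \<partial>M) =
        (\<Sum>k. \<integral>\<^sup>+ x. ennreal (real (card (nbrs (T k) x))) \<partial>M)"
      by (rule nn_integral_suminf) measurable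
    also have "\<dots> \<le> (\<Sum>k. ennreal (2 * (1/2)^k))"
    proof (rule suminf_le)
      fix k
      have "(\<integral>\<^sup>+ x. ennreal (real (card (nbrs (T k) x))) \<partial>M) = ennreal (2 * edge_measure M (T k))"
        unfolding edge_measure_def using nn_integral_eq_integral[OF degree_integrable[OF T(1)[of k]]] by simp
      also have "\<dots> \<le> ennreal (2 * (1/2)^k)" using T(2)[of k] by (intro ennreal_leI) simp
      finally show "(\<integral>\<^sup>+ x. ennreal (real (card (nbrs (T k) x))) \<partial>M) \<le> ennreal (2 * (1/2)^k)" .
    qed auto
    also have "\<dots> = ennreal (\<Sum>k. 2 * (1/2)^k)"
      by (intro suminf_ennreal2 summable_mult summable_geometric) auto
    also have "\<dots> < \<infinity>" by simp
    finally show "(\<integral>\<^sup>+ x. (\<Sum>k. ennreal (real (card (nbrs (T k) x)))) \<partial>M) \<noteq> \<infinity>" by simp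
  qed
  then obtain N where N: "{x \<in> space M. \<not> (\<Sum>k. ennreal (real (card (nbrs (T k) x)))) \<noteq> \<infinity>} \<subseteq> N" "emeasure M N = 0" "N \<in> sets M"
    by (rule AE_E)
  then have "N \<in> null_sets M" by auto
  have good: "\<exists>n. nbrs (S n) y = {}" if "y \<notin> N" for y
  proof -
    have "(\<Sum>k. ennreal (real (card (nbrs (T k) y)))) \<noteq> \<infinity>" using N(1) that space_M by blast
    \<comment> \<open>The terms are natural numbers, so converging to 0 means being eventually
      0.\<close>
    then have "summable (\<lambda>k. real (card (nbrs (T k) y)))" by (intro summable_suminf_not_top) auto
    then have "(\<lambda>k. real (card (nbrs (T k) y))) \<longlonglongrightarrow> 0" by (rule summable_LIMSEQ_zero)
    then have "eventually (\<lambda>k. real (card (nbrs (T k) y)) < 1) sequentially"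
      by (rule order_tendstoD) simp
    then obtain n where n: "\<And>k. k \<ge> n \<Longrightarrow> card (nbrs (T k) y) = 0"
      unfolding eventually_sequentially by auto
    have "nbrs (T k) y = {}" if "k \<ge> n" for k
      using n[OF that] borel_edgesD(6)[OF T(1)[of k], of y] unfolding nbrs_eq_Image by simp
    then have "nbrs (S n) y = {}" unfolding S_def nbrs_def by auto
    then show ?thesis by blast
  qed
  have "AE x in M. \<forall>y\<in>comp E x. \<exists>n. nbrs (S n) y = {}"
    using AE_comp_avoids_null[OF \<open>N \<in> null_sets M\<close>] by (rule eventually_mono) (use good in blast)
  moreover have "decseq S" unfolding S_def decseq_def by (auto intro: order_trans)
  moreover have "finite (comp (E - S n) x)" for n x
  proof (rule finite_subset[OF comp_mono T(3)[of n x]])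
    show "E - S n \<subseteq> E - T n" unfolding S_def by auto
  qed
  ultimately show ?thesis using that[of S] bS unfolding exhausts_def by blast
qed

lemma exhaustsD:
  assumes "exhausts S"
  shows "borel_edges M E (S n)" "decseq S" "F \<subseteq> E \<Longrightarrow> finite (comp (F - S n) x)"
    "AE x in M. \<forall>y\<in>comp E x. \<exists>n. nbrs (S n) y = {}"
proof -
  show "finite (comp (F - S n) x)" if "F \<subseteq> E"
    using assms finite_subset[OF comp_mono[of "F - S n" "E - S n" x]] that unfolding exhausts_def by blast
qed (use assms in \<open>auto simp: exhausts_def\<close>)

lemma rank_exhaustion:
  assumes S: "exhausts S" and F: "borel_edges M E F"
  shows "(\<lambda>n. rank M (F - S n)) \<longlonglongrightarrow> rank M F"
proof -
  note FE = borel_edgesD(1)[OF F]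
  have b: "borel_edges M E (F - S n)" for n by (rule borel_edges_Diff[OF F exhaustsD(1)[OF S]])
  have le1: "norm (1 / real k) \<le> 1" for k :: nat by (cases "k = 0") auto
  have "(\<lambda>n. \<integral>x. 1 / real (card (comp (F - S n) x)) \<partial>M) \<longlonglongrightarrow> (\<integral>x. 1 / real (card (comp F x)) \<partial>M)"
  proof (rule integral_dominated_convergence[where w = "\<lambda>_. 1"])
    show "AE x in M. (\<lambda>n. 1 / real (card (comp (F - S n) x))) \<longlonglongrightarrow> 1 / real (card (comp F x))"
      using exhaustsD(4)[OF S]
    proof (rule eventually_mono)
      fix x assume x: "\<forall>y\<in>comp E x. \<exists>n. nbrs (S n) y = {}"
      have inc: "incseq (\<lambda>n. comp (F - S n) x)"
        using exhaustsD(2)[OF S] unfolding incseq_def decseq_def by (intro allI impI comp_mono) blast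
      have "comp F x \<subseteq> (\<Union>n. comp (F - S n) x)"
      proof (rule comp_subset_closed)
        show "x \<in> (\<Union>n. comp (F - S n) x)" using comp_self by fast
        fix a b assume ab: "(a, b) \<in> F" "a \<in> (\<Union>n. comp (F - S n) x)"
        then obtain n where n: "a \<in> comp (F - S n) x" by blast
        then have "a \<in> comp E x" using comp_mono[of "F - S n" E x] FE by blast
        then obtain m where "nbrs (S m) a = {}" using x by blast
        then have "(a, b) \<notin> S m" unfolding nbrs_def by blast
        \<comment> \<open>At stage \<open>n\<close> the vertex \<open>a\<close> is reached, at stage
          \<open>m\<close> its edges are released; as \<open>S\<close> decreases, both hold at the
          later stage.\<close>
        moreover have "S (max n m) \<subseteq> S m" using exhaustsD(2)[OF S] unfolding decseq_def by auto
        ultimately have "(a, b) \<in> F - S (max n m)" using ab by blast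
        moreover have "a \<in> comp (F - S (max n m)) x" using n inc unfolding incseq_def by (meson max.cobounded1 subsetD)
        ultimately have "b \<in> comp (F - S (max n m)) x" using comp_step by metis
        then show "b \<in> (\<Union>n. comp (F - S n) x)" by blast
      qed
      moreover have "comp (F - S n) x \<subseteq> comp F x" for n by (rule comp_mono) blast
      ultimately have "comp F x = (\<Union>n. comp (F - S n) x)" by blast
      moreover have "comp (F - S n) x \<noteq> {}" for n using comp_self by fast
      ultimately show "(\<lambda>n. 1 / real (card (comp (F - S n) x))) \<longlonglongrightarrow> 1 / real (card (comp F x))"
        using LIMSEQ_inverse_card[OF inc exhaustsD(3)[OF S FE]] by simp
    qed
  qed (use inverse_card_comp_borel[OF F] inverse_card_comp_borel[OF b] le1 in auto)
  then show ?thesis unfolding rank_eq[OF F] rank_eq[OF b] by (intro tendsto_intros)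
qed

lemma edge_measure_exhaustion:
  assumes S: "exhausts S" and F: "borel_edges M E F"
  shows "(\<lambda>n. edge_measure M (F - S n)) \<longlonglongrightarrow> edge_measure M F"
proof -
  note FE = borel_edgesD(1)[OF F]
  have b: "borel_edges M E (F - S n)" for n by (rule borel_edges_Diff[OF F exhaustsD(1)[OF S]])
  obtain d where d: "\<And>F x. F \<subseteq> E \<Longrightarrow> real (card (nbrs F x)) \<le> d" using degree_bounded by blast
  have "(\<lambda>n. \<integral>x. real (card (nbrs (F - S n) x)) \<partial>M) \<longlonglongrightarrow> (\<integral>x. real (card (nbrs F x)) \<partial>M)"
  proof (rule integral_dominated_convergence[where w = "\<lambda>_. d"])
    show "AE x in M. (\<lambda>n. real (card (nbrs (F - S n) x))) \<longlonglongrightarrow> real (card (nbrs F x))"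
      using exhaustsD(4)[OF S]
    proof (rule eventually_mono)
      fix x assume "\<forall>y\<in>comp E x. \<exists>n. nbrs (S n) y = {}"
      then obtain m where m: "nbrs (S m) x = {}" using comp_self by fast
      have "nbrs (F - S n) x = nbrs F x" if "n \<ge> m" for n
      proof -
        have "S n \<subseteq> S m" using exhaustsD(2)[OF S] that unfolding decseq_def by blast
        then show ?thesis using m unfolding nbrs_def by blast
      qed
      then show "(\<lambda>n. real (card (nbrs (F - S n) x))) \<longlonglongrightarrow> real (card (nbrs F x))"
        by (intro tendsto_eventually eventually_sequentiallyI[of m]) simp
    qed
    show "AE x in M. norm (real (card (nbrs (F - S n) x))) \<le> d" for n
      using d[of "F - S n"] FE by auto
  qed (use degree_measurable[OF F] degree_measurable[OF b] in auto)
  then show ?thesis unfolding edge_measure_def by (intro tendsto_intros)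
qed

text \<open>Removing \<open>S n\<close> makes the components finite and preserves independence; rank
  and edge measure both converge as \<open>n\<close> grows.\<close>

lemma rank_Un:
  assumes hyp: "hyperfinite M E" and A: "borel_edges M E A" and R: "borel_edges M E R"
  shows "rank M (A \<union> R) \<le> rank M A + edge_measure M R"
    and "independent_over A R \<Longrightarrow> rank M (A \<union> R) = rank M A + edge_measure M R"
proof -
  obtain S where S: "exhausts S" using hyperfinite_exhausts[OF hyp] .
  note AR = borel_edges_Un[OF A R]
  note b = borel_edges_Diff[OF A exhaustsD(1)[OF S]] borel_edges_Diff[OF R exhaustsD(1)[OF S]]
  have fc: "finite (comp ((A - S n) \<union> (R - S n)) x)" for n x
    using exhaustsD(3)[OF S borel_edgesD(1)[OF AR]] unfolding Un_Diff .
  have lhs: "(\<lambda>n. rank M ((A - S n) \<union> (R - S n))) \<longlonglongrightarrow> rank M (A \<union> R)"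
    using rank_exhaustion[OF S AR] unfolding Un_Diff .
  have rhs: "(\<lambda>n. rank M (A - S n) + edge_measure M (R - S n)) \<longlonglongrightarrow> rank M A + edge_measure M R"
    by (intro tendsto_add rank_exhaustion[OF S A] edge_measure_exhaustion[OF S R])
  show "rank M (A \<union> R) \<le> rank M A + edge_measure M R"
    using rank_Un_finite_comps(1)[OF b fc] by (intro LIMSEQ_le[OF lhs rhs]) auto
  assume ind: "independent_over A R"
  have "rank M ((A - S n) \<union> (R - S n)) = rank M (A - S n) + edge_measure M (R - S n)" for n
    by (rule rank_Un_finite_comps(2)[OF b fc independent_over_mono[OF ind]]) auto
  then show "rank M (A \<union> R) = rank M A + edge_measure M R"
    using LIMSEQ_unique lhs rhs by simp
qed

end

section \<open>Even edge sets\<close>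

lemma even_card_sym:
  assumes "finite R" "sym R" "\<And>x. (x, x) \<notin> R"
  shows "even (card R)"
  using assms
proof (induction "card R" arbitrary: R rule: less_induct)
  case less
  show ?case
  proof (cases "R = {}")
    case False
    then obtain u v where uv: "(u, v) \<in> R" by auto
    then have vu: "(v, u) \<in> R" "u \<noteq> v" using less.prems by (auto dest: symD)
    let ?R = "R - {(u, v), (v, u)}"
    have "card {(u, v), (v, u)} \<le> card R" using uv vu less.prems(1) by (intro card_mono) auto
    moreover have "card ?R = card R - card {(u, v), (v, u)}"
      using uv vu by (intro card_Diff_subset) auto
    moreover have "card {(u, v), (v, u)} = 2" using vu by simp
    ultimately have c: "card R = card ?R + 2" by linarith
    have "even (card ?R)"
      using less.prems c by (intro less.hyps) (auto simp: sym_def)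
    then show ?thesis using c by simp
  qed simp
qed

text \<open>The finitely supported elements of the cycle space over the field with two
  elements.\<close>

definition even_edges :: "('a \<times> 'a) set \<Rightarrow> bool" where
  "even_edges Q \<longleftrightarrow> finite Q \<and> sym Q \<and> (\<forall>x. (x, x) \<notin> Q) \<and> (\<forall>x. even (card (Q `` {x})))"

text \<open>Handshaking: if deleting the edge separated \<open>u\<close> from \<open>v\<close>, then
  \<open>u\<close> would be the only vertex of odd degree in its component of the rest.\<close>

lemma even_edges_on_cycle:
  assumes Q: "even_edges Q" and uv: "(u, v) \<in> Q"
  shows "(u, v) \<in> (Q - {(u, v), (v, u)})\<^sup>*"
proof (rule ccontr)
  let ?Q = "Q - {(u, v), (v, u)}"
  have fin: "finite Q" and sym: "sym Q" and irr: "\<And>x. (x, x) \<notin> Q" and ev: "\<And>x. even (card (Q `` {x}))"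
    using Q unfolding even_edges_def by auto
  define K where "K = comp ?Q u"
  assume "(u, v) \<notin> ?Q\<^sup>*"
  then have vK: "v \<notin> K" unfolding K_def comp_def by simp
  have uK: "u \<in> K" unfolding K_def by (rule comp_self)
  have symQ': "sym ?Q" using sym unfolding sym_def by blast
  have "K \<subseteq> insert u (Range Q)" unfolding K_def by (rule comp_subset_closed) auto
  then have finK: "finite K" using fin by (meson finite_Range finite_insert finite_subset)
  have finQ': "finite (?Q `` {x})" for x using fin by simp
  have clos: "?Q `` {x} \<subseteq> K" if "x \<in> K" for x
    using that comp_step[of x ?Q u] unfolding K_def by blast
  have "(\<Sum>x\<in>K. card (?Q `` {x})) = card (Sigma K (\<lambda>x. ?Q `` {x}))"
    using finK finQ' by simp
  also have "Sigma K (\<lambda>x. ?Q `` {x}) = ?Q \<inter> K \<times> K" using clos by auto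
  also have "even (card (?Q \<inter> K \<times> K))"
    using fin symQ' irr by (intro even_card_sym) (auto simp: sym_def)
  finally have even: "even (\<Sum>x\<in>K. card (?Q `` {x}))" .
  have "even (card (?Q `` {x}))" if "x \<in> K - {u}" for x
  proof -
    have "x \<noteq> v" "x \<noteq> u" using that vK by auto
    then have "?Q `` {x} = Q `` {x}" by auto
    then show ?thesis using ev by simp
  qed
  then have "even (\<Sum>x\<in>K - {u}. card (?Q `` {x}))" by (rule dvd_sum)
  moreover have "(\<Sum>x\<in>K. card (?Q `` {x})) = card (?Q `` {u}) + (\<Sum>x\<in>K - {u}. card (?Q `` {x}))"
    using finK uK by (rule sum.remove)
  ultimately have "even (card (?Q `` {u}))" using even by simp
  moreover have "u \<noteq> v" using uv irr by blast
  then have "?Q `` {u} = Q `` {u} - {v}" by blast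
  moreover have "card (Q `` {u}) = Suc (card (Q `` {u} - {v}))"
    using uv fin by (intro card.remove) auto
  ultimately show False using ev[of u] by simp
qed

text \<open>The sum of the members of \<open>D\<close> over the field with two elements.\<close>

definition odd_sum :: "('a \<times> 'a) set set \<Rightarrow> ('a \<times> 'a) set" where
  "odd_sum D = {e. odd (card {Z \<in> D. e \<in> Z})}"

lemma odd_sum_subset: "odd_sum D \<subseteq> \<Union>D"
proof
  fix e assume "e \<in> odd_sum D"
  then have "{Z \<in> D. e \<in> Z} \<noteq> {}" unfolding odd_sum_def by (metis (mono_tags, lifting) card.empty even_zero mem_Collect_eq)
  then show "e \<in> \<Union>D" by blast
qed

lemma odd_sum_insert:
  assumes "finite D" "Z \<notin> D"
  shows "odd_sum (insert Z D) = (odd_sum D - Z) \<union> (Z - odd_sum D)"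
proof (rule set_eqI)
  fix e
  have "{Z' \<in> insert Z D. e \<in> Z'} = (if e \<in> Z then insert Z {Z' \<in> D. e \<in> Z'} else {Z' \<in> D. e \<in> Z'})"
    by auto
  then have "card {Z' \<in> insert Z D. e \<in> Z'} = (if e \<in> Z then 1 else 0) + card {Z' \<in> D. e \<in> Z'}"
    using assms by simp
  then show "e \<in> odd_sum (insert Z D) \<longleftrightarrow> e \<in> (odd_sum D - Z) \<union> (Z - odd_sum D)"
    unfolding odd_sum_def by simp
qed

lemma even_card_sym_diff:
  assumes "finite A" "finite B"
  shows "even (card ((A - B) \<union> (B - A))) \<longleftrightarrow> (even (card A) \<longleftrightarrow> even (card B))"
proof -
  have "card ((A - B) \<union> (B - A)) = card (A - B) + card (B - A)"
    using assms by (intro card_Un_disjoint) auto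
  moreover have "card A = card (A - B) + card (A \<inter> B)" "card B = card (B - A) + card (A \<inter> B)"
    using card_Int_Diff[OF assms(1), of B] card_Int_Diff[OF assms(2), of A] by (simp_all add: Int_commute)
  ultimately show ?thesis by presburger
qed

lemma odd_sum_even_degrees:
  assumes "finite D" "\<And>Z. Z \<in> D \<Longrightarrow> finite Z" "\<And>Z x. Z \<in> D \<Longrightarrow> even (card (Z `` {x}))"
  shows "finite (odd_sum D) \<and> (\<forall>x. even (card (odd_sum D `` {x})))"
  using assms
proof (induction D rule: finite_induct)
  case empty
  show ?case by (simp add: odd_sum_def)
next
  case (insert Z D)
  have fin: "finite (odd_sum D)" "finite Z" using insert by auto
  have "odd_sum (insert Z D) `` {x} = (odd_sum D `` {x} - Z `` {x}) \<union> (Z `` {x} - odd_sum D `` {x})" for x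
    unfolding odd_sum_insert[OF insert(1,2)] by auto
  then have "even (card (odd_sum (insert Z D) `` {x}))" for x
    using fin insert by (simp add: even_card_sym_diff)
  moreover have "finite (odd_sum (insert Z D))"
    unfolding odd_sum_insert[OF insert(1,2)] using fin by simp
  ultimately show ?case by blast
qed

lemma sym_odd_sum:
  assumes "\<And>Z. Z \<in> D \<Longrightarrow> sym Z"
  shows "sym (odd_sum D)"
proof (rule symI)
  fix x y assume "(x, y) \<in> odd_sum D"
  moreover have "{Z \<in> D. (x, y) \<in> Z} = {Z \<in> D. (y, x) \<in> Z}" using assms by (auto dest: symD)
  ultimately show "(y, x) \<in> odd_sum D" unfolding odd_sum_def by simp
qed

lemma is_cycle_edgesD:
  assumes "is_cycle_edges C"
  shows "finite C" "C \<noteq> {}" "sym C" "(x, x) \<notin> C" "even (card (C `` {y}))"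
    "u \<in> Domain C \<Longrightarrow> v \<in> Domain C \<Longrightarrow> (u, v) \<in> C\<^sup>*"
proof -
  show "even (card (C `` {y}))"
  proof (cases "y \<in> Domain C")
    case True
    then have "card (C `` {y}) = 2" using assms unfolding is_cycle_edges_def nbrs_eq_Image by blast
    then show ?thesis by simp
  next
    case False
    then have "C `` {y} = {}" by auto
    then show ?thesis by simp
  qed
qed (use assms in \<open>auto simp: is_cycle_edges_def sym_edges_iff_sym\<close>)

lemma cycle_subset_comp:
  assumes C: "is_cycle_edges C" "C \<subseteq> E" and x: "(x, y) \<in> C" "x \<in> comp E a"
  shows "C \<subseteq> E \<inter> comp E a \<times> comp E a"
proof clarify
  fix u v assume uv: "(u, v) \<in> C"
  have "(x, u) \<in> C\<^sup>*" using is_cycle_edgesD(6)[OF C(1)] x uv by blast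
  then have "(x, u) \<in> E\<^sup>*" using rtrancl_mono[OF C(2)] by blast
  then have u: "u \<in> comp E a" using x(2) unfolding comp_def by (simp add: rtrancl_trans)
  moreover have "(u, v) \<in> E" using uv C(2) by blast
  ultimately show "(u, v) \<in> E \<inter> comp E a \<times> comp E a" using comp_step by fast
qed

section \<open>Jordan curves in plane drawings\<close>

text \<open>An arc is homeomorphic to an interval. A disc stays connected when one point is deleted,
  whereas a set of reals falls apart when a point strictly between two others is deleted.\<close>

lemma interior_arc_empty:
  fixes g :: "real \<Rightarrow> complex"
  assumes "arc g"
  shows "interior (path_image g) = {}"
proof (rule ccontr)
  assume "interior (path_image g) \<noteq> {}"
  then obtain z e where e: "e > 0" and sub: "ball z e \<subseteq> path_image g"
    by (metis all_not_in_conv mem_interior)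
  obtain h where h: "homeomorphism {0..1} (path_image g) g h" using homeomorphism_arc[OF assms] .
  have conth: "continuous_on (path_image g) h" and inj: "inj_on h (path_image g)"
    using h unfolding homeomorphism_def by (auto intro: inj_on_inverseI)
  have "infinite (ball z e)" using uncountable_ball[OF e, of z] countable_finite by blast
  \<comment> \<open>Three points suffice: the images of two of them enclose that of the third on the
    line.\<close>
  then obtain C where C: "C \<subseteq> ball z e" "card C = 3" "finite C"
    using infinite_arbitrarily_large by metis
  then have "card (h ` C) = 3" using inj_on_subset[OF inj] sub by (metis card_image order_trans)
  then obtain r s t where rst: "h ` C = {r, s, t}" "r \<noteq> s" "s \<noteq> t" "r \<noteq> t" by (auto simp: card_3_iff)
  define H where "H = h ` ball z e"
  have H: "r \<in> H" "s \<in> H" "t \<in> H" using rst(1) C(1) unfolding H_def by blast+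
  have del: "connected (H - {m})" for m
  proof (cases "m \<in> H")
    case True
    then obtain w where w: "w \<in> ball z e" "m = h w" unfolding H_def by blast
    have "h x \<noteq> h w" if "x \<in> ball z e" "x \<noteq> w" for x
      using inj_onD[OF inj, of x w] that sub w(1) by blast
    then have "H - {m} = h ` (ball z e - {w})" unfolding H_def w(2) by (auto simp del: mem_ball)
    moreover have "connected (ball z e - {w})" by (intro connected_open_delete) auto
    moreover have "continuous_on (ball z e - {w}) h"
      using conth by (rule continuous_on_subset) (use sub in blast)
    ultimately show ?thesis by (simp add: connected_continuous_image)
  next
    case False
    then have "H - {m} = h ` ball z e" unfolding H_def by auto
    then show ?thesis using continuous_on_subset[OF conth sub] by (simp add: connected_continuous_image)
  qed
  have mid: False if "x < m" "m < y" "x \<in> H" "y \<in> H" for x m y :: real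
  proof -
    have "x \<in> H - {m}" "y \<in> H - {m}" using that by auto
    then have "{x..y} \<subseteq> H - {m}" using connected_contains_Icc[OF del] by blast
    moreover have "m \<in> {x..y}" using that by simp
    ultimately have "m \<in> H - {m}" by blast
    then show False by blast
  qed
  have "r < s \<and> s < t \<or> r < t \<and> t < s \<or> s < r \<and> r < t \<or> s < t \<and> t < r \<or> t < r \<and> r < s \<or> t < s \<and> s < r"
    using rst(2-4) by linarith
  then show False using mid H by (elim disjE conjE) metis+
qed

lemma plane_drawingD:
  assumes "plane_drawing V Ed p c" "(x, y) \<in> Ed"
  shows "arc (c x y)" "pathstart (c x y) = p x" "pathfinish (c x y) = p y"
    "(u, v) \<in> Ed \<Longrightarrow> {x, y} \<noteq> {u, v} \<Longrightarrow>
      path_image (c x y) \<inter> path_image (c u v) \<subseteq> p ` ({x, y} \<inter> {u, v})"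
    "compact K \<Longrightarrow> finite {v \<in> V. p v \<in> K}" "inj_on p V"
proof -
  note * = assms(1)[unfolded plane_drawing_def]
  have "\<forall>(x, y)\<in>Ed. arc (c x y) \<and> pathstart (c x y) = p x \<and> pathfinish (c x y) = p y \<and>
      c y x = reversepath (c x y)"
    using * by (elim conjE)
  from bspec[OF this assms(2)] show "arc (c x y)" "pathstart (c x y) = p x" "pathfinish (c x y) = p y"
    by simp_all
  have "\<forall>(x, y)\<in>Ed. \<forall>(u, v)\<in>Ed. {x, y} \<noteq> {u, v} \<longrightarrow>
      path_image (c x y) \<inter> path_image (c u v) \<subseteq> p ` ({x, y} \<inter> {u, v})"
    using * by (elim conjE)
  from bspec[OF this assms(2)]
  have *: "\<forall>(u, v)\<in>Ed. {x, y} \<noteq> {u, v} \<longrightarrow>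
      path_image (c x y) \<inter> path_image (c u v) \<subseteq> p ` ({x, y} \<inter> {u, v})"
    by simp
  show "path_image (c x y) \<inter> path_image (c u v) \<subseteq> p ` ({x, y} \<inter> {u, v})"
    if "(u, v) \<in> Ed" "{x, y} \<noteq> {u, v}"
    by (rule mp[OF bspec[OF * that(1), unfolded prod.case] that(2)])
  show "compact K \<Longrightarrow> finite {v \<in> V. p v \<in> K}" "inj_on p V" using assms(1) unfolding plane_drawing_def by simp_all
qed

text \<open>A drawing is a countable union of closed sets without interior, so Baire's theorem
  applies. It is what provides a face on each side of a Jordan curve.\<close>

lemma open_not_subset_drawing:
  assumes dr: "plane_drawing V Ed p c" and V: "countable V" "Ed \<subseteq> V \<times> V" and W: "open W" "W \<noteq> {}"
  shows "\<not> W \<subseteq> drawing_image V Ed p c"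
proof
  assume sub: "W \<subseteq> drawing_image V Ed p c"
  define \<A> where "\<A> = (\<lambda>v. {p v}) ` V \<union> (\<lambda>(x, y). path_image (c x y)) ` Ed"
  have "countable Ed" by (rule countable_subset[OF V(2)]) (simp add: V(1))
  then have cnt: "countable (uminus ` \<A>)" unfolding \<A>_def using V by simp
  have nd: "closed A \<and> interior A = {}" if "A \<in> \<A>" for A
  proof -
    have "arc (c x y)" if "(x, y) \<in> Ed" for x y by (rule plane_drawingD(1)[OF dr that])
    then show ?thesis using that unfolding \<A>_def by (auto simp: interior_arc_empty closed_arc_image)
  qed
  have "UNIV \<subseteq> closure (\<Inter>(uminus ` \<A>))"
    using nd by (intro Baire[OF closed_UNIV cnt]) (auto simp: closure_complement open_Compl)
  then have "W \<inter> \<Inter>(uminus ` \<A>) \<noteq> {}"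
    using W open_Int_closure_eq_empty[OF W(1), of "\<Inter>(uminus ` \<A>)"] by auto
  then obtain z where z: "z \<in> W" "\<And>A. A \<in> \<A> \<Longrightarrow> z \<notin> A" by blast
  have "drawing_image V Ed p c = \<Union>\<A>" unfolding drawing_image_def \<A>_def by auto
  then show False using z sub by blast
qed

text \<open>A walk in \<open>F\<close> closed up by the edge from \<open>b\<close> to
  \<open>a\<close> yields a Jordan curve with inside \<open>I\<close> and outside \<open>J\<close>.
  Any other edge meets the curve at most at its ends, so its open arc, and with it every face it
  bounds, lies on one side. Only the inside is bounded, hence finiteness is stated for
  \<open>I\<close> alone.\<close>

lemma plane_drawing_separation:
  fixes p :: "'a \<Rightarrow> complex"
  assumes dr: "plane_drawing V Ed p c" and V: "countable V" "Ed \<subseteq> V \<times> V"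
    and Ed: "sym Ed" "\<And>x. (x, x) \<notin> Ed"
    and ab: "(a, b) \<in> Ed" and F: "F \<subseteq> Ed" "(a, b) \<notin> F" "(b, a) \<notin> F" "(a, b) \<in> F\<^sup>*"
  obtains I J :: "complex set" and V0 where "I \<inter> J = {}"
    "\<And>f. f \<in> faces V Ed p c \<Longrightarrow> f \<subseteq> I \<or> f \<subseteq> J"
    "\<exists>f\<in>faces V Ed p c. f \<subseteq> I" "\<exists>f\<in>faces V Ed p c. f \<subseteq> J"
    "\<And>e. e \<in> Ed - F - {(a, b), (b, a)} \<Longrightarrow> prod.swap e \<notin> F \<Longrightarrow>
       (\<forall>f\<in>faces V Ed p c. e \<in> face_boundary Ed c f \<longrightarrow> f \<subseteq> I) \<or>
       (\<forall>f\<in>faces V Ed p c. e \<in> face_boundary Ed c f \<longrightarrow> f \<subseteq> J)"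
    "finite V0" "\<And>f. f \<subseteq> I \<Longrightarrow> face_boundary Ed c f \<subseteq> V0 \<times> V0"
proof -
  let ?FS = "faces V Ed p c" and ?DI = "drawing_image V Ed p c"
  define U where "U = (\<Union>(x, y)\<in>F. path_image (c x y))"
  have ba: "(b, a) \<in> Ed" using ab Ed(1) by (auto dest: symD)
  have abne: "a \<noteq> b" using ab Ed(2) by blast
  then have pne: "p a \<noteq> p b"
    using plane_drawingD(6)[OF dr ab] ab V(2) by (auto dest: inj_onD)
  have "a = y \<or> path_component U (p a) (p y)" if "(a, y) \<in> F\<^sup>*" for y
    using that
  proof induction
    case (step y z)
    have yz: "(y, z) \<in> Ed" using step F by blast
    have "path_component U (p y) (p z)"
      unfolding path_component_def
      using plane_drawingD(1-3)[OF dr yz] step(2) arc_imp_path unfolding U_def by (intro exI[of _ "c y z"]) auto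
    then show ?case using step.IH path_component_trans by metis
  qed simp
  then have "path_component U (p a) (p b)" using F(4) abne by blast
  then obtain g where g: "path g" "path_image g \<subseteq> U" "pathstart g = p a" "pathfinish g = p b"
    unfolding path_component_def by blast
  \<comment> \<open>The drawn walk may cross its own track; an arc is extracted from its
    image.\<close>
  obtain q where q: "arc q" "path_image q \<subseteq> path_image g" "pathstart q = p a" "pathfinish q = p b"
    using path_contains_arc[OF g(1,3,4) pne] .
  define \<gamma> where "\<gamma> = q +++ c b a"
  note cba = plane_drawingD[OF dr ba]
  have meet: "path_image (c u v) \<inter> path_image (c x y) \<subseteq> {p u, p v}"
    if "(u, v) \<in> Ed" "(x, y) \<in> Ed" "{u, v} \<noteq> {x, y}" for u v x y
    using plane_drawingD(4)[OF dr that(1,2,3)] by blast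
  have Umeet: "path_image (c u v) \<inter> U \<subseteq> {p u, p v}" if uv: "(u, v) \<in> Ed" "(u, v) \<notin> F" "(v, u) \<notin> F" for u v
  proof
    fix z assume z: "z \<in> path_image (c u v) \<inter> U"
    then obtain x y where xy: "(x, y) \<in> F" "z \<in> path_image (c x y)" unfolding U_def by blast
    then have "{u, v} \<noteq> {x, y}" using uv by (auto simp: doubleton_eq_iff)
    then show "z \<in> {p u, p v}" using meet[OF uv(1), of x y] xy z F(1) by blast
  qed
  have simple: "simple_path \<gamma>" "pathfinish \<gamma> = pathstart \<gamma>"
  proof -
    have "path_image q \<inter> path_image (c b a) \<subseteq> {p a, p b}"
      using Umeet[OF ba F(3,2)] q(2) g(2) by blast
    then show "simple_path \<gamma>" unfolding \<gamma>_def
      using q cba(1-3) by (intro simple_path_join_loop) auto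
    show "pathfinish \<gamma> = pathstart \<gamma>" unfolding \<gamma>_def using q cba(1-3) by simp
  qed
  define I where "I = inside (path_image \<gamma>)"
  define J where "J = outside (path_image \<gamma>)"
  have IJ: "I \<noteq> {}" "open I" "J \<noteq> {}" "open J" "bounded I" "I \<inter> J = {}" "I \<union> J = - path_image \<gamma>"
    using Jordan_inside_outside[OF simple] unfolding I_def J_def by auto
  have img: "path_image \<gamma> = path_image q \<union> path_image (c b a)"
    unfolding \<gamma>_def using q cba by (intro path_image_join) simp
  have "U \<subseteq> ?DI" unfolding U_def drawing_image_def using F(1) by blast
  moreover have "path_image (c b a) \<subseteq> ?DI" unfolding drawing_image_def using ba by blast
  ultimately have img_sub: "path_image \<gamma> \<subseteq> ?DI" unfolding img using q(2) g(2) by blast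
  have split: "S \<subseteq> I \<or> S \<subseteq> J" if "connected S" "S \<inter> path_image \<gamma> = {}" for S
  proof -
    have "S \<subseteq> I \<union> J" using that(2) IJ(7) by blast
    then show ?thesis using connectedD[OF that(1) IJ(2,4)] IJ(6) by blast
  qed
  have face: "connected f" "f \<noteq> {}" "f \<inter> path_image \<gamma> = {}" if "f \<in> ?FS" for f
  proof -
    have f: "f \<in> components (- ?DI)" using that unfolding faces_def .
    show "connected f" "f \<noteq> {}" by (rule in_components_connected[OF f], rule in_components_nonempty[OF f])
    show "f \<inter> path_image \<gamma> = {}" using in_components_subset[OF f] img_sub by blast
  qed
  have ex: "\<exists>f\<in>?FS. f \<subseteq> W" if W: "W = I \<or> W = J" for W
  proof -
    have "open W" "W \<noteq> {}" using W IJ by auto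
    then obtain z where z: "z \<in> W" "z \<notin> ?DI"
      using open_not_subset_drawing[OF dr V] by blast
    define f where "f = connected_component_set (- ?DI) z"
    have f: "f \<in> ?FS" unfolding f_def faces_def using z(2) by (intro componentsI) simp
    have "z \<in> f" unfolding f_def using z(2) by simp
    then have "f \<subseteq> W" using split[OF face(1,3)[OF f]] z(1) W IJ(6) by blast
    then show ?thesis using f by blast
  qed
  have side: "(\<forall>f\<in>?FS. e \<in> face_boundary Ed c f \<longrightarrow> f \<subseteq> I) \<or>
       (\<forall>f\<in>?FS. e \<in> face_boundary Ed c f \<longrightarrow> f \<subseteq> J)"
    if e: "e \<in> Ed - F - {(a, b), (b, a)}" "prod.swap e \<notin> F" for e
  proof -
    obtain u v where uv: "e = (u, v)" by (cases e)
    have E: "(u, v) \<in> Ed" "(u, v) \<notin> F" "(v, u) \<notin> F" "(u, v) \<noteq> (a, b)" "(u, v) \<noteq> (b, a)" using e uv by auto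
    note cuv = plane_drawingD[OF dr E(1)]
    \<comment> \<open>The ends are left out, since they may lie on the curve.\<close>
    define S where "S = c u v ` {0<..<1}"
    have "path_image (c u v) \<inter> path_image (c b a) \<subseteq> {p u, p v}"
      using E(4,5) by (intro meet[OF E(1) ba]) (auto simp: doubleton_eq_iff)
    then have cut: "path_image (c u v) \<inter> path_image \<gamma> \<subseteq> {p u, p v}"
      unfolding img using Umeet[OF E(1-3)] q(2) g(2) by blast
    have inj: "inj_on (c u v) {0..1}" using cuv(1) unfolding arc_def by blast
    have ends: "c u v 0 = p u" "c u v 1 = p v" using cuv(2,3) unfolding pathstart_def pathfinish_def by auto
    have "p u \<notin> S" "p v \<notin> S"
      unfolding S_def ends[symmetric] using inj_onD[OF inj] by fastforce+
    moreover have "S \<subseteq> path_image (c u v)" unfolding S_def path_image_def by auto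
    ultimately have disj: "S \<inter> path_image \<gamma> = {}" using cut by blast
    have "continuous_on {0<..<1} (c u v)"
      using arc_imp_path[OF cuv(1)] unfolding path_def by (rule continuous_on_subset) auto
    then have "connected S" unfolding S_def by (intro connected_continuous_image) auto
    then have S: "S \<subseteq> I \<or> S \<subseteq> J" using split disj by blast
    have z: "c u v (1/2) \<in> S" unfolding S_def by simp
    \<comment> \<open>The midpoint of the edge lies in the closure of \<open>f\<close> and in the
      open side \<open>W\<close>, so \<open>f\<close>, being connected and off the curve, lies in
      \<open>W\<close>.\<close>
    have main: "f \<subseteq> W" if f: "f \<in> ?FS" "e \<in> face_boundary Ed c f"
      and W: "W = I \<or> W = J" "S \<subseteq> W" for f W
    proof -
      have "path_image (c u v) \<subseteq> closure f"
        using f(2) unfolding face_boundary_def uv frontier_def by auto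
      then have "c u v (1/2) \<in> closure f \<inter> W" using z W(2) \<open>S \<subseteq> path_image (c u v)\<close> by blast
      moreover have "open W" using W IJ by auto
      ultimately have "W \<inter> f \<noteq> {}" using open_Int_closure_eq_empty[of W f] by blast
      then show ?thesis using split[OF face(1,3)[OF f(1)]] W(1) IJ(6) by blast
    qed
    show ?thesis using S main[of _ I] main[of _ J] by blast
  qed
  define V0 where "V0 = {v \<in> V. p v \<in> closure I}"
  have "finite V0" unfolding V0_def
    using plane_drawingD(5)[OF dr ab] IJ(5) compact_closure by blast
  moreover have "face_boundary Ed c f \<subseteq> V0 \<times> V0" if "f \<subseteq> I" for f
  proof (rule subrelI)
    fix x y assume "(x, y) \<in> face_boundary Ed c f"
    then have xy: "(x, y) \<in> Ed" "path_image (c x y) \<subseteq> frontier f" unfolding face_boundary_def by auto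
    have "frontier f \<subseteq> closure I" using closure_mono[OF that] unfolding frontier_def by blast
    moreover have "p x \<in> path_image (c x y)" "p y \<in> path_image (c x y)"
      using plane_drawingD(2,3)[OF dr xy(1)] pathstart_in_path_image[of "c x y"] pathfinish_in_path_image[of "c x y"] by simp_all
    moreover have "x \<in> V" "y \<in> V" using xy(1) V(2) by auto
    ultimately show "(x, y) \<in> V0 \<times> V0" using xy(2) unfolding V0_def by blast
  qed
  moreover have "f \<subseteq> I \<or> f \<subseteq> J" if "f \<in> ?FS" for f
    by (rule split[OF face(1,3)[OF that]])
  ultimately show ?thesis
    using IJ(6) ex side by (intro that[of I J V0]) simp_all
qed

section \<open>Minimum spanning forests\<close>

text \<open>The steps of the walk are added modulo 2. Repeated edges cancel, so an arbitrary walk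
  serves as well as a simple path.\<close>

lemma rtrancl_odd_ends:
  assumes "sym F" "\<And>x. (x, x) \<notin> F" "(u, v) \<in> F\<^sup>*"
  shows "\<exists>Q\<subseteq>F. finite Q \<and> sym Q \<and> (\<forall>x. odd (card (Q `` {x})) \<longleftrightarrow> (x = u) \<noteq> (x = v))"
  using assms(3)
proof induction
  case base
  show ?case by (intro exI[of _ "{}"]) (auto simp: sym_def)
next
  case (step y z)
  then obtain Q where Q: "Q \<subseteq> F" "finite Q" "sym Q" "\<And>x. odd (card (Q `` {x})) \<longleftrightarrow> (x = u) \<noteq> (x = y)"
    by blast
  have yz: "y \<noteq> z" "(z, y) \<in> F" using step(2) assms(1,2) by (auto dest: symD)
  define P where "P = {(y, z), (z, y)}"
  define Q' where "Q' = (Q - P) \<union> (P - Q)"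
  have img: "Q' `` {x} = (Q `` {x} - P `` {x}) \<union> (P `` {x} - Q `` {x})" for x
    unfolding Q'_def by blast
  have "odd (card (P `` {x})) \<longleftrightarrow> x = y \<or> x = z" for x
  proof -
    have "P `` {x} = (if x = y then {z} else if x = z then {y} else {})"
      unfolding P_def using yz by auto
    then show ?thesis by simp
  qed
  moreover have "finite (P `` {x})" "finite (Q `` {x})" for x using Q(2) unfolding P_def by auto
  ultimately have "odd (card (Q' `` {x})) \<longleftrightarrow> (x = u) \<noteq> (x = z)" for x
    unfolding img using even_card_sym_diff[of "Q `` {x}" "P `` {x}"] Q(4)[of x] yz(1) by auto
  moreover have "Q' \<subseteq> F" unfolding Q'_def P_def using Q(1) step(2) yz(2) by blast
  moreover have "sym Q'" using Q(3) unfolding Q'_def P_def sym_def by blast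
  moreover have "finite Q'" unfolding Q'_def P_def using Q(2) by simp
  ultimately show ?case by blast
qed

text \<open>A walk between the ends of an edge that avoids the edge has odd degree exactly at these
  ends; adding the edge makes all degrees even.\<close>

lemma independent_over_emptyI:
  assumes T: "sym T" "\<And>x. (x, x) \<notin> T" and ev: "\<And>Q. even_edges Q \<Longrightarrow> Q \<subseteq> T \<Longrightarrow> Q = {}"
  shows "independent_over {} T"
  unfolding independent_over_def
proof (intro conjI ballI, simp, clarsimp)
  fix u v assume uv: "(u, v) \<in> T" and path: "(u, v) \<in> (T - {(u, v), (v, u)})\<^sup>*"
  have vu: "(v, u) \<in> T" "u \<noteq> v" using uv T by (auto dest: symD)
  let ?T = "T - {(u, v), (v, u)}"
  have "sym ?T" using T(1) unfolding sym_def by blast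
  then obtain Q where Q: "Q \<subseteq> ?T" "finite Q" "sym Q" "\<And>x. odd (card (Q `` {x})) \<longleftrightarrow> (x = u) \<noteq> (x = v)"
    using rtrancl_odd_ends[OF _ _ path] T(2) by blast
  let ?Q = "Q \<union> {(u, v), (v, u)}"
  have "even (card (?Q `` {x}))" for x
  proof -
    have "?Q `` {x} = (if x = u then insert v (Q `` {x}) else if x = v then insert u (Q `` {x}) else Q `` {x})"
      using vu by auto
    moreover have "v \<notin> Q `` {u}" "u \<notin> Q `` {v}" "finite (Q `` {x})" using Q(1,2) by auto
    ultimately show ?thesis using Q(4)[of x] vu(2) by auto
  qed
  moreover have "sym ?Q" using Q(3) unfolding sym_def by blast
  ultimately have "even_edges ?Q"
    unfolding even_edges_def using Q(1,2) T(2) vu by auto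
  then show False using ev[of ?Q] Q(1) uv vu by blast
qed

context graphing_on
begin

lemma rtrancl_borel:
  assumes "borel_edges M E F"
  shows "F\<^sup>* \<in> sets borel"
  unfolding rtrancl_eq_UN_relpow_reflcl using nball_relation(1)[OF assms] by simp

text \<open>An edge is discarded exactly when strictly cheaper edges already join its ends. This
  rule involves no choices, which is what makes the forest Borel.\<close>

lemma ex_spanning_forest:
  assumes B: "borel_edges M E B" and fc: "\<And>x. finite (comp B x)"
  obtains T where "borel_edges M E T" "T \<subseteq> B" "\<And>x. comp T x = comp B x"
    "\<And>Q. even_edges Q \<Longrightarrow> Q \<subseteq> T \<Longrightarrow> Q = {}"
proof -
  note BD = borel_edgesD[OF B]
  obtain g :: "'a \<times> 'a \<Rightarrow> real" where g: "inj g" and gm[measurable]: "g \<in> borel_measurable borel"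
    using ex_borel_inj_real by blast
  \<comment> \<open>The minimum over the two orientations makes the weight symmetric; as
    \<open>g\<close> is injective, only the orientations of one edge tie.\<close>
  define key where "key z = min (g z) (g (snd z, fst z))" for z
  have km[measurable]: "key \<in> borel_measurable borel" unfolding key_def by measurable
  have key_sym: "key (y, x) = key (x, y)" for x y unfolding key_def by (simp add: min.commute)
  have key_inj: "(x, y) = (u, v) \<or> (x, y) = (v, u)" if "key (x, y) = key (u, v)" for x y u v
    using that g unfolding key_def inj_def by (auto simp: min_def split: if_splits)
  define L where "L k = {e \<in> B. key e < k}" for k
  have L: "borel_edges M E (L k)" for k
  proof (rule borel_edgesI)
    show "L k \<subseteq> E" using BD(1) unfolding L_def by blast
    show "sym (L k)" using BD(2) key_sym unfolding L_def sym_def by auto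
    have "L k = B \<inter> {e \<in> space borel. key e < k}" unfolding L_def by auto
    also have "\<dots> \<in> sets borel" using BD(3) by measurable
    finally show "L k \<in> sets borel" .
  qed
  \<comment> \<open>A walk uses finitely many edges, so a rational threshold can be placed between
    their weights and that of the discarded edge. This keeps the union countable and hence
    Borel.\<close>
  define T where "T = B - (\<Union>q\<in>\<rat>. {e. q \<le> key e} \<inter> (L q)\<^sup>*)"
  have TB: "T \<subseteq> B" unfolding T_def by blast
  have bT: "borel_edges M E T"
  proof (rule borel_edgesI)
    show "T \<subseteq> E" using TB BD(1) by blast
    show "sym T"
    proof (rule symI)
      fix x y assume xy: "(x, y) \<in> T"
      have "(y, x) \<in> (L k)\<^sup>* \<Longrightarrow> (x, y) \<in> (L k)\<^sup>*" for k
        using sym_rtrancl[OF borel_edgesD(2)[OF L]] by (rule symD)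
      moreover have "(y, x) \<in> B" using xy BD(2) unfolding T_def by (auto dest: symD)
      ultimately show "(y, x) \<in> T" using xy key_sym[of y x] unfolding T_def by auto
    qed
    have "{e. q \<le> key e} \<inter> (L q)\<^sup>* \<in> sets borel" for q
    proof -
      have "{e \<in> space borel. q \<le> key e} \<in> sets borel" by measurable
      then show ?thesis using rtrancl_borel[OF L] by simp
    qed
    then show "T \<in> sets borel" unfolding T_def using BD(3) countable_rat
      by (intro sets.Diff sets.countable_UN'') auto
  qed
  have span: "(x, y) \<in> T\<^sup>*" if "(x, y) \<in> B" for x y
    using that
  \<comment> \<open>The number of cheaper edges in the component is finite, and it drops when a
    discarded edge is replaced by a detour through cheaper ones.\<close>
  proof (induction "card (L (key (x, y)) \<inter> comp B x \<times> comp B x)" arbitrary: x y rule: less_induct)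
    case less
    show ?case
    proof (cases "(x, y) \<in> T")
      case False
      then obtain q where "q \<le> key (x, y)" "(x, y) \<in> (L q)\<^sup>*" using less.prems unfolding T_def by auto
      moreover from this(1) have "(L q)\<^sup>* \<subseteq> (L (key (x, y)))\<^sup>*"
        unfolding L_def by (intro rtrancl_mono) auto
      ultimately have "(x, y) \<in> (L (key (x, y)))\<^sup>*" by blast
      then have "(x, y) \<in> T\<^sup>* \<and> y \<in> comp B x"
      proof (induction rule: rtrancl_induct)
        case base
        show ?case by (simp add: comp_self)
      next
        case (step u v)
        have uvB: "(u, v) \<in> B" and klt: "key (u, v) < key (x, y)" using step(2) unfolding L_def by auto
        have v: "v \<in> comp B x" using step(3) uvB comp_step by fast
        have cu: "comp B u = comp B x" using step(3) comp_eq[OF BD(2)] by blast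
        have "L (key (u, v)) \<inter> comp B u \<times> comp B u \<subset> L (key (x, y)) \<inter> comp B x \<times> comp B x"
        proof (rule psubsetI)
          show "L (key (u, v)) \<inter> comp B u \<times> comp B u \<subseteq> L (key (x, y)) \<inter> comp B x \<times> comp B x"
            using klt unfolding L_def cu by auto
          have "(u, v) \<in> L (key (x, y)) \<inter> comp B x \<times> comp B x" using step(2,3) v by blast
          moreover have "(u, v) \<notin> L (key (u, v))" unfolding L_def by simp
          ultimately show "L (key (u, v)) \<inter> comp B u \<times> comp B u \<noteq> L (key (x, y)) \<inter> comp B x \<times> comp B x"
            by blast
        qed
        then have "card (L (key (u, v)) \<inter> comp B u \<times> comp B u) < card (L (key (x, y)) \<inter> comp B x \<times> comp B x)"
          by (intro psubset_card_mono) (auto simp: fc)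
        then have "(u, v) \<in> T\<^sup>*" using less.hyps uvB by blast
        then show ?case using step(3) v by (meson rtrancl_trans)
      qed
      then show ?thesis by blast
    qed blast
  qed
  have "comp T x = comp B x" for x
  proof
    show "comp T x \<subseteq> comp B x" by (rule comp_mono[OF TB])
    have "B \<subseteq> T\<^sup>*" using span by auto
    then have "B\<^sup>* \<subseteq> T\<^sup>*" using rtrancl_subset_rtrancl by blast
    then show "comp B x \<subseteq> comp T x" unfolding comp_def by blast
  qed
  \<comment> \<open>The dearest edge of a nonempty even set lies on a cycle whose other edges are
    cheaper, so it has been discarded.\<close>
  moreover have "Q = {}" if Q: "even_edges Q" "Q \<subseteq> T" for Q
  proof (rule ccontr)
    assume "Q \<noteq> {}"
    moreover have fin: "finite Q" using Q(1) unfolding even_edges_def by blast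
    ultimately have "Max (key ` Q) \<in> key ` Q" by (intro Max_in) auto
    then obtain e where "e \<in> Q" "key e = Max (key ` Q)" by force
    then have e: "e \<in> Q" "\<And>e'. e' \<in> Q \<Longrightarrow> key e' \<le> key e" using fin by auto
    obtain u v where uv: "e = (u, v)" by (cases e)
    let ?Q = "Q - {(u, v), (v, u)}"
    have lt: "key e' < key e" if "e' \<in> ?Q" for e'
    proof -
      have "key e' \<noteq> key e" using key_inj[of "fst e'" "snd e'" u v] uv that by auto
      moreover have "key e' \<le> key e" using that e(2) by blast
      ultimately show ?thesis by linarith
    qed
    \<comment> \<open>The extra element keeps the maximum meaningful when \<open>?Q\<close> is
      empty.\<close>
    then have "Max (insert (key e - 1) (key ` ?Q)) < key e" using fin by (subst Max_less_iff) auto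
    then obtain q where q: "q \<in> \<rat>" "Max (insert (key e - 1) (key ` ?Q)) < q" "q < key e"
      using Rats_dense_in_real by blast
    have "?Q \<subseteq> L q"
    proof
      fix e' assume e': "e' \<in> ?Q"
      then have "key e' < q" using q(2) fin by (subst (asm) Max_less_iff) auto
      then show "e' \<in> L q" using e' Q(2) TB unfolding L_def by auto
    qed
    then have "e \<in> (L q)\<^sup>*"
      using even_edges_on_cycle[OF Q(1), of u v] e(1) uv rtrancl_mono by blast
    then show False using e(1) Q(2) q unfolding T_def by auto
  qed
  ultimately show ?thesis using that[OF bT TB] by blast
qed

end

section \<open>Planar duality\<close>

lemma odd_card_image:
  assumes inj: "inj_on \<phi> FC" and D: "D \<subseteq> FC" and st: "\<phi> ` {C \<in> FC. P C} = {s, t}" "s \<noteq> t"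
  shows "odd (card {Z \<in> D. P Z}) \<longleftrightarrow> (s \<in> \<phi> ` D) \<noteq> (t \<in> \<phi> ` D)"
proof -
  have "\<phi> ` {Z \<in> D. P Z} = {s, t} \<inter> \<phi> ` D"
  proof
    show "\<phi> ` {Z \<in> D. P Z} \<subseteq> {s, t} \<inter> \<phi> ` D" using st(1) D by blast
    show "{s, t} \<inter> \<phi> ` D \<subseteq> \<phi> ` {Z \<in> D. P Z}"
    proof
      fix r assume r: "r \<in> {s, t} \<inter> \<phi> ` D"
      then obtain Z where Z: "Z \<in> D" "r = \<phi> Z" by blast
      obtain C where C: "C \<in> FC" "P C" "r = \<phi> C" using r st(1) by blast
      then have "C = Z" using inj_onD[OF inj, of C Z] Z D by auto
      then show "r \<in> \<phi> ` {Z \<in> D. P Z}" using Z C by blast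
    qed
  qed
  moreover have "inj_on \<phi> {Z \<in> D. P Z}" by (rule inj_on_subset[OF inj]) (use D in blast)
  ultimately have "card {Z \<in> D. P Z} = card ({s, t} \<inter> \<phi> ` D)" using card_image by metis
  moreover have "{s, t} \<inter> \<phi> ` D =
      (if s \<in> \<phi> ` D then {s} else {}) \<union> (if t \<in> \<phi> ` D then {t} else {})" by auto
  ultimately show ?thesis using st(2) by (auto simp: card_insert_if)
qed

lemma finite_sym_connector:
  assumes "sym G" "(a, b) \<in> G\<^sup>*"
  shows "\<exists>F\<subseteq>G. finite F \<and> sym F \<and> (a, b) \<in> F\<^sup>*"
  using assms(2)
proof induction
  case base
  show ?case by (intro exI[of _ "{}"]) (auto simp: sym_def)
next
  case (step y z)
  then obtain F where F: "F \<subseteq> G" "finite F" "sym F" "(a, y) \<in> F\<^sup>*" by blast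
  let ?F = "F \<union> {(y, z), (z, y)}"
  have "(a, y) \<in> ?F\<^sup>*" using F(4) rtrancl_mono[of F ?F] by blast
  then have "(a, z) \<in> ?F\<^sup>*" by (rule rtrancl_into_rtrancl) blast
  moreover have "?F \<subseteq> G" using F(1) step(2) assms(1) by (auto dest: symD)
  moreover have "finite ?F" using F(2) by simp
  moreover have "sym ?F" using F(3) unfolding sym_def by blast
  ultimately show ?case by blast
qed

text \<open>A connector of least cardinality is taken. A nonempty even set avoiding the edge
  \<open>(a, b)\<close> would lie inside it, and one of its edges could be dropped without
  disconnecting \<open>a\<close> from \<open>b\<close>.\<close>

lemma minimal_connector:
  assumes "sym G" "(a, b) \<in> G\<^sup>*"
  obtains F where "F \<subseteq> G" "finite F" "sym F" "(a, b) \<in> F\<^sup>*"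
    "\<And>Q. even_edges Q \<Longrightarrow> Q \<noteq> {} \<Longrightarrow> Q \<subseteq> F \<union> {(a, b), (b, a)} \<Longrightarrow> (a, b) \<in> Q"
proof -
  define ok where "ok F \<longleftrightarrow> F \<subseteq> G \<and> finite F \<and> sym F \<and> (a, b) \<in> F\<^sup>*" for F
  have "\<exists>F. ok F" using finite_sym_connector[OF assms(1,2)] unfolding ok_def by blast
  then obtain F where F: "ok F" and least: "\<And>F'. ok F' \<Longrightarrow> card F \<le> card F'"
    using ex_has_least_nat[of ok _ card] by blast
  have "(a, b) \<in> Q" if Q: "even_edges Q" "Q \<noteq> {}" "Q \<subseteq> F \<union> {(a, b), (b, a)}" for Q
  proof (rule ccontr)
    assume nab: "(a, b) \<notin> Q"
    have symQ: "sym Q" using Q(1) unfolding even_edges_def by blast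
    then have "(b, a) \<notin> Q" using nab by (auto dest: symD)
    then have QF: "Q \<subseteq> F" using Q(3) nab by blast
    obtain u v where uv: "(u, v) \<in> Q" using Q(2) by auto
    let ?F = "F - {(u, v), (v, u)}"
    have mono: "(Q - {(u, v), (v, u)})\<^sup>* \<subseteq> ?F\<^sup>*" using QF by (intro rtrancl_mono) blast
    have vu: "(v, u) \<in> Q" using uv symQ by (auto dest: symD)
    have "(u, v) \<in> ?F\<^sup>*" using even_edges_on_cycle[OF Q(1) uv] mono by blast
    moreover have "(v, u) \<in> ?F\<^sup>*"
      using even_edges_on_cycle[OF Q(1) vu] mono by (auto simp: insert_commute)
    ultimately have "F \<subseteq> ?F\<^sup>*" by auto
    then have "F\<^sup>* \<subseteq> ?F\<^sup>*" using rtrancl_subset_rtrancl by blast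
    then have "ok ?F" using F unfolding ok_def sym_def by auto
    moreover have "card ?F < card F"
      using F uv QF unfolding ok_def by (intro psubset_card_mono) auto
    ultimately show False using least by fastforce
  qed
  then show ?thesis using that[of F] F unfolding ok_def by blast
qed

text \<open>The inverse \<open>\<tau>\<close> is a parameter of its own, which makes the assumptions
  symmetric: by \<open>swapped\<close>, every result also holds with the two graphings
  exchanged.\<close>

locale dual_planar_graphings =
  fixes M :: "'a::polish_space measure" and Ms :: "'b::polish_space measure"
    and E :: "('a \<times> 'a) set" and Es :: "('b \<times> 'b) set"
    and FC :: "('a \<times> 'a) set set" and FCs :: "('b \<times> 'b) set set"
    and \<sigma> :: "'a \<times> 'a \<Rightarrow> 'b \<times> 'b" and \<tau> :: "'b \<times> 'b \<Rightarrow> 'a \<times> 'a"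
  assumes planar: "planar_graphing M E FC" and planar_dual: "planar_graphing Ms Es FCs"
    and dual: "dual_via M E FC Ms Es \<sigma>" and dual_dual: "dual_via Ms Es FCs M E \<tau>"
    and \<tau>_\<sigma>: "\<And>e. e \<in> E \<Longrightarrow> \<tau> (\<sigma> e) = e" and \<sigma>_\<tau>: "\<And>e. e \<in> Es \<Longrightarrow> \<sigma> (\<tau> e) = e"
    and hyp: "hyperfinite M E" and hyp_dual: "hyperfinite Ms Es"
begin

lemma swapped: "dual_planar_graphings Ms M Es E FCs FC \<tau> \<sigma>"
  by unfold_locales (use planar planar_dual dual dual_dual \<tau>_\<sigma> \<sigma>_\<tau> hyp hyp_dual in auto)

sublocale graphing_on M E
  by unfold_locales (use planar in \<open>simp add: planar_graphing_def\<close>)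

sublocale dual: graphing_on Ms Es
  by unfold_locales (use planar_dual in \<open>simp add: planar_graphing_def\<close>)

section \<open>Faces as dual vertices, and edge sets under \<open>\<sigma>\<close>\<close>

lemma faceD: "C \<in> FC \<Longrightarrow> C \<subseteq> E" "C \<in> FC \<Longrightarrow> is_cycle_edges C"
proof -
  have "\<exists>L::nat. \<forall>C\<in>FC. C \<subseteq> E \<and> is_cycle_edges C \<and> card C \<le> L"
    using planar unfolding planar_graphing_def by (elim conjE)
  then show "C \<in> FC \<Longrightarrow> C \<subseteq> E" "C \<in> FC \<Longrightarrow> is_cycle_edges C" by auto
qed

lemma bij_\<sigma>: "bij_betw \<sigma> E Es"
  using dual unfolding dual_via_def by (elim conjE)

lemma \<sigma>_in: "e \<in> E \<Longrightarrow> \<sigma> e \<in> Es"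
  using bij_\<sigma> by (rule bij_betw_apply)

lemma \<sigma>_swap: "(x, y) \<in> E \<Longrightarrow> \<sigma> (y, x) = prod.swap (\<sigma> (x, y))"
proof -
  have "\<forall>(x, y)\<in>E. \<sigma> (y, x) = prod.swap (\<sigma> (x, y))" using dual unfolding dual_via_def by (elim conjE)
  then show "(x, y) \<in> E \<Longrightarrow> \<sigma> (y, x) = prod.swap (\<sigma> (x, y))" by auto
qed

lemma edge_measure_\<sigma>: "borel_edges M E A \<Longrightarrow> edge_measure Ms (\<sigma> ` A) = edge_measure M A"
  using dual unfolding dual_via_def by (elim conjE) simp

lemma \<sigma>_ends_ne: "e \<in> E \<Longrightarrow> fst (\<sigma> e) \<noteq> snd (\<sigma> e)"
  using \<sigma>_in[of e] dual.irrefl_E by (metis prod.collapse)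

lemma face_vertex:
  obtains \<phi> where "inj_on \<phi> FC" "\<phi> ` FC = UNIV"
    "\<And>e. e \<in> E \<Longrightarrow> \<phi> ` {C \<in> FC. e \<in> C} = {fst (\<sigma> e), snd (\<sigma> e)}"
proof -
  have "\<exists>\<phi>. bij_betw \<phi> FC UNIV \<and> (\<forall>e\<in>E. {fst (\<sigma> e), snd (\<sigma> e)} = \<phi> ` {C \<in> FC. e \<in> C})"
    using dual unfolding dual_via_def by (elim conjE)
  then obtain \<phi> where \<phi>: "bij_betw \<phi> FC UNIV"
    "\<And>e. e \<in> E \<Longrightarrow> {fst (\<sigma> e), snd (\<sigma> e)} = \<phi> ` {C \<in> FC. e \<in> C}" by blast
  show ?thesis
    by (rule that[OF bij_betw_imp_inj_on[OF \<phi>(1)] bij_betw_imp_surj_on[OF \<phi>(1)] \<phi>(2)[symmetric]])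
qed

lemma sym_\<sigma>_image:
  assumes "A \<subseteq> E" "sym A"
  shows "sym (\<sigma> ` A)"
proof (rule symI)
  fix s t assume "(s, t) \<in> \<sigma> ` A"
  then obtain x y where xy: "(x, y) \<in> A" "\<sigma> (x, y) = (s, t)" by auto
  then have "\<sigma> (y, x) = (t, s)" using \<sigma>_swap[of x y] assms(1) by auto
  moreover have "(y, x) \<in> A" using xy assms(2) by (auto dest: symD)
  ultimately show "(t, s) \<in> \<sigma> ` A" by (metis imageI)
qed

lemma \<sigma>_image_eq:
  assumes "A \<subseteq> E"
  shows "\<sigma> ` A = {e \<in> Es. \<tau> e \<in> A}"
proof (intro set_eqI iffI)
  fix e assume "e \<in> \<sigma> ` A"
  then obtain a where a: "a \<in> A" "e = \<sigma> a" by blast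
  then show "e \<in> {e \<in> Es. \<tau> e \<in> A}" using \<sigma>_in[of a] \<tau>_\<sigma>[of a] assms by auto
next
  fix e assume "e \<in> {e \<in> Es. \<tau> e \<in> A}"
  then show "e \<in> \<sigma> ` A" using \<sigma>_\<tau>[of e] by (auto intro: rev_image_eqI)
qed

text \<open>The image under \<open>\<sigma>\<close> is a preimage under the measurable map
  \<open>\<tau>\<close>.\<close>

lemma borel_edges_\<sigma>:
  assumes A: "borel_edges M E A"
  shows "borel_edges Ms Es (\<sigma> ` A)"
proof (rule dual.borel_edgesI)
  note AE = borel_edgesD(1)[OF A]
  show "\<sigma> ` A \<subseteq> Es" using \<sigma>_in AE by blast
  show "sym (\<sigma> ` A)" by (rule sym_\<sigma>_image[OF AE borel_edgesD(2)[OF A]])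
  have meas: "\<tau> \<in> measurable (restrict_space (Ms \<Otimes>\<^sub>M Ms) Es) (M \<Otimes>\<^sub>M M)"
    using dual_dual unfolding dual_via_def by (elim conjE)
  have "A \<in> sets (M \<Otimes>\<^sub>M M)" using A unfolding borel_edges_def by blast
  from measurable_sets[OF meas this]
  have "\<tau> -` A \<inter> space (restrict_space (Ms \<Otimes>\<^sub>M Ms) Es) \<in> sets (restrict_space (Ms \<Otimes>\<^sub>M Ms) Es)" .
  moreover have sp: "space (Ms \<Otimes>\<^sub>M Ms) = UNIV" by (simp add: space_pair_measure dual.space_M)
  moreover have "\<tau> -` A \<inter> Es = \<sigma> ` A" using \<sigma>_image_eq[OF AE] by auto
  ultimately have "\<sigma> ` A \<in> sets (restrict_space (Ms \<Otimes>\<^sub>M Ms) Es)"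
    by (simp add: space_restrict_space)
  moreover have "Es \<inter> space (Ms \<Otimes>\<^sub>M Ms) \<in> sets (Ms \<Otimes>\<^sub>M Ms)"
    using dual.E_borel unfolding sp dual.sets_pair_M by simp
  ultimately have "\<sigma> ` A \<in> sets (Ms \<Otimes>\<^sub>M Ms)" using sets_restrict_space_iff by blast
  then show "\<sigma> ` A \<in> sets borel" unfolding dual.sets_pair_M .
qed

text \<open>The vertex \<open>x\<close> corresponds to one facial cycle of the dual; the duals of
  all edges at \<open>x\<close> lie on it, and a cycle is connected.\<close>

lemma star_dual_connected:
  assumes "(x, y) \<in> E" "(x, z) \<in> E"
  shows "(fst (\<sigma> (x, y)), fst (\<sigma> (x, z))) \<in> Es\<^sup>*"
proof -
  interpret sw: dual_planar_graphings Ms M Es E FCs FC \<tau> \<sigma> by (rule swapped)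
  obtain \<psi> where \<psi>: "inj_on \<psi> FCs" "\<And>e. e \<in> Es \<Longrightarrow> \<psi> ` {C \<in> FCs. e \<in> C} = {fst (\<tau> e), snd (\<tau> e)}"
    using sw.face_vertex by metis
  have face: "\<exists>C\<in>FCs. \<psi> C = x \<and> \<sigma> (x, w) \<in> C" if "(x, w) \<in> E" for w
  proof -
    have "x \<in> \<psi> ` {C \<in> FCs. \<sigma> (x, w) \<in> C}" using \<psi>(2)[OF \<sigma>_in[OF that]] \<tau>_\<sigma>[OF that] by simp
    then show ?thesis by blast
  qed
  obtain C where C: "C \<in> FCs" "\<psi> C = x" "\<sigma> (x, y) \<in> C" using face[OF assms(1)] by blast
  obtain C' where C': "C' \<in> FCs" "\<psi> C' = x" "\<sigma> (x, z) \<in> C'" using face[OF assms(2)] by blast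
  have "C' = C" using inj_onD[OF \<psi>(1), of C' C] C C' by simp
  moreover have "fst e \<in> Domain C" if "e \<in> C" for e using that by (metis Domain.DomainI prod.collapse)
  ultimately have "(fst (\<sigma> (x, y)), fst (\<sigma> (x, z))) \<in> C\<^sup>*"
    using C C' by (intro is_cycle_edgesD(6)[OF sw.faceD(2)]) auto
  then show ?thesis using rtrancl_mono[OF sw.faceD(1)[OF C(1)]] by blast
qed

text \<open>If every edge lay in an even number of members of \<open>D\<close>, the dual vertices
  \<open>W\<close> of \<open>D\<close> would be closed under dual edges. Stars are connected in the
  dual, so \<open>W\<close> would spread from \<open>Z\<close> along the primal component to all
  faces in it, including \<open>Z'\<close>.\<close>

lemma ex_separating_edge:
  assumes D: "D \<subseteq> FC" and Z: "Z \<in> D" "Z \<subseteq> comp E a \<times> comp E a"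
    and Z': "Z' \<in> FC - D" "Z' \<subseteq> comp E a \<times> comp E a"
  shows "\<exists>e\<in>E. odd (card {Z \<in> D. e \<in> Z})"
proof (rule ccontr)
  assume none: "\<not> ?thesis"
  obtain \<phi> where \<phi>: "inj_on \<phi> FC" "\<And>e. e \<in> E \<Longrightarrow> \<phi> ` {C \<in> FC. e \<in> C} = {fst (\<sigma> e), snd (\<sigma> e)}"
    using face_vertex by metis
  define W where "W = \<phi> ` D"
  have both: "fst (\<sigma> e) \<in> W \<longleftrightarrow> snd (\<sigma> e) \<in> W" if "e \<in> E" for e
    using none that odd_card_image[OF \<phi>(1) D \<phi>(2)[OF that] \<sigma>_ends_ne[OF that]] unfolding W_def by blast
  have Wcl: "t \<in> W" if "(s, t) \<in> Es" "s \<in> W" for s t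
  proof -
    have "\<tau> (s, t) \<in> E" "\<sigma> (\<tau> (s, t)) = (s, t)"
      using that(1) \<sigma>_\<tau> dual_planar_graphings.\<sigma>_in[OF swapped] by auto
    then show ?thesis using both[of "\<tau> (s, t)"] that(2) by simp
  qed
  have Wstar: "t \<in> W" if "(s, t) \<in> Es\<^sup>*" "s \<in> W" for s t
    using that by induction (auto intro: Wcl)
  have inW: "fst (\<sigma> e) \<in> W" if "e \<in> C" "C \<in> FC" "C \<in> D" for e C
  proof -
    have "e \<in> E" using faceD(1) that by blast
    then have "\<phi> C \<in> {fst (\<sigma> e), snd (\<sigma> e)}" using \<phi>(2) that by blast
    moreover have "\<phi> C \<in> W" using that(3) unfolding W_def by blast
    ultimately show ?thesis using both[OF \<open>e \<in> E\<close>] by auto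
  qed
  have ZF: "Z \<in> FC" using Z D by blast
  obtain x y where xy: "(x, y) \<in> Z" using is_cycle_edgesD(2)[OF faceD(2)[OF ZF]] by auto
  obtain u v where uv: "(u, v) \<in> Z'" using is_cycle_edgesD(2)[OF faceD(2)] Z' by fastforce
  have xyE: "(x, y) \<in> E" using xy faceD(1)[OF ZF] by blast
  have uvE: "(u, v) \<in> E" using uv faceD(1)[of Z'] Z' by blast
  define w where "w z \<longleftrightarrow> (\<forall>z'. (z, z') \<in> E \<longrightarrow> fst (\<sigma> (z, z')) \<in> W)" for z
  have w1: "w z" if "(z, z') \<in> E" "fst (\<sigma> (z, z')) \<in> W" for z z'
    unfolding w_def using star_dual_connected[OF that(1)] Wstar that(2) by blast
  have wstep: "w z'" if "(z, z') \<in> E" "w z" for z z'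
  proof -
    have "snd (\<sigma> (z, z')) \<in> W" using that both[OF that(1)] unfolding w_def by blast
    then have "fst (\<sigma> (z', z)) \<in> W" using \<sigma>_swap[OF that(1)] by simp
    moreover have "(z', z) \<in> E" using that(1) sym_E by (auto dest: symD)
    ultimately show ?thesis using w1 by blast
  qed
  have "x \<in> comp E a" "u \<in> comp E a" using xy uv Z Z' by auto
  then have "u \<in> comp E x" using comp_eq[OF sym_E, of x a] by simp
  moreover have "w x" by (rule w1[OF xyE inW[OF xy ZF Z(1)]])
  ultimately have "w u" using comp_subset_closed[of x "Collect w" E] wstep by auto
  then have "fst (\<sigma> (u, v)) \<in> W" "snd (\<sigma> (u, v)) \<in> W" using uvE both[OF uvE] unfolding w_def by auto
  moreover have "\<phi> Z' \<in> {fst (\<sigma> (u, v)), snd (\<sigma> (u, v))}" using \<phi>(2)[OF uvE] uv Z' by blast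
  ultimately have "\<phi> Z' \<in> \<phi> ` D" unfolding W_def by auto
  then show False using inj_onD[OF \<phi>(1)] Z' D by blast
qed

lemma countable_comp: "countable (comp E a)"
  unfolding comp_eq_UN_nball
  by (intro countable_UN countableI_type countable_finite finite_nball[OF borel_edges_E])

lemma even_edges_odd_sum:
  assumes "D \<subseteq> FC" "finite D"
  shows "even_edges (odd_sum D)"
proof -
  have cyc: "is_cycle_edges Z" if "Z \<in> D" for Z using faceD(2) assms(1) that by blast
  have "finite (odd_sum D) \<and> (\<forall>x. even (card (odd_sum D `` {x})))"
    using is_cycle_edgesD(1,5)[OF cyc] by (intro odd_sum_even_degrees assms)
  moreover have "sym (odd_sum D)" using is_cycle_edgesD(3)[OF cyc] by (intro sym_odd_sum)
  moreover have "(x, x) \<notin> odd_sum D" for x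
    using odd_sum_subset[of D] is_cycle_edgesD(4)[OF cyc] by blast
  ultimately show ?thesis unfolding even_edges_def by blast
qed

text \<open>
  An arc through a minimal connector of \<open>a\<close> and \<open>b\<close> closes up with the edge \<open>(a, b)\<close> to a Jordan curve.
  Summing the facial cycles of the faces inside it gives an even set inside connector and edge, and by
  minimality of the connector such a set contains \<open>(a, b)\<close> unless it is empty. If some facial cycle
  bounds faces on both sides, that cycle is taken instead.
\<close>
lemma cycle_face_sum:
  assumes ab: "(a, b) \<in> E" and F: "F \<subseteq> E" "sym F" and path: "(a, b) \<in> (F - {(a, b), (b, a)})\<^sup>*"
  obtains D where "D \<subseteq> FC" "finite D" "odd_sum D \<subseteq> F \<union> {(a, b), (b, a)}" "(a, b) \<in> odd_sum D"
proof -
  define K where "K = comp E a"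
  define Ed where "Ed = E \<inter> K \<times> K"
  \<comment> \<open>The drawing covers only the component of \<open>a\<close>; a walk from
    \<open>a\<close> stays inside it.\<close>
  define G where "G = (F - {(a, b), (b, a)}) \<inter> K \<times> K"
  have aK: "a \<in> K" unfolding K_def by (rule comp_self)
  have Kcl: "y \<in> K" if "x \<in> K" "(x, y) \<in> E" for x y using that comp_step unfolding K_def by fast
  have symG: "sym G" using F(2) unfolding G_def sym_def by blast
  have "comp (F - {(a, b), (b, a)}) a \<subseteq> comp G a \<inter> K"
  proof (rule comp_subset_closed)
    show "a \<in> comp G a \<inter> K" using aK comp_self[of a G] by simp
    fix x y assume xy: "(x, y) \<in> F - {(a, b), (b, a)}" "x \<in> comp G a \<inter> K"
    then have y: "y \<in> K" using Kcl F(1) by blast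
    then have "(x, y) \<in> G" using xy unfolding G_def by blast
    then show "y \<in> comp G a \<inter> K" using comp_step[of x G a y] xy y by blast
  qed
  then have pathG: "(a, b) \<in> G\<^sup>*" using path unfolding comp_def by blast
  have abG: "(a, b) \<notin> G" "(b, a) \<notin> G" unfolding G_def by blast+
  obtain F0 where F0: "F0 \<subseteq> G" "finite F0" "sym F0" "(a, b) \<in> F0\<^sup>*"
    and min: "\<And>Q. even_edges Q \<Longrightarrow> Q \<noteq> {} \<Longrightarrow> Q \<subseteq> F0 \<union> {(a, b), (b, a)} \<Longrightarrow> (a, b) \<in> Q"
    using minimal_connector[OF symG pathG] by blast
  have "\<forall>x. \<exists>p c. plane_drawing (comp E x) (E \<inter> (comp E x \<times> comp E x)) p c \<and>
          face_boundary (E \<inter> (comp E x \<times> comp E x)) c `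
              faces (comp E x) (E \<inter> (comp E x \<times> comp E x)) p c
            = {C \<in> FC. C \<subseteq> E \<inter> (comp E x \<times> comp E x)}"
    using planar unfolding planar_graphing_def by (elim conjE)
  from spec[OF this, of a, folded K_def, folded Ed_def]
  obtain p c where dr: "plane_drawing K Ed p c"
    and bd: "face_boundary Ed c ` faces K Ed p c = {C \<in> FC. C \<subseteq> Ed}"
    by (elim exE conjE)
  have Ed: "Ed \<subseteq> K \<times> K" "sym Ed" "\<And>x. (x, x) \<notin> Ed" "(a, b) \<in> Ed"
    using sym_E irrefl_E ab aK Kcl unfolding Ed_def by (auto simp: sym_def)
  have F0Ed: "F0 \<subseteq> Ed" using F0(1) F(1) unfolding G_def Ed_def by blast
  have cK: "countable K" unfolding K_def by (rule countable_comp)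
  have nF0: "(a, b) \<notin> F0" "(b, a) \<notin> F0" using F0(1) abG by blast+
  obtain I J V0 where IJ: "I \<inter> J = {}"
    "\<And>f. f \<in> faces K Ed p c \<Longrightarrow> f \<subseteq> I \<or> f \<subseteq> J"
    "\<exists>f\<in>faces K Ed p c. f \<subseteq> I" "\<exists>f\<in>faces K Ed p c. f \<subseteq> J"
    and side: "\<And>e. e \<in> Ed - F0 - {(a, b), (b, a)} \<Longrightarrow> prod.swap e \<notin> F0 \<Longrightarrow>
       (\<forall>f\<in>faces K Ed p c. e \<in> face_boundary Ed c f \<longrightarrow> f \<subseteq> I) \<or>
       (\<forall>f\<in>faces K Ed p c. e \<in> face_boundary Ed c f \<longrightarrow> f \<subseteq> J)"
    and V0: "finite V0" "\<And>f. f \<subseteq> I \<Longrightarrow> face_boundary Ed c f \<subseteq> V0 \<times> V0"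
    using plane_drawing_separation[OF dr cK Ed(1-4) F0Ed nF0 F0(4)] by blast
  define FS where "FS = faces K Ed p c"
  define bdy where "bdy = face_boundary Ed c"
  note IJ = IJ[folded FS_def] and side = side[folded FS_def bdy_def] and bd = bd[folded FS_def bdy_def]
    and V0 = V0[folded bdy_def]
  have ne: "f \<noteq> {}" if "f \<in> FS" for f
    using that in_components_nonempty unfolding FS_def faces_def by blast
  define H where "H = F0 \<union> {(a, b), (b, a)}"
  have HF: "H \<subseteq> F \<union> {(a, b), (b, a)}" using F0(1) unfolding H_def G_def by blast
  have side': "(\<forall>f\<in>FS. e \<in> bdy f \<longrightarrow> f \<subseteq> I) \<or>
       (\<forall>f\<in>FS. e \<in> bdy f \<longrightarrow> f \<subseteq> J)"
    if "e \<in> Ed" "e \<notin> H" for e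
  proof (rule side)
    show "e \<in> Ed - F0 - {(a, b), (b, a)}" using that unfolding H_def by blast
    show "prod.swap e \<notin> F0" using that F0(3) unfolding H_def by (cases e) (auto dest: symD)
  qed
  have faceK: "C \<subseteq> Ed" if "C \<in> FC" "e \<in> C" "e \<in> Ed" for C e
    using cycle_subset_comp[OF faceD(2)[OF that(1)] faceD(1)[OF that(1)], of "fst e" "snd e" a] that
    unfolding Ed_def K_def by auto
  \<comment> \<open>The faces inside the curve have their boundaries on the finite vertex set
    \<open>V0\<close>, so \<open>D\<close> is finite. The outside family \<open>D'\<close> supplies
    a facial cycle not in \<open>D\<close>.\<close>
  define D where "D = {bdy f |f. f \<in> FS \<and> f \<subseteq> I}"
  define D' where "D' = {bdy f |f. f \<in> FS \<and> f \<subseteq> J}"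
  have un: "D \<union> D' = {C \<in> FC. C \<subseteq> Ed}" unfolding bd[symmetric] D_def D'_def using IJ(2) by blast
  have DE: "C \<subseteq> Ed" if "C \<in> D \<union> D'" for C using that unfolding un by blast
  have "D \<subseteq> Pow (V0 \<times> V0)" unfolding D_def using V0(2) by blast
  then have finD: "finite D" using V0(1) by (meson finite_Pow_iff finite_SigmaI finite_subset)
  have DFC: "D \<subseteq> FC" using un by blast
  have both: "C \<subseteq> H" if C: "C \<in> D" "C \<in> D'" for C
  proof
    fix e assume e: "e \<in> C"
    obtain f where f: "f \<in> FS" "f \<subseteq> I" "C = bdy f" using C(1) unfolding D_def by blast
    obtain f' where f': "f' \<in> FS" "f' \<subseteq> J" "C = bdy f'" using C(2) unfolding D'_def by blast
    show "e \<in> H"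
    proof (rule ccontr)
      assume "e \<notin> H"
      moreover have "e \<in> Ed" using e DE C by blast
      ultimately have "f' \<subseteq> I \<or> f \<subseteq> J" using side' e f f' by blast
      then show False using ne[OF f(1)] ne[OF f'(1)] f(2) f'(2) IJ(1) by blast
    qed
  qed
  have sub: "odd_sum D \<subseteq> H"
  proof
    fix e assume e: "e \<in> odd_sum D"
    then obtain Z where Z: "Z \<in> D" "e \<in> Z" using odd_sum_subset[of D] by blast
    then have eEd: "e \<in> Ed" using DE by blast
    then have eE: "e \<in> E" unfolding Ed_def by blast
    obtain f where f: "f \<in> FS" "f \<subseteq> I" "Z = bdy f" using Z(1) unfolding D_def by blast
    show "e \<in> H"
    proof (rule ccontr)
      assume "e \<notin> H"
      then consider "\<forall>f\<in>FS. e \<in> bdy f \<longrightarrow> f \<subseteq> I" | "f \<subseteq> J"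
        using side'[OF eEd] f Z(2) by blast
      then show False
      proof cases
        \<comment> \<open>Every face bounded by \<open>e\<close> is inside, so \<open>D\<close>
          contains both facial cycles through \<open>e\<close>, an even number.\<close>
        case 1
        have "{Z \<in> D. e \<in> Z} = {Z \<in> FC. e \<in> Z}"
        proof
          show "{Z \<in> FC. e \<in> Z} \<subseteq> {Z \<in> D. e \<in> Z}"
          proof clarify
            fix C assume C: "C \<in> FC" "e \<in> C"
            then have "C \<in> bdy ` FS" unfolding bd using faceK eEd by blast
            then show "C \<in> D" using 1 C(2) unfolding D_def by blast
          qed
        qed (use DFC in blast)
        moreover obtain \<phi> where \<phi>: "inj_on \<phi> FC" "\<And>e. e \<in> E \<Longrightarrow> \<phi> ` {C \<in> FC. e \<in> C} = {fst (\<sigma> e), snd (\<sigma> e)}"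
          using face_vertex by metis
        have "inj_on \<phi> {Z \<in> FC. e \<in> Z}" by (rule inj_on_subset[OF \<phi>(1)]) blast
        then have "card {Z \<in> FC. e \<in> Z} = card {fst (\<sigma> e), snd (\<sigma> e)}"
          using card_image \<phi>(2)[OF eE] by metis
        then have "card {Z \<in> FC. e \<in> Z} = 2" using \<sigma>_ends_ne[OF eE] by simp
        ultimately show False using e unfolding odd_sum_def by simp
      next
        case 2
        then show False using ne[OF f(1)] f(2) IJ(1) by blast
      qed
    qed
  qed
  show ?thesis
  proof (cases "D \<inter> D' = {}")
    case False
    then obtain Z where Z: "Z \<in> D" "Z \<in> D'" by blast
    have "odd_sum {Z} = Z"
      using odd_sum_insert[of "{}" Z] by (simp add: odd_sum_def)
    moreover have "even_edges (odd_sum {Z})" using Z DFC by (intro even_edges_odd_sum) auto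
    moreover have "Z \<noteq> {}" using is_cycle_edgesD(2)[OF faceD(2)] Z DFC by blast
    moreover have "Z \<subseteq> H" by (rule both[OF Z])
    ultimately have "(a, b) \<in> odd_sum {Z}" "odd_sum {Z} \<subseteq> H" using min[of Z] unfolding H_def by auto
    then show ?thesis using that[of "{Z}"] Z DFC HF by blast
  next
    case True
    \<comment> \<open>Facial cycles exist on both sides, so \<open>D\<close> is neither empty nor
      everything in this component, and its sum cannot vanish.\<close>
    obtain Z where Z: "Z \<in> D" using IJ(3) unfolding D_def by blast
    obtain Z' where Z': "Z' \<in> D'" using IJ(4) unfolding D'_def by blast
    have "Z \<subseteq> comp E a \<times> comp E a" "Z' \<subseteq> comp E a \<times> comp E a"
      using DE[of Z] DE[of Z'] Z Z' unfolding Ed_def K_def by blast+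
    moreover have "Z' \<in> FC - D" using Z' True un by blast
    ultimately have "\<exists>e\<in>E. odd (card {Z \<in> D. e \<in> Z})" using ex_separating_edge[OF DFC Z] by blast
    then have "odd_sum D \<noteq> {}" unfolding odd_sum_def by blast
    then have "(a, b) \<in> odd_sum D" using min[OF even_edges_odd_sum[OF DFC finD]] sub unfolding H_def by blast
    then show ?thesis using that[of D] DFC finD sub HF by blast
  qed
qed

section \<open>Forests, cuts and independence across the duality\<close>

lemma forest_complement_comp:
  assumes T: "T \<subseteq> E" "sym T" "\<And>Q. even_edges Q \<Longrightarrow> Q \<subseteq> T \<Longrightarrow> Q = {}"
    and fin: "finite (comp (Es - \<sigma> ` T) s)"
  shows "comp (Es - \<sigma> ` T) s = comp Es s"
proof (rule ccontr)
  define W where "W = comp (Es - \<sigma> ` T) s"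
  assume "comp (Es - \<sigma> ` T) s \<noteq> comp Es s"
  then have "\<not> comp Es s \<subseteq> W" using comp_mono[of "Es - \<sigma> ` T" Es s] unfolding W_def by blast
  moreover have "s \<in> W" unfolding W_def by (rule comp_self)
  ultimately obtain r t where rt: "(r, t) \<in> Es" "r \<in> W" "t \<notin> W"
    using comp_subset_closed[of s W Es] by blast
  obtain \<phi> where \<phi>: "inj_on \<phi> FC" "\<phi> ` FC = UNIV"
    "\<And>e. e \<in> E \<Longrightarrow> \<phi> ` {C \<in> FC. e \<in> C} = {fst (\<sigma> e), snd (\<sigma> e)}"
    using face_vertex by metis
  define D where "D = {Z \<in> FC. \<phi> Z \<in> W}"
  have DFC: "D \<subseteq> FC" unfolding D_def by blast
  have "\<phi> ` D \<subseteq> W" unfolding D_def by blast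
  moreover have "w \<in> \<phi> ` D" if "w \<in> W" for w
  proof -
    have "w \<in> \<phi> ` FC" using \<phi>(2) by simp
    then show ?thesis using that unfolding D_def by blast
  qed
  ultimately have \<phi>D: "\<phi> ` D = W" by blast
  have "finite (\<phi> ` D)" unfolding \<phi>D W_def by (rule fin)
  then have finD: "finite D" using finite_imageD inj_on_subset[OF \<phi>(1) DFC] by blast
  have mem: "e \<in> odd_sum D \<longleftrightarrow> (fst (\<sigma> e) \<in> W) \<noteq> (snd (\<sigma> e) \<in> W)" if "e \<in> E" for e
    using odd_card_image[OF \<phi>(1) DFC \<phi>(3)[OF that] \<sigma>_ends_ne[OF that]] unfolding odd_sum_def \<phi>D by simp
  have symT: "sym (Es - \<sigma> ` T)"
    using sym_\<sigma>_image[OF T(1,2)] dual.sym_E unfolding sym_def by blast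
  have "odd_sum D \<subseteq> T"
  proof
    fix e assume e: "e \<in> odd_sum D"
    then have eE: "e \<in> E" using odd_sum_subset[of D] DFC faceD(1) by blast
    obtain s' t' where st: "\<sigma> e = (s', t')" by (cases "\<sigma> e")
    have cr: "(s' \<in> W) \<noteq> (t' \<in> W)" using mem[OF eE] e st by simp
    have "(s', t') \<in> \<sigma> ` T"
    proof (rule ccontr)
      assume "(s', t') \<notin> \<sigma> ` T"
      then have "(s', t') \<in> Es - \<sigma> ` T" using \<sigma>_in[OF eE] st by simp
      moreover then have "(t', s') \<in> Es - \<sigma> ` T" using symT by (auto dest: symD)
      ultimately show False using cr comp_step[of _ "Es - \<sigma> ` T" s] unfolding W_def by blast
    qed
    then obtain e' where "e' \<in> T" "\<sigma> e' = \<sigma> e" using st by auto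
    then have "e' = e" using \<tau>_\<sigma>[of e] \<tau>_\<sigma>[of e'] eE T(1) by auto
    then show "e \<in> T" using \<open>e' \<in> T\<close> by simp
  qed
  then have "odd_sum D = {}" by (rule T(3)[OF even_edges_odd_sum[OF DFC finD]])
  moreover have "\<tau> (r, t) \<in> E" using dual_planar_graphings.\<sigma>_in[OF swapped rt(1)] .
  then have "\<tau> (r, t) \<in> odd_sum D" using mem[of "\<tau> (r, t)"] \<sigma>_\<tau>[OF rt(1)] rt(2,3) by simp
  ultimately show False by blast
qed

text \<open>A cycle through the dual of \<open>(x, y)\<close> that avoids the dual of
  \<open>T\<close> yields, by \<open>cycle_face_sum\<close> in the dual, a finite set
  \<open>W\<close> of primal vertices that separates \<open>x\<close> from \<open>y\<close> and is
  crossed by no edge of \<open>T\<close>. But \<open>T\<close> joins \<open>x\<close> to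
  \<open>y\<close>.\<close>

lemma dual_independent:
  assumes B: "B \<subseteq> E" "sym B" and T: "T \<subseteq> B" "sym T" "\<And>x. comp T x = comp B x"
  shows "independent_over (\<sigma> ` (E - B)) (\<sigma> ` (B - T))"
proof -
  interpret sw: dual_planar_graphings Ms M Es E FCs FC \<tau> \<sigma> by (rule swapped)
  have inj: "inj_on \<sigma> E" using bij_\<sigma> unfolding bij_betw_def by blast
  have un: "\<sigma> ` (E - B) \<union> \<sigma> ` (B - T) = \<sigma> ` (E - T)" using B(1) T(1) by blast
  have "\<sigma> ` (E - B) \<inter> \<sigma> ` (B - T) = \<sigma> ` ((E - B) \<inter> (B - T))"
    using inj B(1) by (intro inj_on_image_Int[symmetric]) auto
  then have disj: "\<sigma> ` (E - B) \<inter> \<sigma> ` (B - T) = {}" by auto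
  have "(s, t) \<notin> (\<sigma> ` (E - T) - {(s, t), (t, s)})\<^sup>*" if st: "(s, t) \<in> \<sigma> ` (B - T)" for s t
  proof
    assume path: "(s, t) \<in> (\<sigma> ` (E - T) - {(s, t), (t, s)})\<^sup>*"
    obtain x y where xy: "(x, y) \<in> B - T" "\<sigma> (x, y) = (s, t)" using st by auto
    have ET: "E - T \<subseteq> E" "sym (E - T)" using sym_E T(2) unfolding sym_def by blast+
    have symF: "sym (\<sigma> ` (E - T))" by (rule sym_\<sigma>_image[OF ET])
    have stF: "(s, t) \<in> \<sigma> ` (E - T)" using st un by blast
    then have tsF: "(t, s) \<in> \<sigma> ` (E - T)" using symF by (auto dest: symD)
    have FEs: "\<sigma> ` (E - T) \<subseteq> Es" using \<sigma>_in by blast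
    obtain D where D: "D \<subseteq> FCs" "finite D" "odd_sum D \<subseteq> \<sigma> ` (E - T) \<union> {(s, t), (t, s)}" "(s, t) \<in> odd_sum D"
      using sw.cycle_face_sum[OF _ FEs symF path] stF FEs by blast
    have DF: "odd_sum D \<subseteq> \<sigma> ` (E - T)" using D(3) stF tsF by blast
    obtain \<psi> where \<psi>: "inj_on \<psi> FCs" "\<And>e. e \<in> Es \<Longrightarrow> \<psi> ` {C \<in> FCs. e \<in> C} = {fst (\<tau> e), snd (\<tau> e)}"
      using sw.face_vertex by metis
    \<comment> \<open>Facial cycles of the dual stand for primal vertices, so \<open>W\<close> is a
      vertex set and the sum over \<open>D\<close> is dual to the cut around it.\<close>
    define W where "W = \<psi> ` D"
    have mem: "\<sigma> (u, v) \<in> odd_sum D \<longleftrightarrow> (u \<in> W) \<noteq> (v \<in> W)" if uv: "(u, v) \<in> E" for u v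
      using odd_card_image[OF \<psi>(1) D(1) \<psi>(2)[OF \<sigma>_in[OF uv]] sw.\<sigma>_ends_ne[OF \<sigma>_in[OF uv]]] \<tau>_\<sigma>[OF uv]
      unfolding odd_sum_def W_def by simp
    have noT: "u \<in> W \<longleftrightarrow> v \<in> W" if uv: "(u, v) \<in> T" for u v
    proof (rule ccontr)
      assume "\<not> ?thesis"
      moreover have uvE: "(u, v) \<in> E" using uv T(1) B(1) by blast
      ultimately have "\<sigma> (u, v) \<in> \<sigma> ` (E - T)" using mem DF by blast
      then obtain e where "e \<in> E - T" "\<sigma> e = \<sigma> (u, v)" by auto
      then have "e = (u, v)" using inj_onD[OF inj, of e "(u, v)"] uvE by blast
      then show False using \<open>e \<in> E - T\<close> uv by blast
    qed
    have "(x, y) \<in> E" using xy B(1) by blast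
    then have cr: "(x \<in> W) \<noteq> (y \<in> W)" using mem[of x y] xy(2) D(4) by simp
    have "y \<in> comp B x" using xy comp_step[OF comp_self] by fast
    then have "y \<in> comp T x" using T(3) by simp
    moreover have "comp T x \<subseteq> {z. z \<in> W \<longleftrightarrow> x \<in> W}"
      using noT by (intro comp_subset_closed) auto
    ultimately show False using cr by blast
  qed
  then show ?thesis unfolding independent_over_def un using disj by blast
qed

section \<open>The rank identity\<close>

lemma duality_finite_comps:
  assumes B: "borel_edges M E B" and fc: "\<And>x. finite (comp B x)"
  shows "rank M B + edge_measure M (E - B) - rank Ms (\<sigma> ` (E - B)) = edge_measure M E - rank Ms Es"
proof -
  note BD = borel_edgesD[OF B]
  obtain T where bT: "borel_edges M E T" and T: "T \<subseteq> B" "\<And>x. comp T x = comp B x"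
    "\<And>Q. even_edges Q \<Longrightarrow> Q \<subseteq> T \<Longrightarrow> Q = {}"
    using ex_spanning_forest[OF B fc] by blast
  note TD = borel_edgesD[OF bT]
  have empty: "borel_edges M E {}" by (rule borel_edgesI) (auto simp: sym_def)
  have "independent_over {} T" by (rule independent_over_emptyI[OF TD(2,5) T(3)])
  then have rT: "rank M T = edge_measure M T"
    using rank_Un_finite_comps(2)[OF empty bT] fc T(2) rank_empty by simp
  have rB: "rank M B = rank M T" unfolding rank_def T(2) ..
  have bA: "borel_edges M E (E - B)" by (rule borel_edges_Diff[OF borel_edges_E B])
  have bR: "borel_edges M E (B - T)" by (rule borel_edges_Diff[OF B bT])
  \<comment> \<open>An infinite component forces an infinite one in the larger graph, and both then
    have cardinality 0.\<close>
  have "card (comp (Es - \<sigma> ` T) s) = card (comp Es s)" for s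
  proof (cases "finite (comp (Es - \<sigma> ` T) s)")
    case True
    then show ?thesis using forest_complement_comp[OF TD(1,2) T(3)] by simp
  next
    case False
    moreover have "comp (Es - \<sigma> ` T) s \<subseteq> comp Es s" by (rule comp_mono) blast
    ultimately have "infinite (comp Es s)" using finite_subset by blast
    then show ?thesis using False by simp
  qed
  then have rEs: "rank Ms (Es - \<sigma> ` T) = rank Ms Es" unfolding rank_def by simp
  have inj: "inj_on \<sigma> E" and im: "\<sigma> ` E = Es" using bij_\<sigma> unfolding bij_betw_def by blast+
  have "Es - \<sigma> ` T = \<sigma> ` (E - T)"
    unfolding im[symmetric] by (rule inj_on_image_set_diff[OF inj, symmetric]) (use TD(1) in auto)
  also have "\<dots> = \<sigma> ` (E - B) \<union> \<sigma> ` (B - T)" using BD(1) T(1) by blast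
  finally have "rank Ms Es = rank Ms (\<sigma> ` (E - B) \<union> \<sigma> ` (B - T))" using rEs by simp
  \<comment> \<open>Dual components may be infinite although those of \<open>B\<close> are finite,
    so the rank formula for hyperfinite graphings is used on this side.\<close>
  also have "\<dots> = rank Ms (\<sigma> ` (E - B)) + edge_measure Ms (\<sigma> ` (B - T))"
    by (rule dual.rank_Un(2)[OF hyp_dual borel_edges_\<sigma>[OF bA] borel_edges_\<sigma>[OF bR]
          dual_independent[OF BD(1,2) T(1) TD(2) T(2)]])
  also have "edge_measure Ms (\<sigma> ` (B - T)) = edge_measure M (B - T)" by (rule edge_measure_\<sigma>[OF bR])
  finally have rs: "rank Ms Es = rank Ms (\<sigma> ` (E - B)) + edge_measure M (B - T)" .
  have "edge_measure M ((B - T) \<union> T) = edge_measure M (B - T) + edge_measure M T"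
    by (rule edge_measure_Un[OF bR bT]) blast
  moreover have "(B - T) \<union> T = B" using T(1) by blast
  moreover have "edge_measure M ((E - B) \<union> B) = edge_measure M (E - B) + edge_measure M B"
    by (rule edge_measure_Un[OF bA B]) blast
  moreover have "(E - B) \<union> B = E" using BD(1) by blast
  ultimately show ?thesis using rs rT rB by simp
qed

text \<open>Cutting \<open>B\<close> along \<open>S n\<close> makes its components finite, while the
  complementary dual edge set grows by the image of \<open>B \<inter> S n\<close>, of measure
  \<open>\<delta> n\<close>. Since rank is monotone and grows by at most the measure added, the dual
  rank is squeezed, and only the primal graphing has to be exhausted.\<close>

lemma duality:
  assumes B: "borel_edges M E B"
  shows "rank M B + edge_measure M (E - B) - rank Ms (\<sigma> ` (E - B)) = edge_measure M E - rank Ms Es"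
proof -
  obtain S where S: "exhausts S" using hyperfinite_exhausts[OF hyp] .
  note BE = borel_edgesD(1)[OF B]
  note bS = exhaustsD(1)[OF S]
  define \<delta> where "\<delta> n = edge_measure M (B \<inter> S n)" for n
  have bD: "borel_edges M E (B - S n)" and bI: "borel_edges M E (B \<inter> S n)" for n
    by (rule borel_edges_Diff[OF B bS], rule borel_edges_Int[OF B bS])
  have bA: "borel_edges M E (E - B)" by (rule borel_edges_Diff[OF borel_edges_E B])
  have "edge_measure M B = edge_measure M (B - S n) + \<delta> n" for n
  proof -
    have "(B - S n) \<union> (B \<inter> S n) = B" by blast
    moreover have "(B - S n) \<inter> (B \<inter> S n) = {}" by blast
    ultimately show ?thesis using edge_measure_Un[OF bD[of n] bI[of n]] unfolding \<delta>_def by metis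
  qed
  then have \<delta>: "\<delta> n = edge_measure M B - edge_measure M (B - S n)" for n by (simp add: algebra_simps)
  have \<delta>0: "\<delta> \<longlonglongrightarrow> 0"
    unfolding \<delta>[abs_def] using tendsto_diff[OF tendsto_const edge_measure_exhaustion[OF S B]] by (metis (no_types) diff_self)
  have split: "E - (B - S n) = (E - B) \<union> (B \<inter> S n)" for n using BE by blast
  have \<eta>: "edge_measure M (E - (B - S n)) = edge_measure M (E - B) + \<delta> n" for n
    unfolding split \<delta>_def by (rule edge_measure_Un[OF bA bI]) blast
  define r where "r n = rank Ms (\<sigma> ` (E - (B - S n)))" for n
  have im: "\<sigma> ` (E - (B - S n)) = \<sigma> ` (E - B) \<union> \<sigma> ` (B \<inter> S n)" for n unfolding split by (rule image_Un)
  have lower: "rank Ms (\<sigma> ` (E - B)) \<le> r n" for n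
    unfolding r_def im
    by (rule dual.rank_mono[OF borel_edges_\<sigma>[OF bA] dual.borel_edges_Un[OF borel_edges_\<sigma>[OF bA] borel_edges_\<sigma>[OF bI]]]) blast
  have upper: "r n \<le> rank Ms (\<sigma> ` (E - B)) + \<delta> n" for n
    unfolding r_def im \<delta>_def edge_measure_\<sigma>[OF bI, symmetric]
    by (rule dual.rank_Un(1)[OF hyp_dual borel_edges_\<sigma>[OF bA] borel_edges_\<sigma>[OF bI]])
  have "r \<longlonglongrightarrow> rank Ms (\<sigma> ` (E - B))"
  proof (rule real_tendsto_sandwich)
    show "(\<lambda>_. rank Ms (\<sigma> ` (E - B))) \<longlonglongrightarrow> rank Ms (\<sigma> ` (E - B))" by simp
    show "(\<lambda>n. rank Ms (\<sigma> ` (E - B)) + \<delta> n) \<longlonglongrightarrow> rank Ms (\<sigma> ` (E - B))"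
      using tendsto_add[OF tendsto_const \<delta>0] by (metis (no_types) add_0_right)
  qed (use lower upper in auto)
  moreover have eq: "rank M (B - S n) + (edge_measure M (E - B) + \<delta> n) - r n = edge_measure M E - rank Ms Es" for n
    using duality_finite_comps[OF bD exhaustsD(3)[OF S BE]] unfolding \<eta> r_def by simp
  ultimately have "(\<lambda>n. rank M (B - S n) + (edge_measure M (E - B) + \<delta> n) - r n) \<longlonglongrightarrow>
      rank M B + (edge_measure M (E - B) + 0) - rank Ms (\<sigma> ` (E - B))"
    using rank_exhaustion[OF S B] \<delta>0 by (intro tendsto_intros)
  then show ?thesis unfolding eq using LIMSEQ_unique[OF tendsto_const] by fastforce
qed

lemma corank_eq_dual_rank:
  assumes A: "borel_edges M E A"
  shows "corank M E A = rank Ms (\<sigma> ` A)"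
proof -
  have "edge_measure M {} = 0" unfolding edge_measure_def nbrs_def by simp
  \<comment> \<open>Taking \<open>B = E\<close> leaves the empty dual edge set, of rank 0. The
    result is an Euler formula; it evaluates the constant for \<open>B = E - A\<close>.\<close>
  then have euler: "rank M E = edge_measure M E - rank Ms Es"
    using duality[OF borel_edges_E] dual.rank_empty by simp
  have "E - (E - A) = A" using borel_edgesD(1)[OF A] by blast
  then show ?thesis
    unfolding corank_def using duality[OF borel_edges_Diff[OF borel_edges_E A]] euler by simp
qed

end

theorem theorem1p6:
  fixes M :: "'a::polish_space measure" and Ms :: "'b::polish_space measure"
    and E :: "('a \<times> 'a) set" and Es :: "('b \<times> 'b) set"
    and FC :: "('a \<times> 'a) set set" and FCs :: "('b \<times> 'b) set set"
    and \<sigma> :: "'a \<times> 'a \<Rightarrow> 'b \<times> 'b"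
  assumes "prob_space M"
    and "planar_graphing M E FC"
    and "planar_graphing Ms Es FCs"
    and "dual_via M E FC Ms Es \<sigma>"
    and "dual_via Ms Es FCs M E (inv_into E \<sigma>)"
    and "hyperfinite M E"
    and "hyperfinite Ms Es"
  shows "\<forall>A. borel_edges M E A \<longrightarrow>
           corank M E A = rank Ms (\<sigma> ` A) \<and> corank Ms Es (\<sigma> ` A) = rank M A"
proof (intro allI impI)
  fix A assume A: "borel_edges M E A"
  have bij: "bij_betw \<sigma> E Es" using assms(4) unfolding dual_via_def by (elim conjE)
  interpret dual_planar_graphings M Ms E Es FC FCs \<sigma> "inv_into E \<sigma>"
  proof
    show "inv_into E \<sigma> (\<sigma> e) = e" if "e \<in> E" for e by (rule bij_betw_inv_into_left[OF bij that])
    show "\<sigma> (inv_into E \<sigma> e) = e" if "e \<in> Es" for e by (rule bij_betw_inv_into_right[OF bij that])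
  qed (use assms in auto)
  interpret sw: dual_planar_graphings Ms M Es E FCs FC "inv_into E \<sigma>" \<sigma> by (rule swapped)
  have "inv_into E \<sigma> ` \<sigma> ` A = A"
    using \<tau>_\<sigma> borel_edgesD(1)[OF A] by (force simp: image_iff)
  then show "corank M E A = rank Ms (\<sigma> ` A) \<and> corank Ms Es (\<sigma> ` A) = rank M A"
    using corank_eq_dual_rank[OF A] sw.corank_eq_dual_rank[OF borel_edges_\<sigma>[OF A]] by simp
qed

end
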